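(* Let $a,b,c,d,e,f,g,h$ be indeterminates, let $$ M=\begin{bmatrix} a&d&d&a\\ e&0&g&e\\ f&h&0&f\\ b&c&c&b \end{bmatrix}, $$ and let $R$ denote the irreducible polynomial $R:=abgh+acfg+bdeh+2cdef$. The matching generating functions of the first twelve Aztec diamonds weighted by $\mathrm{wt}_M$ are given by $$ \begin{aligned} M(AD_{0};\mathrm{wt}_M)&=1\\ M(AD_{1};\mathrm{wt}_M)&=de\\ M(AD_{2};\mathrm{wt}_M)&=abR\\ M(AD_{3};\mathrm{wt}_M)&=(de)^2abghR\\ M(AD_{4};\mathrm{wt}_M)&=2(ab)^2cdefR^3\\ M(AD_{5};\mathrm{wt}_M)&=2(de)^4(abgh)^2cfR^3\\ M(AD_{6};\mathrm{wt}_M)&=2^3(ab)^4(cdef)^3ghR^5\\ M(AD_{7};\mathrm{wt}_M)&=2^3(de)^7(abgh)^4(cf)^3R^5\\ M(AD_{8};\mathrm{wt}_M)&=2^5(ab)^7(cdef)^5(gh)^3R^8\\ M(AD_{9};\mathrm{wt}_M)&=2^5(de)^{10}(abgh)^7(cf)^5R^8\\ M(AD_{10};\mathrm{wt}_M)&=2^8(ab)^{10}(cdef)^8(gh)^5R^{12}\\ M(AD_{11};\mathrm{wt}_M)&=2^8(de)^{14}(abgh)^{10}(cf)^8R^{12}, \end{aligned} $$ and for higher orders we have the recurrences $$ M(AD_{2n};\mathrm{wt}_M)=2^{4n-12}(ab)^{4n-10}(cdef)^{4n-12}(gh)^{4n-16}R^{4n-8}M(AD_{2n-12};\mathrm{wt}_M)\qquad(2n\ge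 12) $$ and $$ M(AD_{2n-1};\mathrm{wt}_M)=2^{4n-16}(de)^{4n-10}(abgh)^{4n-14}(cf)^{4n-16}R^{4n-12} M(AD_{2n-13};\mathrm{wt}_M)\qquad(2n-1\ge 13). $$
   Context: For $n\ge0$, the Aztec diamond graph $AD_n$ has vertices $u_{i,j}$ ($0\le i\le n$, $1\le j\le n$) and $v_{i,j}$ ($1\le i\le n$, $0\le j\le n$), and $4n^2$ edges $\epsilon_{r,s}$, $1\le r,s\le 2n$ (the edge centers form a $2n\times2n$ array), where for $1\le i,j\le n$: $\epsilon_{2i-1,2j-1}=u_{i-1,j}v_{i,j-1}$, $\epsilon_{2i-1,2j}=u_{i-1,j}v_{i,j}$, $\epsilon_{2i,2j-1}=u_{i,j}v_{i,j-1}$, $\epsilon_{2i,2j}=u_{i,j}v_{i,j}$. $AD_0$ is the empty graph. For a $k\times l$ matrix $A$ with $k,l$ even, the weight $\mathrm{wt}_A$ on $AD_n$ assigns to the edge $\epsilon_{r,s}$ the entry of $A$ in row $r'$ and column $s'$, where $1\le r'\le k$, $r'\equiv r \pmod k$, $1\le s'\le l$, $s'\equiv s\pmod l$ (the array of edges is filled periodically with copies of $A$ starting from the upper left corner). The weight of a perfect matching is the product of the weights of its edges, and $M(G;\mathrm{wt})$ is the sum of the weights of all perfect matchings of $G$ (equal to $1$ for the empty graph). *)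

theory Defs
  imports
    "HOL-Library.Poly_Mapping"
    "HOL-Library.Numeral_Type"
    "HOL-Computational_Algebra.Factorial_Ring"
    "Jordan_Normal_Form.Matrix"
begin

text \<open>
  The polynomial ring in eight indeterminates over \<^typ>\<open>'k\<close>: finitely supported maps from exponent
  vectors to coefficients, with the convolution product of \<^theory>\<open>HOL-Library.Poly_Mapping\<close>.
\<close>

type_synonym 'k poly8 = "(8 \<Rightarrow>\<^sub>0 nat) \<Rightarrow>\<^sub>0 'k"

definition indet :: "8 \<Rightarrow> 'k::comm_semiring_1 poly8" where
  "indet i = Poly_Mapping.single (Poly_Mapping.single i 1) 1"


text \<open>Graphs are given by a vertex set and a set of edges, an edge being the set of its two ends.\<close>

definition perfect_matching :: "'v set \<Rightarrow> 'v set set \<Rightarrow> 'v set set \<Rightarrow> bool" where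
  "perfect_matching V E P \<longleftrightarrow> P \<subseteq> E \<and> (\<forall>v\<in>V. \<exists>!e. e \<in> P \<and> v \<in> e)"

definition matching_gf :: "'v set \<Rightarrow> 'v set set \<Rightarrow> ('v set \<Rightarrow> 'r::comm_semiring_1) \<Rightarrow> 'r" where
  "matching_gf V E wt = (\<Sum>P | perfect_matching V E P. \<Prod>e\<in>P. wt e)"


datatype aztec_vertex = Uvert nat nat | Vvert nat nat

definition aztec_vertices :: "nat \<Rightarrow> aztec_vertex set" where
  "aztec_vertices n =
     {Uvert i j | i j. 0 \<le> i \<and> i \<le> n \<and> 1 \<le> j \<and> j \<le> n} \<union>
     {Vvert i j | i j. 1 \<le> i \<and> i \<le> n \<and> 0 \<le> j \<and> j \<le> n}"

text \<open>
  The edge with centre in row \<open>r\<close> and column \<open>s\<close> of the array of edges. The single formula with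
  \<open>div\<close> merges the usual four parity cases, which are recovered in \<open>aztec_edge_cases\<close> below.
\<close>

definition aztec_edge :: "nat \<Rightarrow> nat \<Rightarrow> aztec_vertex set" where
  "aztec_edge r s = {Uvert (r div 2) ((s + 1) div 2), Vvert ((r + 1) div 2) (s div 2)}"

lemma aztec_edge_cases:
  assumes "1 \<le> i" "1 \<le> j"
  shows "aztec_edge (2*i - 1) (2*j - 1) = {Uvert (i - 1) j, Vvert i (j - 1)}"
    and "aztec_edge (2*i - 1) (2*j) = {Uvert (i - 1) j, Vvert i j}"
    and "aztec_edge (2*i) (2*j - 1) = {Uvert i j, Vvert i (j - 1)}"
    and "aztec_edge (2*i) (2*j) = {Uvert i j, Vvert i j}"
proof -
  have "(2*i - 1) div 2 = i - 1" "(2*j - 1) div 2 = j - 1"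
    using assms by linarith+
  then show "aztec_edge (2*i - 1) (2*j - 1) = {Uvert (i - 1) j, Vvert i (j - 1)}"
    and "aztec_edge (2*i - 1) (2*j) = {Uvert (i - 1) j, Vvert i j}"
    and "aztec_edge (2*i) (2*j - 1) = {Uvert i j, Vvert i (j - 1)}"
    and "aztec_edge (2*i) (2*j) = {Uvert i j, Vvert i j}"
    using assms by (simp_all add: aztec_edge_def)
qed

definition aztec_edges :: "nat \<Rightarrow> aztec_vertex set set" where
  "aztec_edges n = {aztec_edge r s | r s. 1 \<le> r \<and> r \<le> 2*n \<and> 1 \<le> s \<and> s \<le> 2*n}"

text \<open>
  Rows and columns of the array of edges are numbered from 1, whereas matrix entries are numbered
  from 0. The weight is a function of the edge itself because an edge determines its row and column
  (\<open>inj_aztec_edge\<close>).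
\<close>

definition aztec_weight :: "'r mat \<Rightarrow> aztec_vertex set \<Rightarrow> 'r" where
  "aztec_weight A e =
     (case inv_into UNIV (\<lambda>(r, s). aztec_edge r s) e of
        (r, s) \<Rightarrow> A $$ ((r - 1) mod dim_row A, (s - 1) mod dim_col A))"

lemma inj_aztec_edge: "inj (\<lambda>(r, s). aztec_edge r s)"
proof (rule injI, clarify)
  fix r s r' s' :: nat
  assume "aztec_edge r s = aztec_edge r' s'"
  then have "r div 2 = r' div 2" "(s + 1) div 2 = (s' + 1) div 2"
    "(r + 1) div 2 = (r' + 1) div 2" "s div 2 = s' div 2"
    by (auto simp: aztec_edge_def doubleton_eq_iff)
  moreover have "k = k div 2 + (k + 1) div 2" for k :: nat
    by presburger
  ultimately show "r = r' \<and> s = s'"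
    by metis
qed

lemma aztec_weight_edge:
  "aztec_weight A (aztec_edge r s) = A $$ ((r - 1) mod dim_row A, (s - 1) mod dim_col A)"
  using inv_f_f[OF inj_aztec_edge, of "(r, s)"] by (simp add: aztec_weight_def)

definition aztec_gf :: "'r::comm_semiring_1 mat \<Rightarrow> nat \<Rightarrow> 'r" where
  "aztec_gf A n = matching_gf (aztec_vertices n) (aztec_edges n) (aztec_weight A)"

end

theory Submission
  imports Defs "HOL-Computational_Algebra.Polynomial_Factorial"
begin

text \<open>
  The faces \<open>{\<epsilon>\<^sub>2\<^sub>i\<^sub>-\<^sub>1\<^sub>,\<^sub>2\<^sub>j\<^sub>-\<^sub>1, \<dots>, \<epsilon>\<^sub>2\<^sub>i\<^sub>,\<^sub>2\<^sub>j}\<close> (cells) partition the edges of \<open>AD\<^sub>n\<close>, every vertex lies in one or two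
  cells, and a perfect matching selects for each vertex the cell in which it is matched. A cell with opposite
  edge weights \<open>x, w\<close> and \<open>y, z\<close> and \<open>\<Delta> = x w + y z\<close> contributes \<open>\<Delta>\<close> times what the cell rotated
  by a half turn, with all weights divided by \<open>\<Delta>\<close>, contributes for the complementary set of its vertices.
  Complementing in all cells at once unmatches the boundary vertices, which leaves a copy of \<open>AD\<^sub>n\<^sub>-\<^sub>1\<close>:
  this is urban renewal for the whole Aztec diamond. A \<open>4\<close>-periodic weight stays \<open>4\<close>-periodic, and twelve
  such reductions over the fraction field carry \<open>M\<close> to a scalar multiple of itself, passing only through
  matrices of Laurent monomials in \<open>a, \<dots>, h, R\<close> and the four binomials \<open>S = a g + d e\<close>, \<open>T = b h + c f\<close>,
  \<open>P = a g + 2 d e\<close>, \<open>Q = b h + 2 c f\<close>.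
\<close>

section \<open>Complementation in a single cell\<close>

text \<open>The division by cell factors forces the fraction field, and each factor met on the way
  must be nonzero. The zero entries are harmless: only the factor of a block has to be nonzero, and
  a block with zeros on one diagonal still has the product of the other diagonal as its factor.
  Removing the boundary shifts the partition into cells by one row and one column, so each reduction
  creates new sums of two products. In general these would grow; here each of them is a monomial
  times one of a few relations, namely sums equal to \<open>S\<close>, \<open>T\<close>,
  \<open>R\<close>, \<open>T * P\<close>, \<open>S * Q\<close>, \<open>2 * R\<close>,
  \<open>P\<close>, \<open>Q\<close> or \<open>2\<close>, and these relations recur after six
  reductions. The exponents of the factors are quadratic in the order and contain halves rounded up
  or down. Taking reductions in pairs, separately for even and odd orders, removes the rounding. The
  quadratic parts cancel against the scalar that closes the orbit, since this scalar enters with the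
  power \<open>n * (n + 1)\<close>; that is why the recurrences have exponents linear in the
  order.\<close>

lemma sum_prod_blocks:
  fixes w :: "'p \<Rightarrow> 'r::comm_semiring_1"
  assumes "finite C" and fin: "\<And>c. c \<in> C \<Longrightarrow> finite (E c)"
    and "\<And>c c'. c \<in> C \<Longrightarrow> c' \<in> C \<Longrightarrow> c \<noteq> c' \<Longrightarrow> E c \<inter> E c' = {}"
  shows "(\<Sum>P | P \<subseteq> (\<Union>c\<in>C. E c) \<and> (\<forall>c\<in>C. Q c (P \<inter> E c)). \<Prod>p\<in>P. w p)
       = (\<Prod>c\<in>C. \<Sum>T | T \<subseteq> E c \<and> Q c T. \<Prod>p\<in>T. w p)"
  using assms
proof (induction C rule: finite_induct)
  case empty
  have "{P::'p set. P \<subseteq> {}} = {{}}" by auto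
  then show ?case by simp
next
  case (insert c C)
  define U where "U = (\<Union>c\<in>C. E c)"
  define \<A> where "\<A> = {T. T \<subseteq> E c \<and> Q c T}"
  define \<B> where "\<B> = {P. P \<subseteq> U \<and> (\<forall>c\<in>C. Q c (P \<inter> E c))}"
  have disj: "E c \<inter> U = {}"
    using insert.hyps(2) insert.prems(2)[of c] unfolding U_def by blast
  have finU: "finite U" "finite (E c)"
    using insert.hyps insert.prems(1) by (auto simp: U_def)
  have IH: "(\<Sum>P\<in>\<B>. \<Prod>p\<in>P. w p) = (\<Prod>c\<in>C. \<Sum>T | T \<subseteq> E c \<and> Q c T. \<Prod>p\<in>T. w p)"
    unfolding \<B>_def U_def by (rule insert.IH) (use insert.prems in auto)
  \<comment> \<open>This is the distributive law: conditions that see only the traces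
    \<open>P \<inter> E c\<close> can be met independently in each block.\<close>
  have "(\<Sum>P | P \<subseteq> (\<Union>c\<in>insert c C. E c) \<and> (\<forall>c\<in>insert c C. Q c (P \<inter> E c)). \<Prod>p\<in>P. w p)
      = (\<Sum>(T, P)\<in>\<A> \<times> \<B>. (\<Prod>p\<in>T. w p) * (\<Prod>p\<in>P. w p))"
  proof (rule sum.reindex_bij_witness[where i = "\<lambda>(T, P). T \<union> P" and j = "\<lambda>P. (P \<inter> E c, P \<inter> U)"], goal_cases)
    case (1 P)
    then show ?case by (auto simp: U_def)
  next
    case (2 P)
    have *: "P \<inter> U \<inter> E c' = P \<inter> E c'" if "c' \<in> C" for c'
      using that by (auto simp: U_def)
    show ?case using 2 by (auto simp: \<A>_def \<B>_def *)
  next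
    case (3 x)
    then show ?case using disj by (auto simp: \<A>_def \<B>_def)
  next
    case (4 x)
    then obtain T P where x: "x = (T, P)" "T \<subseteq> E c" "Q c T" "P \<subseteq> U" "\<forall>c\<in>C. Q c (P \<inter> E c)"
      by (auto simp: \<A>_def \<B>_def)
    have "(T \<union> P) \<inter> E c = T" using x disj by auto
    moreover have "(T \<union> P) \<inter> E c' = P \<inter> E c'" if "c' \<in> C" for c'
      using x disj that by (auto simp: U_def)
    ultimately show ?case using x by (auto simp: U_def)
  next
    case (5 P)
    then have "P = (P \<inter> E c) \<union> (P \<inter> U)" by (auto simp: U_def)
    moreover have "(\<Prod>p\<in>(P \<inter> E c) \<union> (P \<inter> U). w p) = (\<Prod>p\<in>P \<inter> E c. w p) * (\<Prod>p\<in>P \<inter> U. w p)"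
      by (rule prod.union_disjoint) (use finU disj in auto)
    ultimately show ?case by simp
  qed
  also have "\<dots> = (\<Sum>T\<in>\<A>. \<Prod>p\<in>T. w p) * (\<Sum>P\<in>\<B>. \<Prod>p\<in>P. w p)"
    by (simp add: sum_product sum.cartesian_product)
  finally show ?case using insert.hyps IH by (simp add: \<A>_def)
qed

lemma sum_Pow_insert:
  fixes g :: "'p set \<Rightarrow> 'r::comm_monoid_add"
  assumes "finite A" "x \<notin> A"
  shows "(\<Sum>T\<in>Pow (insert x A). g T) = (\<Sum>T\<in>Pow A. g T) + (\<Sum>T\<in>Pow A. g (insert x T))"
proof -
  have "inj_on (insert x) (Pow A)" using assms(2) by (auto simp: inj_on_def)
  moreover have "Pow A \<inter> insert x ` Pow A = {}" using assms(2) by auto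
  ultimately show ?thesis
    using assms(1) by (simp add: Pow_insert sum.union_disjoint sum.reindex o_def)
qed

text \<open>
  A corner is a pair of a cell and one of its four vertices: \<open>Inl (r, j)\<close> is the end \<open>u\<close> shared by the two
  edges of row \<open>r\<close> in the \<open>j\<close>-th column of cells, \<open>Inr (i, s)\<close> is the end \<open>v\<close> shared by the two edges of
  column \<open>s\<close> in the \<open>i\<close>-th row of cells.
\<close>

type_synonym corner = "nat \<times> nat + nat \<times> nat"

definition ends :: "nat \<times> nat \<Rightarrow> corner set" where
  "ends p = {Inl (fst p, (snd p + 1) div 2), Inr ((fst p + 1) div 2, snd p)}"

text \<open>The set \<open>I\<close> limits the condition to the corners at hand, so that the same
  notion serves a single cell and the whole array. Corners of \<open>I\<close> outside
  \<open>K\<close> must stay uncovered, so \<open>K\<close> records exactly the corners in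
  use.\<close>

definition exact_cover :: "(nat \<times> nat) set \<Rightarrow> corner set \<Rightarrow> corner set \<Rightarrow> bool" where
  "exact_cover P I K \<longleftrightarrow>
     (\<forall>k\<in>I. if k \<in> K then \<exists>!p. p \<in> P \<and> k \<in> ends p else \<forall>p\<in>P. k \<notin> ends p)"

definition cell_edges :: "nat \<times> nat \<Rightarrow> (nat \<times> nat) set" where
  "cell_edges c = {(2 * fst c - 1, 2 * snd c - 1), (2 * fst c - 1, 2 * snd c),
                   (2 * fst c, 2 * snd c - 1), (2 * fst c, 2 * snd c)}"

definition cell_corners :: "nat \<times> nat \<Rightarrow> corner set" where
  "cell_corners c = {Inl (2 * fst c - 1, snd c), Inl (2 * fst c, snd c),
                     Inr (fst c, 2 * snd c - 1), Inr (fst c, 2 * snd c)}"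

definition cell_sum :: "(nat \<Rightarrow> nat \<Rightarrow> 'r::comm_semiring_1) \<Rightarrow> corner set \<Rightarrow> nat \<times> nat \<Rightarrow> 'r" where
  "cell_sum w K c = (\<Sum>T | T \<subseteq> cell_edges c \<and> exact_cover T (cell_corners c) K. \<Prod>p\<in>T. w (fst p) (snd p))"

definition cell_factor :: "(nat \<Rightarrow> nat \<Rightarrow> 'r::comm_semiring_1) \<Rightarrow> nat \<times> nat \<Rightarrow> 'r" where
  "cell_factor w c = w (2 * fst c - 1) (2 * snd c - 1) * w (2 * fst c) (2 * snd c)
                   + w (2 * fst c - 1) (2 * snd c) * w (2 * fst c) (2 * snd c - 1)"

text \<open>The four edges form a 4-cycle in which \<open>t\<close>, \<open>b\<close> alternate with
  \<open>l\<close>, \<open>r\<close>. Matchable sets of corners are the empty set, the four pairs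
  joined by an edge, and the whole cycle with its two matchings; the other ten sets contribute
  0.\<close>

lemma cell_sum_eq:
  fixes w :: "nat \<Rightarrow> nat \<Rightarrow> 'r::comm_semiring_1"
  assumes "fst c \<ge> 1" "snd c \<ge> 1"
  defines "t \<equiv> (Inl (2 * fst c - 1, snd c) :: corner)" and "b \<equiv> (Inl (2 * fst c, snd c) :: corner)"
    and "l \<equiv> (Inr (fst c, 2 * snd c - 1) :: corner)" and "r \<equiv> (Inr (fst c, 2 * snd c) :: corner)"
  shows "cell_sum w K c =
    (if t \<in> K \<and> b \<in> K \<and> l \<in> K \<and> r \<in> K then cell_factor w c
     else if t \<in> K \<and> b \<notin> K \<and> l \<in> K \<and> r \<notin> K then w (2 * fst c - 1) (2 * snd c - 1)
     else if t \<in> K \<and> b \<notin> K \<and> l \<notin> K \<and> r \<in> K then w (2 * fst c - 1) (2 * snd c)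
     else if t \<notin> K \<and> b \<in> K \<and> l \<in> K \<and> r \<notin> K then w (2 * fst c) (2 * snd c - 1)
     else if t \<notin> K \<and> b \<in> K \<and> l \<notin> K \<and> r \<in> K then w (2 * fst c) (2 * snd c)
     else if t \<notin> K \<and> b \<notin> K \<and> l \<notin> K \<and> r \<notin> K then 1
     else 0)"
proof -
  define p1 p2 p3 p4 where p: "p1 = (2 * fst c - 1, 2 * snd c - 1)" "p2 = (2 * fst c - 1, 2 * snd c)"
    "p3 = (2 * fst c, 2 * snd c - 1)" "p4 = (2 * fst c, 2 * snd c)"
  have half: "(2 * k - 1 + 1) div 2 = k" "(2 * k + 1) div 2 = k" if "k \<ge> 1" for k :: nat
    using that by presburger+
  have ends: "ends p1 = {t, l}" "ends p2 = {t, r}" "ends p3 = {b, l}" "ends p4 = {b, r}"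
    unfolding ends_def p t_def b_def l_def r_def fst_conv snd_conv half[OF assms(1)] half[OF assms(2)]
    by simp_all
  have ne: "2 * k - 1 \<noteq> 2 * k" "2 * k \<noteq> 2 * k - 1" if "k \<ge> 1" for k :: nat
    using that by presburger+
  have corners_ne: "t \<noteq> b" "t \<noteq> l" "t \<noteq> r" "b \<noteq> l" "b \<noteq> r" "l \<noteq> r"
    unfolding t_def b_def l_def r_def using ne assms(1,2) by simp_all
  have edges_ne: "p1 \<noteq> p2" "p1 \<noteq> p3" "p1 \<noteq> p4" "p2 \<noteq> p3" "p2 \<noteq> p4" "p3 \<noteq> p4"
    unfolding p using ne assms(1,2) by simp_all
  have corners: "cell_corners c = {t, b, l, r}" and edges: "cell_edges c = {p1, p2, p3, p4}"
    by (simp_all add: cell_corners_def cell_edges_def t_def b_def l_def r_def p)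
  \<comment> \<open>Each corner lies on exactly two of the four edges, so covering it once is an
    exclusive or.\<close>
  have cover: "exact_cover T (cell_corners c) K \<longleftrightarrow>
      (if t \<in> K then (p1 \<in> T) \<noteq> (p2 \<in> T) else p1 \<notin> T \<and> p2 \<notin> T) \<and>
      (if b \<in> K then (p3 \<in> T) \<noteq> (p4 \<in> T) else p3 \<notin> T \<and> p4 \<notin> T) \<and>
      (if l \<in> K then (p1 \<in> T) \<noteq> (p3 \<in> T) else p1 \<notin> T \<and> p3 \<notin> T) \<and>
      (if r \<in> K then (p2 \<in> T) \<noteq> (p4 \<in> T) else p2 \<notin> T \<and> p4 \<notin> T)"
    if "T \<subseteq> {p1, p2, p3, p4}" for T
  proof -
    have in_ends: "t \<in> ends p1" "t \<in> ends p2" "t \<notin> ends p3" "t \<notin> ends p4"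
      "b \<notin> ends p1" "b \<notin> ends p2" "b \<in> ends p3" "b \<in> ends p4"
      "l \<in> ends p1" "l \<notin> ends p2" "l \<in> ends p3" "l \<notin> ends p4"
      "r \<notin> ends p1" "r \<in> ends p2" "r \<notin> ends p3" "r \<in> ends p4"
      unfolding ends using corners_ne by simp_all
    have mem: "p \<in> T \<and> t \<in> ends p \<longleftrightarrow> p \<in> T \<inter> {p1, p2}" "p \<in> T \<and> b \<in> ends p \<longleftrightarrow> p \<in> T \<inter> {p3, p4}"
      "p \<in> T \<and> l \<in> ends p \<longleftrightarrow> p \<in> T \<inter> {p1, p3}" "p \<in> T \<and> r \<in> ends p \<longleftrightarrow> p \<in> T \<inter> {p2, p4}" for p
    proof -
      consider "p = p1" | "p = p2" | "p = p3" | "p = p4" | "p \<notin> T"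
        using \<open>T \<subseteq> {p1, p2, p3, p4}\<close> by blast
      then show "p \<in> T \<and> t \<in> ends p \<longleftrightarrow> p \<in> T \<inter> {p1, p2}" "p \<in> T \<and> b \<in> ends p \<longleftrightarrow> p \<in> T \<inter> {p3, p4}"
        "p \<in> T \<and> l \<in> ends p \<longleftrightarrow> p \<in> T \<inter> {p1, p3}" "p \<in> T \<and> r \<in> ends p \<longleftrightarrow> p \<in> T \<inter> {p2, p4}"
        by (cases; use in_ends edges_ne in simp)+
    qed
    have ex1: "(\<exists>!p. p \<in> T \<inter> {x, y}) \<longleftrightarrow> (x \<in> T) \<noteq> (y \<in> T)" if "x \<noteq> y" for x y
      using that by auto
    have all: "(\<forall>p\<in>T. k \<notin> ends p) \<longleftrightarrow> (\<nexists>p. p \<in> T \<and> k \<in> ends p)" for k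
      by blast
    have none: "(\<nexists>p. p \<in> T \<inter> {x, y}) \<longleftrightarrow> x \<notin> T \<and> y \<notin> T" for x y
      by blast
    show ?thesis
      unfolding exact_cover_def corners all mem ball_simps none
      using ex1 edges_ne by simp
  qed
  have "cell_sum w K c = (\<Sum>T\<in>Pow {p1, p2, p3, p4}.
          if exact_cover T (cell_corners c) K then \<Prod>p\<in>T. w (fst p) (snd p) else 0)"
    unfolding cell_sum_def edges by (rule sum.mono_neutral_cong_left) auto
  also have "\<dots> = (\<Sum>T\<in>Pow {p1, p2, p3, p4}.
      if (if t \<in> K then (p1 \<in> T) \<noteq> (p2 \<in> T) else p1 \<notin> T \<and> p2 \<notin> T) \<and>
      (if b \<in> K then (p3 \<in> T) \<noteq> (p4 \<in> T) else p3 \<notin> T \<and> p4 \<notin> T) \<and>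
      (if l \<in> K then (p1 \<in> T) \<noteq> (p3 \<in> T) else p1 \<notin> T \<and> p3 \<notin> T) \<and>
      (if r \<in> K then (p2 \<in> T) \<noteq> (p4 \<in> T) else p2 \<notin> T \<and> p4 \<notin> T)
      then \<Prod>p\<in>T. w (fst p) (snd p) else 0)"
    by (rule sum.cong) (simp_all add: cover)
  also have "\<dots> = (if t \<in> K \<and> b \<in> K \<and> l \<in> K \<and> r \<in> K
       then w (fst p1) (snd p1) * w (fst p4) (snd p4) + w (fst p2) (snd p2) * w (fst p3) (snd p3)
     else if t \<in> K \<and> b \<notin> K \<and> l \<in> K \<and> r \<notin> K then w (fst p1) (snd p1)
     else if t \<in> K \<and> b \<notin> K \<and> l \<notin> K \<and> r \<in> K then w (fst p2) (snd p2)
     else if t \<notin> K \<and> b \<in> K \<and> l \<in> K \<and> r \<notin> K then w (fst p3) (snd p3)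
     else if t \<notin> K \<and> b \<in> K \<and> l \<notin> K \<and> r \<in> K then w (fst p4) (snd p4)
     else if t \<notin> K \<and> b \<notin> K \<and> l \<notin> K \<and> r \<notin> K then 1
     else 0)"
    using edges_ne
    by (cases "t \<in> K"; cases "b \<in> K"; cases "l \<in> K"; cases "r \<in> K")
       (simp_all add: sum_Pow_insert edges_ne[symmetric] add.commute)
  finally show ?thesis
    by (simp add: p cell_factor_def)
qed

definition rotate_cells :: "(nat \<Rightarrow> nat \<Rightarrow> 'r::field) \<Rightarrow> nat \<Rightarrow> nat \<Rightarrow> 'r" where
  "rotate_cells w r s = w (if odd r then r + 1 else r - 1) (if odd s then s + 1 else s - 1)
      / cell_factor w ((r + 1) div 2, (s + 1) div 2)"

lemma rotate_cells_simps:
  assumes "i \<ge> 1" "j \<ge> 1"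
  shows "rotate_cells w (2 * i - 1) (2 * j - 1) = w (2 * i) (2 * j) / cell_factor w (i, j)"
    "rotate_cells w (2 * i - 1) (2 * j) = w (2 * i) (2 * j - 1) / cell_factor w (i, j)"
    "rotate_cells w (2 * i) (2 * j - 1) = w (2 * i - 1) (2 * j) / cell_factor w (i, j)"
    "rotate_cells w (2 * i) (2 * j) = w (2 * i - 1) (2 * j - 1) / cell_factor w (i, j)"
proof -
  have half: "(2 * k - 1 + 1) div 2 = k" "(2 * k + 1) div 2 = k" "2 * k - 1 + 1 = 2 * k"
     "odd (2 * k - 1)" if "k \<ge> 1" for k :: nat
    using that by presburger+
  show "rotate_cells w (2 * i - 1) (2 * j - 1) = w (2 * i) (2 * j) / cell_factor w (i, j)"
    "rotate_cells w (2 * i - 1) (2 * j) = w (2 * i) (2 * j - 1) / cell_factor w (i, j)"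
    "rotate_cells w (2 * i) (2 * j - 1) = w (2 * i - 1) (2 * j) / cell_factor w (i, j)"
    "rotate_cells w (2 * i) (2 * j) = w (2 * i - 1) (2 * j - 1) / cell_factor w (i, j)"
    unfolding rotate_cells_def using half[OF assms(1)] half[OF assms(2)] by simp_all
qed

text \<open>In a 4-cycle the complement of the ends of an edge is the pair of ends of the opposite
  edge, which the half turn has provided with the right weight; the empty set and the whole cycle
  are exchanged. The rotated cell has the factor \<open>1 / cell_factor w c\<close>, because each of
  its products has two divided weights. Hence one prefactor serves all \<open>K\<close>.\<close>

lemma cell_sum_complement:
  fixes w :: "nat \<Rightarrow> nat \<Rightarrow> 'r::field"
  assumes "fst c \<ge> 1" "snd c \<ge> 1" "cell_factor w c \<noteq> 0" "cell_corners c \<subseteq> I"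
  shows "cell_sum w K c = cell_factor w c * cell_sum (rotate_cells w) (I - K) c"
proof -
  have "cell_factor (rotate_cells w) c = 1 / cell_factor w c"
    using assms(3)
    unfolding cell_factor_def[of "rotate_cells w"] rotate_cells_simps[OF assms(1,2)] prod.collapse
    by (simp add: divide_simps) (simp add: cell_factor_def algebra_simps)
  then show ?thesis
    using assms(3,4)
    unfolding cell_sum_eq[OF assms(1,2)] rotate_cells_simps[OF assms(1,2)] prod.collapse
    by (auto simp: cell_corners_def)
qed

section \<open>Complementation in the Aztec diamond\<close>

definition positions :: "nat \<Rightarrow> (nat \<times> nat) set" where
  "positions n = {1..2*n} \<times> {1..2*n}"

definition cells :: "nat \<Rightarrow> (nat \<times> nat) set" where
  "cells n = {1..n} \<times> {1..n}"

definition corners :: "nat \<Rightarrow> corner set" where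
  "corners n = Inl ` ({1..2*n} \<times> {1..n}) \<union> Inr ` ({1..n} \<times> {1..2*n})"

text \<open>Corners of different cells are kept apart, so this belongs to a disjoint union of
  4-cycles. Gluing corners into vertices is left to the choice of \<open>K\<close>.\<close>

definition cover_sum :: "nat \<Rightarrow> (nat \<Rightarrow> nat \<Rightarrow> 'r::comm_semiring_1) \<Rightarrow> corner set \<Rightarrow> 'r" where
  "cover_sum n w K =
     (\<Sum>P | P \<subseteq> positions n \<and> exact_cover P (corners n) K. \<Prod>p\<in>P. w (fst p) (snd p))"

lemma finite_cells [simp]: "finite (cells n)"
  by (simp add: cells_def)

lemma finite_positions [simp]: "finite (positions n)"
  by (simp add: positions_def)

lemma finite_corners [simp]: "finite (corners n)"
  by (simp add: corners_def)

lemma corners_mem: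
  "Inl (r, j) \<in> corners n \<longleftrightarrow> 1 \<le> r \<and> r \<le> 2 * n \<and> 1 \<le> j \<and> j \<le> n"
  "Inr (i, s) \<in> corners n \<longleftrightarrow> 1 \<le> i \<and> i \<le> n \<and> 1 \<le> s \<and> s \<le> 2 * n"
  by (auto simp: corners_def)

lemma half_eq_iff: "r \<ge> 1 \<Longrightarrow> i \<ge> 1 \<Longrightarrow> (r + 1) div 2 = i \<longleftrightarrow> r = 2 * i - 1 \<or> r = 2 * i" for r i :: nat
  by presburger

lemma mem_cell_edges_iff:
  assumes "fst p \<ge> 1" "snd p \<ge> 1" "fst c \<ge> 1" "snd c \<ge> 1"
  shows "p \<in> cell_edges c \<longleftrightarrow> c = ((fst p + 1) div 2, (snd p + 1) div 2)"
proof -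
  have "c = ((fst p + 1) div 2, (snd p + 1) div 2)
      \<longleftrightarrow> (fst p + 1) div 2 = fst c \<and> (snd p + 1) div 2 = snd c"
    by (metis fst_conv prod.collapse snd_conv)
  then show ?thesis
    unfolding half_eq_iff[OF assms(1,3)] half_eq_iff[OF assms(2,4)] cell_edges_def
      insert_iff prod_eq_iff fst_conv snd_conv
    by blast
qed

lemma positions_eq_UN: "positions n = (\<Union>c\<in>cells n. cell_edges c)"
proof (rule Set.set_eqI)
  fix p
  show "p \<in> positions n \<longleftrightarrow> p \<in> (\<Union>c\<in>cells n. cell_edges c)"
  proof
    assume p: "p \<in> positions n"
    let ?c = "((fst p + 1) div 2, (snd p + 1) div 2)"
    have "(k + 1) div 2 \<in> {1..n}" if "k \<in> {1..2*n}" for k using that by auto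
    then have "?c \<in> cells n" using p by (auto simp: positions_def cells_def)
    moreover from this have "p \<in> cell_edges ?c"
      by (subst mem_cell_edges_iff) (use p in \<open>auto simp: positions_def cells_def\<close>)
    ultimately show "p \<in> (\<Union>c\<in>cells n. cell_edges c)" by blast
  qed (auto simp: positions_def cells_def cell_edges_def)
qed

lemma corners_eq_UN: "corners n = (\<Union>c\<in>cells n. cell_corners c)"
proof (rule Set.set_eqI)
  fix k
  have *: "(r + 1) div 2 \<in> {1..n}" "r = 2 * ((r + 1) div 2) - 1 \<or> r = 2 * ((r + 1) div 2)"
    if "r \<in> {1..2*n}" for r using that by auto
  show "k \<in> corners n \<longleftrightarrow> k \<in> (\<Union>c\<in>cells n. cell_corners c)"
  proof
    assume k: "k \<in> corners n"
    then consider r j where "k = Inl (r, j)" "r \<in> {1..2*n}" "j \<in> {1..n}"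
      | i s where "k = Inr (i, s)" "s \<in> {1..2*n}" "i \<in> {1..n}"
      by (auto simp: corners_def)
    then show "k \<in> (\<Union>c\<in>cells n. cell_corners c)"
    proof cases
      case (1 r j)
      then have "k \<in> cell_corners ((r + 1) div 2, j)" "((r + 1) div 2, j) \<in> cells n"
        using *[of r] by (auto simp: cell_corners_def cells_def)
      then show ?thesis by blast
    next
      case (2 i s)
      then have "k \<in> cell_corners (i, (s + 1) div 2)" "(i, (s + 1) div 2) \<in> cells n"
        using *[of s] by (auto simp: cell_corners_def cells_def)
      then show ?thesis by blast
    qed
  qed (auto simp: corners_mem cells_def cell_corners_def)
qed

text \<open>A corner determines its cell, because halving its long index gives the missing cell
  coordinate. This is what decouples the covering conditions of different cells.\<close>

lemma ends_cell_edges: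
  assumes "p \<in> positions n" "c \<in> cells n" "k \<in> cell_corners c" "k \<in> ends p"
  shows "p \<in> cell_edges c"
proof -
  have pos: "fst p \<ge> 1" "snd p \<ge> 1" "fst c \<ge> 1" "snd c \<ge> 1"
    using assms by (auto simp: positions_def cells_def)
  have half: "(2 * m - 1 + 1) div 2 = m" "(2 * m + 1) div 2 = m" if "m \<ge> 1" for m :: nat
    using that by presburger+
  have "fst c = (fst p + 1) div 2 \<and> snd c = (snd p + 1) div 2"
  proof (cases k)
    case (Inl x)
    then have "x = (fst p, (snd p + 1) div 2)" "x = (2 * fst c - 1, snd c) \<or> x = (2 * fst c, snd c)"
      using assms(3,4) unfolding ends_def cell_corners_def by blast+
    then show ?thesis using half[OF pos(3)] by (elim disjE) simp_all
  next
    case (Inr x)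
    then have "x = ((fst p + 1) div 2, snd p)" "x = (fst c, 2 * snd c - 1) \<or> x = (fst c, 2 * snd c)"
      using assms(3,4) unfolding ends_def cell_corners_def by blast+
    then show ?thesis using half[OF pos(4)] by (elim disjE) simp_all
  qed
  then show ?thesis
    unfolding mem_cell_edges_iff[OF pos] by (metis prod.collapse)
qed

lemma exact_cover_cells:
  assumes "P \<subseteq> positions n"
  shows "exact_cover P (corners n) K \<longleftrightarrow>
    (\<forall>c\<in>cells n. exact_cover (P \<inter> cell_edges c) (cell_corners c) K)"
proof -
  have "p \<in> P \<and> k \<in> ends p \<longleftrightarrow> p \<in> P \<inter> cell_edges c \<and> k \<in> ends p"
    if "c \<in> cells n" "k \<in> cell_corners c" for c k p
    using assms ends_cell_edges[OF _ that] by blast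
  then have "(\<exists>!p. p \<in> P \<and> k \<in> ends p) \<longleftrightarrow> (\<exists>!p. p \<in> P \<inter> cell_edges c \<and> k \<in> ends p)"
    "(\<forall>p\<in>P. k \<notin> ends p) \<longleftrightarrow> (\<forall>p\<in>P \<inter> cell_edges c. k \<notin> ends p)"
    if "c \<in> cells n" "k \<in> cell_corners c" for c k
    using that by (simp, blast)
  then show ?thesis
    unfolding exact_cover_def corners_eq_UN by simp
qed

lemma cover_sum_cells: "cover_sum n w K = (\<Prod>c\<in>cells n. cell_sum w K c)"
proof -
  have "cover_sum n w K = (\<Sum>P | P \<subseteq> (\<Union>c\<in>cells n. cell_edges c) \<and>
      (\<forall>c\<in>cells n. exact_cover (P \<inter> cell_edges c) (cell_corners c) K). \<Prod>p\<in>P. w (fst p) (snd p))"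
    unfolding cover_sum_def
    by (rule sum.cong) (use exact_cover_cells in \<open>auto simp flip: positions_eq_UN\<close>)
  also have "\<dots> = (\<Prod>c\<in>cells n. cell_sum w K c)"
    unfolding cell_sum_def
  proof (rule sum_prod_blocks)
    fix c c' assume c: "c \<in> cells n" "c' \<in> cells n" "c \<noteq> c'"
    show "cell_edges c \<inter> cell_edges c' = {}"
    proof (rule ccontr)
      assume "cell_edges c \<inter> cell_edges c' \<noteq> {}"
      then obtain p where p: "p \<in> cell_edges c" "p \<in> cell_edges c'" by blast
      then have "p \<in> positions n" using c positions_eq_UN by blast
      then show False
        using p c mem_cell_edges_iff[of p c] mem_cell_edges_iff[of p c']
        by (auto simp: positions_def cells_def)
    qed
  qed (auto simp: cell_edges_def)
  finally show ?thesis .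
qed

lemma cover_sum_complement:
  fixes w :: "nat \<Rightarrow> nat \<Rightarrow> 'r::field"
  assumes "\<And>c. c \<in> cells n \<Longrightarrow> cell_factor w c \<noteq> 0"
  shows "cover_sum n w K
       = (\<Prod>c\<in>cells n. cell_factor w c) * cover_sum n (rotate_cells w) (corners n - K)"
proof -
  have "cell_sum w K c = cell_factor w c * cell_sum (rotate_cells w) (corners n - K) c"
    if "c \<in> cells n" for c
    by (rule cell_sum_complement) (use that assms corners_eq_UN in \<open>auto simp: cells_def\<close>)
  then show ?thesis
    by (simp add: cover_sum_cells flip: prod.distrib)
qed

section \<open>Gluing corners into vertices\<close>

fun vert :: "corner \<Rightarrow> aztec_vertex" where
  "vert (Inl (r, j)) = Uvert (r div 2) j"
| "vert (Inr (i, s)) = Vvert i (s div 2)"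

lemma vert_ends: "vert ` ends p = aztec_edge (fst p) (snd p)"
  by (simp add: ends_def aztec_edge_def)

lemma inj_on_vert_ends: "inj_on vert (ends p)"
  by (auto simp: ends_def inj_on_def)

lemma ends_subset_corners: "p \<in> positions n \<Longrightarrow> ends p \<subseteq> corners n"
  by (auto simp: positions_def corners_mem ends_def)

text \<open>Matchings of the subgraph induced on \<open>V\<close>, written as sets of positions. A
  general \<open>V\<close> is needed because complementation ends in the inner vertices of the same
  array, before any renumbering.\<close>

definition region_gf :: "nat \<Rightarrow> aztec_vertex set \<Rightarrow> (nat \<Rightarrow> nat \<Rightarrow> 'r::comm_semiring_1) \<Rightarrow> 'r" where
  "region_gf n V w = (\<Sum>P | P \<subseteq> positions n \<and> (\<forall>p\<in>P. aztec_edge (fst p) (snd p) \<subseteq> V)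
       \<and> (\<forall>v\<in>V. \<exists>!p. p \<in> P \<and> v \<in> aztec_edge (fst p) (snd p)). \<Prod>p\<in>P. w (fst p) (snd p))"

definition transversals :: "nat \<Rightarrow> aztec_vertex set \<Rightarrow> corner set set" where
  "transversals n V = {K. K \<subseteq> corners n \<and> vert ` K \<subseteq> V \<and> (\<forall>v\<in>V. \<exists>!k. k \<in> K \<and> vert k = v)}"

lemma exact_coverD:
  assumes "exact_cover P I K" "k \<in> I"
  shows "k \<in> K \<Longrightarrow> \<exists>!p. p \<in> P \<and> k \<in> ends p" and "p \<in> P \<Longrightarrow> k \<in> ends p \<Longrightarrow> k \<in> K"
  using assms unfolding exact_cover_def by (simp, meson)

text \<open>Two used corners over the same vertex would come from two edges of \<open>P\<close> at
  that vertex, which is excluded, or from a single edge with both ends there, which does not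
  exist.\<close>

lemma transversal_of_matching:
  assumes P: "P \<subseteq> positions n" and V: "\<And>p. p \<in> P \<Longrightarrow> aztec_edge (fst p) (snd p) \<subseteq> V"
    and ex1: "\<And>v. v \<in> V \<Longrightarrow> \<exists>!p. p \<in> P \<and> v \<in> aztec_edge (fst p) (snd p)"
  shows "(\<Union>p\<in>P. ends p) \<in> transversals n V" "exact_cover P (corners n) (\<Union>p\<in>P. ends p)"
proof -
  define K where "K = (\<Union>p\<in>P. ends p)"
  have edge: "vert k \<in> aztec_edge (fst p) (snd p)" if "k \<in> ends p" for k p
    using that vert_ends by blast
  have same: "p = p'" if "k \<in> ends p" "p \<in> P" "k' \<in> ends p'" "p' \<in> P" "vert k = vert k'" for k k' p p'
  proof -
    have "vert k \<in> aztec_edge (fst p) (snd p)" "vert k \<in> aztec_edge (fst p') (snd p')"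
      using edge[OF that(1)] edge[OF that(3)] that(5) by simp_all
    moreover from this have "\<exists>!p. p \<in> P \<and> vert k \<in> aztec_edge (fst p) (snd p)"
      using ex1 V[OF that(2)] by blast
    ultimately show ?thesis using that(2,4) by blast
  qed
  have "K \<subseteq> corners n"
    unfolding K_def using P ends_subset_corners by blast
  moreover have "vert k \<in> V" if "k \<in> K" for k
    using that edge V unfolding K_def by blast
  moreover have "\<exists>!k. k \<in> K \<and> vert k = v" if v: "v \<in> V" for v
  proof -
    obtain p where p: "p \<in> P" "v \<in> aztec_edge (fst p) (snd p)"
      using ex1[OF v] by blast
    then obtain k where k: "k \<in> ends p" "vert k = v"
      using vert_ends by (metis imageE)
    have "k' = k" if k': "k' \<in> K \<and> vert k' = v" for k'
    proof -
      obtain p' where p': "p' \<in> P" "k' \<in> ends p'" using k' unfolding K_def by blast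
      then have "p' = p" using same[OF p'(2,1) k(1) p(1)] k' k by simp
      then show ?thesis using p' k k' inj_onD[OF inj_on_vert_ends] by metis
    qed
    moreover have "k \<in> K" unfolding K_def using k p by blast
    ultimately show ?thesis using k by blast
  qed
  ultimately show "(\<Union>p\<in>P. ends p) \<in> transversals n V"
    unfolding K_def[symmetric] transversals_def by blast
  have "\<exists>!p. p \<in> P \<and> k \<in> ends p" if "k \<in> K" for k
    using that same unfolding K_def by blast
  then show "exact_cover P (corners n) (\<Union>p\<in>P. ends p)"
    unfolding K_def[symmetric] exact_cover_def by (auto simp: K_def)
qed

lemma matching_of_transversal:
  assumes K: "K \<in> transversals n V" and P: "P \<subseteq> positions n" "exact_cover P (corners n) K"
  shows "(\<Union>p\<in>P. ends p) = K" "\<And>p. p \<in> P \<Longrightarrow> aztec_edge (fst p) (snd p) \<subseteq> V"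
    "\<And>v. v \<in> V \<Longrightarrow> \<exists>!p. p \<in> P \<and> v \<in> aztec_edge (fst p) (snd p)"
proof -
  have KV: "K \<subseteq> corners n" "vert ` K \<subseteq> V" "\<And>v. v \<in> V \<Longrightarrow> \<exists>!k. k \<in> K \<and> vert k = v"
    using K by (simp_all add: transversals_def)
  have cov: "\<exists>!p. p \<in> P \<and> k \<in> ends p" if "k \<in> K" for k
    using exact_coverD(1)[OF P(2)] KV(1) that by blast
  have sub: "ends p \<subseteq> K" if "p \<in> P" for p
  proof
    fix k assume k: "k \<in> ends p"
    then have "k \<in> corners n" using P that ends_subset_corners by blast
    then show "k \<in> K" using exact_coverD(2)[OF P(2)] that k by blast
  qed
  show "(\<Union>p\<in>P. ends p) = K"
  proof
    show "(\<Union>p\<in>P. ends p) \<subseteq> K" using sub by (rule UN_least)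
    show "K \<subseteq> (\<Union>p\<in>P. ends p)" using cov by blast
  qed
  show "aztec_edge (fst p) (snd p) \<subseteq> V" if "p \<in> P" for p
    using sub[OF that] KV(2) by (metis image_mono order_trans vert_ends)
  show "\<exists>!p. p \<in> P \<and> v \<in> aztec_edge (fst p) (snd p)" if v: "v \<in> V" for v
  proof -
    obtain k where k: "k \<in> K" "vert k = v" using KV(3)[OF v] by blast
    obtain p where p: "p \<in> P" "k \<in> ends p" using cov[OF k(1)] by blast
    have "v \<in> aztec_edge (fst p) (snd p)"
      using p k vert_ends by (metis imageI)
    moreover have "p' = p" if p': "p' \<in> P \<and> v \<in> aztec_edge (fst p') (snd p')" for p'
    proof -
      obtain k' where k': "k' \<in> ends p'" "vert k' = v"
        using p' vert_ends by (metis imageE)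
      then have "k' = k" using KV(3)[OF v] k sub[of p'] p' by blast
      then show ?thesis using cov[OF k(1)] p k' p' by blast
    qed
    ultimately show ?thesis using p by blast
  qed
qed

text \<open>Matchings are grouped by the set of corners they use; the fibre over a transversal
  \<open>K\<close> consists of the exact covers of \<open>K\<close>.\<close>

lemma region_gf_transversals: "region_gf n V w = (\<Sum>K\<in>transversals n V. cover_sum n w K)"
proof -
  define \<P> where "\<P> = {P. P \<subseteq> positions n \<and> (\<forall>p\<in>P. aztec_edge (fst p) (snd p) \<subseteq> V)
       \<and> (\<forall>v\<in>V. \<exists>!p. p \<in> P \<and> v \<in> aztec_edge (fst p) (snd p))}"
  define g where "g P = (\<Union>p\<in>P. ends p)" for P
  have \<P>D: "P \<subseteq> positions n" "p \<in> P \<Longrightarrow> aztec_edge (fst p) (snd p) \<subseteq> V"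
      "v \<in> V \<Longrightarrow> \<exists>!p. p \<in> P \<and> v \<in> aztec_edge (fst p) (snd p)" if "P \<in> \<P>" for P p v
    using that by (simp_all add: \<P>_def)
  have fin: "finite \<P>" "finite (transversals n V)"
  proof -
    have "\<P> \<subseteq> Pow (positions n)" "transversals n V \<subseteq> Pow (corners n)"
      unfolding \<P>_def transversals_def by blast+
    then show "finite \<P>" "finite (transversals n V)"
      by (simp_all add: finite_subset)
  qed
  have g: "g P \<in> transversals n V" "exact_cover P (corners n) (g P)" if "P \<in> \<P>" for P
    unfolding g_def by (rule transversal_of_matching; rule \<P>D[OF that]; assumption)+
  then have "region_gf n V w
      = (\<Sum>K\<in>transversals n V. \<Sum>P\<in>{P \<in> \<P>. g P = K}. \<Prod>p\<in>P. w (fst p) (snd p))"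
    unfolding region_gf_def \<P>_def[symmetric] using fin
    by (subst sum.group) auto
  also have "\<dots> = (\<Sum>K\<in>transversals n V. cover_sum n w K)"
  proof (rule sum.cong[OF refl])
    fix K assume K: "K \<in> transversals n V"
    have "P \<in> \<P> \<and> g P = K \<longleftrightarrow> P \<subseteq> positions n \<and> exact_cover P (corners n) K" for P
    proof
      assume "P \<in> \<P> \<and> g P = K"
      then show "P \<subseteq> positions n \<and> exact_cover P (corners n) K"
        using g(2)[of P] \<P>D(1)[of P] by simp
    next
      assume "P \<subseteq> positions n \<and> exact_cover P (corners n) K"
      then show "P \<in> \<P> \<and> g P = K"
        using matching_of_transversal[OF K, of P] by (simp add: \<P>_def g_def)
    qed
    then show "(\<Sum>P\<in>{P \<in> \<P>. g P = K}. \<Prod>p\<in>P. w (fst p) (snd p)) = cover_sum n w K"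
      unfolding cover_sum_def by simp
  qed
  finally show ?thesis .
qed

section \<open>Complementary choices of cells\<close>

definition inner_vertices :: "nat \<Rightarrow> aztec_vertex set" where
  "inner_vertices n =
     {Uvert i j | i j. 1 \<le> i \<and> i < n \<and> 1 \<le> j \<and> j \<le> n} \<union>
     {Vvert i j | i j. 1 \<le> i \<and> i \<le> n \<and> 1 \<le> j \<and> j < n}"

text \<open>The vertex is the bottom corner of the cell above it and the top corner of the cell
  below it. At the border one of the two leaves the range of \<open>corners n\<close>.\<close>

lemma vert_eq_Uvert_iff: "vert k = Uvert i j \<longleftrightarrow> k = Inl (2 * i, j) \<or> k = Inl (2 * i + 1, j)"
  by (cases k rule: vert.cases) auto

lemma vert_eq_Vvert_iff: "vert k = Vvert i j \<longleftrightarrow> k = Inr (i, 2 * j) \<or> k = Inr (i, 2 * j + 1)"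
  by (cases k rule: vert.cases) auto

lemma ex1_pair: "x \<noteq> y \<Longrightarrow> (\<exists>!k. k \<in> K \<and> (k = x \<or> k = y)) \<longleftrightarrow> (x \<in> K) \<noteq> (y \<in> K)"
  by metis

lemma ex1_vert:
  "(\<exists>!k. k \<in> K \<and> vert k = Uvert i j) \<longleftrightarrow> (Inl (2 * i, j) \<in> K) \<noteq> (Inl (2 * i + 1, j) \<in> K)"
  "(\<exists>!k. k \<in> K \<and> vert k = Vvert i j) \<longleftrightarrow> (Inr (i, 2 * j) \<in> K) \<noteq> (Inr (i, 2 * j + 1) \<in> K)"
  unfolding vert_eq_Uvert_iff vert_eq_Vvert_iff by (simp_all add: ex1_pair)

lemma ball_Collect2: "(\<forall>v\<in>{F i j | i j. P i j}. Q v) \<longleftrightarrow> (\<forall>i j. P i j \<longrightarrow> Q (F i j))"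
  by blast

lemma ball_aztec_vertices:
  "(\<forall>v\<in>aztec_vertices n. Q v) \<longleftrightarrow> (\<forall>j\<in>{1..n}. (\<forall>i\<le>n. Q (Uvert i j)) \<and> (\<forall>i\<le>n. Q (Vvert j i)))"
  unfolding aztec_vertices_def ball_Un ball_Collect2 by auto

lemma ball_inner_vertices:
  "(\<forall>v\<in>inner_vertices n. Q v) \<longleftrightarrow> (\<forall>j\<in>{1..n}. \<forall>i\<in>{1..<n}. Q (Uvert i j) \<and> Q (Vvert j i))"
  unfolding inner_vertices_def ball_Un ball_Collect2 by auto

text \<open>Over an inner vertex lie two corners, and exactly one of them is in \<open>K\<close> iff
  exactly one is in the complement. Over a boundary vertex lies a single corner; it must belong to
  \<open>K\<close>, so the complement has nothing there.\<close>

lemma transversals_complement: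
  assumes "K \<subseteq> corners n"
  shows "K \<in> transversals n (aztec_vertices n) \<longleftrightarrow> corners n - K \<in> transversals n (inner_vertices n)"
proof -
  define X where "X = (\<lambda>j. \<forall>i\<le>n. (Inl (2 * i, j) \<in> K) \<noteq> (Inl (2 * i + 1, j) \<in> K))"
  define Y where "Y = (\<lambda>i. \<forall>j\<le>n. (Inr (i, 2 * j) \<in> K) \<noteq> (Inr (i, 2 * j + 1) \<in> K))"
  have vertK: "vert ` K \<subseteq> aztec_vertices n"
  proof
    fix v assume "v \<in> vert ` K"
    then obtain k where k: "k \<in> corners n" "v = vert k" using assms by blast
    then show "v \<in> aztec_vertices n"
      by (cases k rule: vert.cases) (auto simp: corners_mem aztec_vertices_def)
  qed
  have lhs: "K \<in> transversals n (aztec_vertices n) \<longleftrightarrow> (\<forall>j\<in>{1..n}. X j \<and> Y j)"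
    using assms vertK unfolding transversals_def ball_aztec_vertices ex1_vert X_def Y_def by simp
  have "vert ` (corners n - K) \<subseteq> inner_vertices n \<longleftrightarrow>
      (\<forall>j\<in>{1..n}. Inl (1, j) \<in> K \<and> Inl (2 * n, j) \<in> K \<and> Inr (j, 1) \<in> K \<and> Inr (j, 2 * n) \<in> K)"
    (is "?A \<longleftrightarrow> ?B")
  proof
    assume A: ?A
    show ?B
    proof
      fix j assume j: "j \<in> {1..n}"
      have "k \<in> K" if "vert k \<notin> inner_vertices n" "k \<in> corners n" for k
        using A that by blast
      then show "Inl (1, j) \<in> K \<and> Inl (2 * n, j) \<in> K \<and> Inr (j, 1) \<in> K \<and> Inr (j, 2 * n) \<in> K"
        using j by (auto simp: inner_vertices_def corners_mem)
    qed
  next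
    assume B: ?B
    have inner: "1 \<le> r div 2 \<and> r div 2 < n" if "1 \<le> r" "r \<le> 2 * n" "r \<noteq> 1" "r \<noteq> 2 * n" for r
      using that by presburger
    show ?A
    proof
      fix v assume "v \<in> vert ` (corners n - K)"
      then obtain k where k: "k \<in> corners n" "k \<notin> K" "v = vert k" by blast
      show "v \<in> inner_vertices n"
      proof (cases k rule: vert.cases)
        case (1 r j)
        then have j: "j \<in> {1..n}" and r: "1 \<le> r" "r \<le> 2 * n" using k by (auto simp: corners_mem)
        then have "r \<noteq> 1" "r \<noteq> 2 * n" using B k(2) 1 by blast+
        then show ?thesis using inner[OF r] j k(3) 1 by (auto simp: inner_vertices_def)
      next
        case (2 i s)
        then have i: "i \<in> {1..n}" and s: "1 \<le> s" "s \<le> 2 * n" using k by (auto simp: corners_mem)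
        then have "s \<noteq> 1" "s \<noteq> 2 * n" using B k(2) 2 by blast+
        then show ?thesis using inner[OF s] i k(3) 2 by (auto simp: inner_vertices_def)
      qed
    qed
  qed
  then have rhs: "corners n - K \<in> transversals n (inner_vertices n) \<longleftrightarrow>
      (\<forall>j\<in>{1..n}. Inl (1, j) \<in> K \<and> Inl (2 * n, j) \<in> K \<and> Inr (j, 1) \<in> K \<and> Inr (j, 2 * n) \<in> K) \<and>
      (\<forall>j\<in>{1..n}. \<forall>i\<in>{1..<n}. ((Inl (2 * i, j) \<in> K) \<noteq> (Inl (2 * i + 1, j) \<in> K)) \<and>
          ((Inr (j, 2 * i) \<in> K) \<noteq> (Inr (j, 2 * i + 1) \<in> K)))"
    unfolding transversals_def ball_inner_vertices ex1_vert by (simp add: corners_mem) blast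
  \<comment> \<open>The missing second corners over boundary vertices carry the indices
    \<open>0\<close> and \<open>2 * n + 1\<close>. Since these are never in \<open>K\<close>, the
    exclusive or at \<open>i = 0\<close> and \<open>i = n\<close> forces the indices
    \<open>1\<close> and \<open>2 * n\<close> into \<open>K\<close>.\<close>
  have outside: "Inl (0, j) \<notin> K" "Inl (2 * n + 1, j) \<notin> K" "Inr (j, 0) \<notin> K" "Inr (j, 2 * n + 1) \<notin> K" for j
    using assms by (auto simp: corners_def)
  have range: "i \<le> n \<longleftrightarrow> i = 0 \<or> i = n \<or> i \<in> {1..<n}" for i by auto
  have "X j \<and> Y j \<longleftrightarrow> Inl (1, j) \<in> K \<and> Inl (2 * n, j) \<in> K \<and> Inr (j, 1) \<in> K \<and> Inr (j, 2 * n) \<in> K \<and>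
      (\<forall>i\<in>{1..<n}. ((Inl (2 * i, j) \<in> K) \<noteq> (Inl (2 * i + 1, j) \<in> K)) \<and>
          ((Inr (j, 2 * i) \<in> K) \<noteq> (Inr (j, 2 * i + 1) \<in> K)))" for j
    unfolding X_def Y_def range using outside[of j] by auto
  then show ?thesis unfolding lhs rhs by blast
qed

text \<open>Complementation is an involution on sets of corners, hence reindexes the sum over
  transversals, and its prefactor is the same for all \<open>K\<close>.\<close>

lemma complementation:
  fixes w :: "nat \<Rightarrow> nat \<Rightarrow> 'r::field"
  assumes "\<And>c. c \<in> cells n \<Longrightarrow> cell_factor w c \<noteq> 0"
  shows "region_gf n (aztec_vertices n) w
       = (\<Prod>c\<in>cells n. cell_factor w c) * region_gf n (inner_vertices n) (rotate_cells w)"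
proof -
  have "region_gf n (aztec_vertices n) w = (\<Sum>K\<in>transversals n (aztec_vertices n).
      (\<Prod>c\<in>cells n. cell_factor w c) * cover_sum n (rotate_cells w) (corners n - K))"
    unfolding region_gf_transversals by (rule sum.cong) (simp_all add: cover_sum_complement[OF assms])
  also have "\<dots> = (\<Sum>K\<in>transversals n (inner_vertices n).
      (\<Prod>c\<in>cells n. cell_factor w c) * cover_sum n (rotate_cells w) K)"
  proof (rule sum.reindex_bij_witness[where i = "\<lambda>K. corners n - K" and j = "\<lambda>K. corners n - K"])
    fix K
    assume "K \<in> transversals n (inner_vertices n)"
    moreover from this have "K \<subseteq> corners n" by (simp add: transversals_def)
    ultimately show "corners n - (corners n - K) = K" "corners n - K \<in> transversals n (aztec_vertices n)"
      by (auto simp: transversals_complement double_diff)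
  next
    fix K
    assume "K \<in> transversals n (aztec_vertices n)"
    moreover from this have "K \<subseteq> corners n" by (simp add: transversals_def)
    ultimately show "corners n - (corners n - K) = K" "corners n - K \<in> transversals n (inner_vertices n)"
      by (auto simp: transversals_complement double_diff)
  qed simp
  finally show ?thesis
    by (simp add: region_gf_transversals flip: sum_distrib_left)
qed

section \<open>Periodic weights\<close>

text \<open>Serves two changes of index: from edges as sets of vertices to positions, and from the
  positions of the inner graph to those of the smaller array.\<close>

lemma sum_subsets_image:
  assumes "inj f"
  shows "(\<Sum>P | P \<subseteq> f ` A \<and> C P. \<Prod>e\<in>P. g e) = (\<Sum>P | P \<subseteq> A \<and> C (f ` P). \<Prod>p\<in>P. g (f p))"
proof -
  have "{P. P \<subseteq> f ` A \<and> C P} = (`) f ` {P. P \<subseteq> A \<and> C (f ` P)}"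
    by (auto simp: subset_image_iff)
  moreover have "inj_on ((`) f) {P. P \<subseteq> A \<and> C (f ` P)}"
    using assms by (simp add: inj_on_def inj_image_eq_iff)
  moreover have "inj_on f P" for P
    using assms by (rule inj_on_subset) simp
  ultimately show ?thesis
    by (simp add: sum.reindex prod.reindex o_def)
qed

lemma ex1_image: "inj f \<Longrightarrow> (\<exists>!e. e \<in> f ` P \<and> C e) \<longleftrightarrow> (\<exists>!p. p \<in> P \<and> C (f p))"
proof -
  assume "inj f"
  then have inj: "f p = f p' \<longleftrightarrow> p = p'" for p p' by (rule inj_eq)
  show ?thesis
  proof
    assume "\<exists>!e. e \<in> f ` P \<and> C e"
    then show "\<exists>!p. p \<in> P \<and> C (f p)" using inj by blast
  next
    assume "\<exists>!p. p \<in> P \<and> C (f p)"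
    then show "\<exists>!e. e \<in> f ` P \<and> C e" by blast
  qed
qed

lemma aztec_edge_subset: "p \<in> positions n \<Longrightarrow> aztec_edge (fst p) (snd p) \<subseteq> aztec_vertices n"
  by (cases p) (auto simp: positions_def aztec_edge_def aztec_vertices_def)

lemma matching_gf_region_gf:
  "matching_gf (aztec_vertices n) (aztec_edges n) wt
     = region_gf n (aztec_vertices n) (\<lambda>r s. wt (aztec_edge r s))"
proof -
  have edges: "aztec_edges n = (\<lambda>(r, s). aztec_edge r s) ` positions n"
    by (auto simp: aztec_edges_def positions_def) blast
  \<comment> \<open>For the full vertex set the containment of edges demanded by
    \<open>region_gf\<close> is automatic.\<close>
  have "{P. P \<subseteq> positions n \<and> (\<forall>v\<in>aztec_vertices n. \<exists>!p. p \<in> P \<and> v \<in> aztec_edge (fst p) (snd p))}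
    = {P. P \<subseteq> positions n \<and> (\<forall>p\<in>P. aztec_edge (fst p) (snd p) \<subseteq> aztec_vertices n)
       \<and> (\<forall>v\<in>aztec_vertices n. \<exists>!p. p \<in> P \<and> v \<in> aztec_edge (fst p) (snd p))}"
    using aztec_edge_subset by (intro Collect_cong) (meson subsetD)
  then show ?thesis
    unfolding matching_gf_def perfect_matching_def edges region_gf_def sum_subsets_image[OF inj_aztec_edge]
      ex1_image[OF inj_aztec_edge]
    by (simp add: case_prod_beta)
qed

section \<open>The inner graph as a smaller diamond\<close>

fun shift_vertex :: "aztec_vertex \<Rightarrow> aztec_vertex" where
  "shift_vertex (Uvert i j) = Vvert (Suc i) j"
| "shift_vertex (Vvert i j) = Uvert i (Suc j)"

lemma inj_shift_vertex: "inj shift_vertex"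
proof (rule injI)
  fix x y assume "shift_vertex x = shift_vertex y"
  then show "x = y" by (cases x; cases y) auto
qed

text \<open>Moving by one row and one column changes both parities, so the \<open>u\<close> and
  \<open>v\<close> vertices exchange their roles.\<close>

lemma shift_aztec_edge: "aztec_edge (Suc r) (Suc s) = shift_vertex ` aztec_edge r s"
  by (simp add: aztec_edge_def insert_commute)

lemma shift_aztec_vertices: "inner_vertices (Suc n) = shift_vertex ` aztec_vertices n"
proof
  show "inner_vertices (Suc n) \<subseteq> shift_vertex ` aztec_vertices n"
  proof
    fix v assume v: "v \<in> inner_vertices (Suc n)"
    show "v \<in> shift_vertex ` aztec_vertices n"
    proof (cases v)
      case (Uvert i j)
      then have "v = shift_vertex (Vvert i (j - 1))" "Vvert i (j - 1) \<in> aztec_vertices n"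
        using v by (auto simp: inner_vertices_def aztec_vertices_def)
      then show ?thesis by blast
    next
      case (Vvert i j)
      then have "v = shift_vertex (Uvert (i - 1) j)" "Uvert (i - 1) j \<in> aztec_vertices n"
        using v by (auto simp: inner_vertices_def aztec_vertices_def)
      then show ?thesis by blast
    qed
  qed
  show "shift_vertex ` aztec_vertices n \<subseteq> inner_vertices (Suc n)"
    by (auto simp: inner_vertices_def aztec_vertices_def)
qed

lemma region_gf_inner:
  "region_gf (Suc n) (inner_vertices (Suc n)) w
     = region_gf n (aztec_vertices n) (\<lambda>r s. w (Suc r) (Suc s))"
proof -
  define f where "f = (\<lambda>p::nat \<times> nat. (Suc (fst p), Suc (snd p)))"
  have inj: "inj f" by (simp add: inj_def f_def prod_eq_iff)
  have edge: "aztec_edge (fst (f p)) (snd (f p)) = shift_vertex ` aztec_edge (fst p) (snd p)" for p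
    by (simp add: f_def shift_aztec_edge)
  define C where "C P \<longleftrightarrow> (\<forall>p\<in>P. aztec_edge (fst p) (snd p) \<subseteq> inner_vertices (Suc n))
      \<and> (\<forall>v\<in>inner_vertices (Suc n). \<exists>!p. p \<in> P \<and> v \<in> aztec_edge (fst p) (snd p))" for P
  \<comment> \<open>An edge with both ends inner avoids the outermost rows and columns of the array,
    so it is the shift of an edge of the smaller array.\<close>
  have "p \<in> f ` positions n"
    if "p \<in> positions (Suc n)" "aztec_edge (fst p) (snd p) \<subseteq> inner_vertices (Suc n)" for p
  proof -
    have "1 \<le> fst p div 2" "fst p div 2 < Suc n" "1 \<le> snd p div 2" "snd p div 2 < Suc n"
      using that(2) by (auto simp: aztec_edge_def inner_vertices_def)
    then have "(fst p - 1, snd p - 1) \<in> positions n" "p = f (fst p - 1, snd p - 1)"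
      by (auto simp: positions_def f_def)
    then show ?thesis by blast
  qed
  moreover have "f ` positions n \<subseteq> positions (Suc n)"
    by (auto simp: f_def positions_def)
  ultimately have "P \<subseteq> positions (Suc n) \<and> C P \<longleftrightarrow> P \<subseteq> f ` positions n \<and> C P" for P
    unfolding C_def by (meson order_trans subset_iff)
  then have "region_gf (Suc n) (inner_vertices (Suc n)) w
      = (\<Sum>P | P \<subseteq> f ` positions n \<and> C P. \<Prod>p\<in>P. w (fst p) (snd p))"
    unfolding region_gf_def C_def by simp
  also have "\<dots> = (\<Sum>P | P \<subseteq> positions n \<and> C (f ` P). \<Prod>p\<in>P. w (fst (f p)) (snd (f p)))"
    by (rule sum_subsets_image[OF inj])
  finally have "region_gf (Suc n) (inner_vertices (Suc n)) w
      = (\<Sum>P | P \<subseteq> positions n \<and> C (f ` P). \<Prod>p\<in>P. w (fst (f p)) (snd (f p)))" .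
  moreover have "C (f ` P) \<longleftrightarrow> (\<forall>p\<in>P. aztec_edge (fst p) (snd p) \<subseteq> aztec_vertices n) \<and>
      (\<forall>v\<in>aztec_vertices n. \<exists>!p. p \<in> P \<and> v \<in> aztec_edge (fst p) (snd p))" for P
    unfolding C_def ex1_image[OF inj] shift_aztec_vertices ball_simps edge
      inj_image_subset_iff[OF inj_shift_vertex] inj_image_mem_iff[OF inj_shift_vertex] ..
  ultimately show ?thesis
    unfolding region_gf_def by (simp add: f_def)
qed

lemma region_gf_cong:
  assumes "\<And>r s. 1 \<le> r \<Longrightarrow> 1 \<le> s \<Longrightarrow> w r s = w' r s"
  shows "region_gf n V w = region_gf n V w'"
  unfolding region_gf_def
proof (rule sum.cong[OF refl], rule prod.cong[OF refl])
  fix P p assume P: "P \<in> {P. P \<subseteq> positions n \<and> (\<forall>p\<in>P. aztec_edge (fst p) (snd p) \<subseteq> V) \<and>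
      (\<forall>v\<in>V. \<exists>!p. p \<in> P \<and> v \<in> aztec_edge (fst p) (snd p))}" and p: "p \<in> P"
  then have "p \<in> positions n" by blast
  then show "w (fst p) (snd p) = w' (fst p) (snd p)"
    by (intro assms) (auto simp: positions_def)
qed

text \<open>Each edge has exactly one end among the \<open>n (n + 1)\<close> vertices \<open>u\<^sub>i\<^sub>,\<^sub>j\<close>.\<close>

lemma card_matching:
  assumes "P \<subseteq> positions n" "\<forall>v\<in>aztec_vertices n. \<exists>!p. p \<in> P \<and> v \<in> aztec_edge (fst p) (snd p)"
  shows "card P = n * (n + 1)"
proof -
  define u where "u p = (fst p div 2, (snd p + 1) div 2)" for p :: "nat \<times> nat"
  have u: "Uvert i j \<in> aztec_edge (fst p) (snd p) \<longleftrightarrow> u p = (i, j)" for i j p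
    by (auto simp: u_def aztec_edge_def)
  have ex1: "\<exists>!p. p \<in> P \<and> u p = (i, j)" if "(i, j) \<in> {0..n} \<times> {1..n}" for i j
    unfolding u[symmetric] using assms(2) that by (auto simp: aztec_vertices_def)
  have mem: "u p \<in> {0..n} \<times> {1..n}" if "p \<in> P" for p
  proof -
    have "p \<in> positions n" using that assms(1) by blast
    then show ?thesis by (cases p) (auto simp: u_def positions_def)
  qed
  have "inj_on u P"
  proof (rule inj_onI)
    fix p p' assume *: "p \<in> P" "p' \<in> P" "u p = u p'"
    obtain i j where ij: "u p = (i, j)" by fastforce
    then show "p = p'" using ex1[of i j] mem[of p] * by metis
  qed
  moreover have "{0..n} \<times> {1..n} \<subseteq> u ` P"
  proof clarify
    fix i j assume "i \<in> {0..n}" "j \<in> {1..n}"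
    then obtain p where "p \<in> P" "u p = (i, j)" using ex1[of i j] by blast
    then show "(i, j) \<in> u ` P" by force
  qed
  then have "u ` P = {0..n} \<times> {1..n}"
    using mem by blast
  ultimately have "card P = card ({0..n} \<times> {1..n})"
    by (metis card_image)
  then show ?thesis by (simp add: card_cartesian_product)
qed

lemma region_gf_scale:
  "region_gf n (aztec_vertices n) (\<lambda>r s. k * w r s) = k ^ (n * (n + 1)) * region_gf n (aztec_vertices n) w"
  unfolding region_gf_def sum_distrib_left
proof (rule sum.cong[OF refl])
  fix P assume "P \<in> {P. P \<subseteq> positions n \<and> (\<forall>p\<in>P. aztec_edge (fst p) (snd p) \<subseteq> aztec_vertices n) \<and>
      (\<forall>v\<in>aztec_vertices n. \<exists>!p. p \<in> P \<and> v \<in> aztec_edge (fst p) (snd p))}"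
  then have "card P = n * (n + 1)" using card_matching by blast
  then show "(\<Prod>p\<in>P. k * w (fst p) (snd p)) = k ^ (n * (n + 1)) * (\<Prod>p\<in>P. w (fst p) (snd p))"
    by (simp only: prod.distrib prod_constant)
qed

lemma region_gf_hom:
  assumes "h 0 = 0" "\<And>x y. h (x + y) = h x + h y" "h 1 = 1" "\<And>x y. h (x * y) = h x * h y"
  shows "h (region_gf n V w) = region_gf n V (\<lambda>r s. h (w r s))"
proof -
  have sum: "h (\<Sum>x\<in>A. F x) = (\<Sum>x\<in>A. h (F x))" for F and A :: "(nat \<times> nat) set set"
    using assms(1,2) by (induction A rule: infinite_finite_induct) auto
  have prod: "h (\<Prod>x\<in>A. F x) = (\<Prod>x\<in>A. h (F x))" for F and A :: "(nat \<times> nat) set"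
    using assms(3,4) by (induction A rule: infinite_finite_induct) auto
  show ?thesis unfolding region_gf_def sum prod ..
qed

section \<open>Reduction of a 4-periodic weight\<close>

definition periodic :: "'r list list \<Rightarrow> nat \<Rightarrow> nat \<Rightarrow> 'r" where
  "periodic L r s = L ! ((r - 1) mod 4) ! ((s - 1) mod 4)"

definition diamond_gf :: "nat \<Rightarrow> 'r::comm_semiring_1 list list \<Rightarrow> 'r" where
  "diamond_gf n L = region_gf n (aztec_vertices n) (periodic L)"

lemma diamond_gf_0: "diamond_gf 0 L = 1"
proof -
  have "{P. P \<subseteq> positions 0 \<and> (\<forall>p\<in>P. aztec_edge (fst p) (snd p) \<subseteq> aztec_vertices 0)
       \<and> (\<forall>v\<in>aztec_vertices 0. \<exists>!p. p \<in> P \<and> v \<in> aztec_edge (fst p) (snd p))} = {{}}"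
    by (auto simp: positions_def aztec_vertices_def)
  then show ?thesis by (simp add: diamond_gf_def region_gf_def)
qed

text \<open>The factor of a cell depends only on the parities of its two indices when the weight is
  4-periodic; this counts the odd and the even indices.\<close>

lemma prod_parity:
  fixes F :: "bool \<Rightarrow> 'r::comm_monoid_mult"
  shows "(\<Prod>i\<in>{1..N}. F (odd i)) = F True ^ ((N + 1) div 2) * F False ^ (N div 2)"
proof (induction N)
  case (Suc N)
  then show ?case by (cases "even N") (auto simp: ac_simps elim!: oddE evenE)
qed simp

lemma block_index:
  fixes i :: nat
  assumes "i \<ge> 1"
  shows "(2 * i - 1 - 1) mod 4 = (if odd i then 0 else 2)" "(2 * i - 1) mod 4 = (if odd i then 1 else 3)"
proof -
  have i: "i = 2 * ((i - 1) div 2) + (i - 1) mod 2 + 1" "(i - 1) mod 2 < 2"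
    using assms by simp_all
  obtain k where "k = (i - 1) div 2" by simp
  with i have "i = Suc (2 * k) \<or> i = Suc (Suc (2 * k))" by linarith
  then show "(2 * i - 1 - 1) mod 4 = (if odd i then 0 else 2)" "(2 * i - 1) mod 4 = (if odd i then 1 else 3)"
    by (elim disjE; simp add: mod_Suc)+
qed

text \<open>Shifting by one and then passing to the partner row inside the cell permutes the indices
  \<open>0, 1, 2, 3\<close> into \<open>0, 3, 2, 1\<close>. The same holds for columns.\<close>

lemma rotated_index:
  fixes r :: nat
  assumes "r \<ge> 1"
  shows "((if odd (Suc r) then Suc r + 1 else Suc r - 1) - 1) mod 4
      = (if (r - 1) mod 4 = 0 then 0 else if (r - 1) mod 4 = 1 then 3 else if (r - 1) mod 4 = 2 then 2 else 1)"
    "odd ((Suc r + 1) div 2) \<longleftrightarrow> (r - 1) mod 4 = 0 \<or> (r - 1) mod 4 = 3"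
proof -
  have "r = 4 * ((r - 1) div 4) + (r - 1) mod 4 + 1"
    using assms by simp
  moreover have "(r - 1) mod 4 < 4" by simp
  moreover obtain k where "k = (r - 1) div 4" by simp
  ultimately have "r = Suc (4 * k) \<or> r = Suc (Suc (4 * k)) \<or> r = Suc (Suc (Suc (4 * k)))
      \<or> r = Suc (Suc (Suc (Suc (4 * k))))"
    by linarith
  then show "((if odd (Suc r) then Suc r + 1 else Suc r - 1) - 1) mod 4
      = (if (r - 1) mod 4 = 0 then 0 else if (r - 1) mod 4 = 1 then 3 else if (r - 1) mod 4 = 2 then 2 else 1)"
    "odd ((Suc r + 1) div 2) \<longleftrightarrow> (r - 1) mod 4 = 0 \<or> (r - 1) mod 4 = 3"
    by (elim disjE; simp add: mod_Suc)+
qed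

text \<open>\<open>L'\<close> lists the rows and columns of \<open>L\<close> in the order
  \<open>0, 3, 2, 1\<close>, each entry divided by the factor of the block it comes from. Of the
  \<open>n + 1\<close> rows of cells, \<open>n div 2 + 1\<close> are odd and
  \<open>(n + 1) div 2\<close> are even, whence the exponents. The factors are separate variables so
  that they can be supplied in simplified form.\<close>

lemma reduction_step:
  fixes x00 :: "'r::field"
  assumes L: "L = [[x00, x01, x02, x03], [x10, x11, x12, x13], [x20, x21, x22, x23], [x30, x31, x32, x33]]"
    and D: "x00 * x11 + x01 * x10 = D1" "x02 * x13 + x03 * x12 = D2"
      "x20 * x31 + x21 * x30 = D3" "x22 * x33 + x23 * x32 = D4"
    and D0: "D1 \<noteq> 0" "D2 \<noteq> 0" "D3 \<noteq> 0" "D4 \<noteq> 0"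
    and L': "L' = [[x00 / D1, x03 / D2, x02 / D2, x01 / D1], [x30 / D3, x33 / D4, x32 / D4, x31 / D3],
                   [x20 / D3, x23 / D4, x22 / D4, x21 / D3], [x10 / D1, x13 / D2, x12 / D2, x11 / D1]]"
  shows "diamond_gf (Suc n) L = D1 ^ ((n div 2 + 1)\<^sup>2) * (D2 * D3) ^ ((n div 2 + 1) * ((n + 1) div 2))
      * D4 ^ (((n + 1) div 2)\<^sup>2) * diamond_gf n L'"
proof -
  define D where "D p q = (if p then if q then D1 else D2 else if q then D3 else D4)" for p q
  have factor: "cell_factor (periodic L) c = D (odd (fst c)) (odd (snd c))" if "fst c \<ge> 1" "snd c \<ge> 1" for c
    unfolding cell_factor_def periodic_def block_index[OF that(1)] block_index[OF that(2)]
    using D by (simp add: L D_def)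
  have "cell_factor (periodic L) c \<noteq> 0" if "c \<in> cells (Suc n)" for c
    using that D0 by (simp add: factor cells_def D_def mem_Times_iff)
  then have "diamond_gf (Suc n) L = (\<Prod>c\<in>cells (Suc n). cell_factor (periodic L) c)
      * region_gf n (aztec_vertices n) (\<lambda>r s. rotate_cells (periodic L) (Suc r) (Suc s))"
    unfolding diamond_gf_def by (simp add: complementation region_gf_inner)
  also have "(\<Prod>c\<in>cells (Suc n). cell_factor (periodic L) c)
      = (\<Prod>i\<in>{1..Suc n}. \<Prod>j\<in>{1..Suc n}. D (odd i) (odd j))"
    unfolding cells_def prod.cartesian_product by (intro prod.cong) (auto simp: factor)
  also have "\<dots> = D1 ^ ((n div 2 + 1)\<^sup>2) * (D2 * D3) ^ ((n div 2 + 1) * ((n + 1) div 2)) * D4 ^ (((n + 1) div 2)\<^sup>2)"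
  proof -
    have pow: "(D1 ^ u * D2 ^ v) ^ u * (D3 ^ u * D4 ^ v) ^ v = D1 ^ u\<^sup>2 * (D2 * D3) ^ (u * v) * D4 ^ v\<^sup>2" for u v
      by (simp add: power_mult_distrib power2_eq_square mult.commute[of v u] flip: power_mult)
    have half: "(Suc n + 1) div 2 = n div 2 + 1" "Suc n div 2 = (n + 1) div 2" by simp_all
    show ?thesis
      unfolding prod_parity[where F = "D _"] prod_parity[where F = "\<lambda>p. D p True ^ _ * D p False ^ _"] half
        pow[symmetric] by (simp add: D_def)
  qed
  also have "region_gf n (aztec_vertices n) (\<lambda>r s. rotate_cells (periodic L) (Suc r) (Suc s)) = diamond_gf n L'"
    unfolding diamond_gf_def
  proof (rule region_gf_cong)
    fix r s :: nat assume "1 \<le> r" "1 \<le> s"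
    have four: "m mod 4 = 0 \<or> m mod 4 = 1 \<or> m mod 4 = 2 \<or> m mod 4 = 3" for m :: nat
      using mod_less_divisor[of 4 m] by linarith
    have entry: "L ! (if k = 0 then 0 else if k = 1 then 3 else if k = 2 then 2 else 1)
          ! (if m = 0 then 0 else if m = 1 then 3 else if m = 2 then 2 else 1)
          / D (k = 0 \<or> k = 3) (m = 0 \<or> m = 3) = L' ! k ! m"
      if "k = 0 \<or> k = 1 \<or> k = 2 \<or> k = 3" "m = 0 \<or> m = 1 \<or> m = 2 \<or> m = 3" for k m :: nat
      using that by (elim disjE) (simp_all add: L L' D_def numeral_eq_Suc)
    have pos: "1 \<le> fst ((Suc r + 1) div 2, (Suc s + 1) div 2)" "1 \<le> snd ((Suc r + 1) div 2, (Suc s + 1) div 2)"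
      by simp_all
    have "rotate_cells (periodic L) (Suc r) (Suc s)
        = L ! (((if odd (Suc r) then Suc r + 1 else Suc r - 1) - 1) mod 4)
            ! (((if odd (Suc s) then Suc s + 1 else Suc s - 1) - 1) mod 4)
          / D (odd ((Suc r + 1) div 2)) (odd ((Suc s + 1) div 2))"
      unfolding rotate_cells_def factor[OF pos] periodic_def fst_conv snd_conv ..
    also have "\<dots> = periodic L' r s"
      unfolding rotated_index[OF \<open>1 \<le> r\<close>] rotated_index[OF \<open>1 \<le> s\<close>] periodic_def
      by (rule entry[OF four four])
    finally show "rotate_cells (periodic L) (Suc r) (Suc s) = periodic L' r s" .
  qed
  finally show ?thesis .
qed

lemma diamond_gf_scale:
  assumes "length L = 4" "\<And>l. l \<in> set L \<Longrightarrow> length l = 4"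
  shows "diamond_gf n (map (map ((*) k)) L) = k ^ (n * (n + 1)) * diamond_gf n L"
proof -
  have "periodic (map (map ((*) k)) L) r s = k * periodic L r s" for r s
    using assms by (simp add: periodic_def)
  then have "periodic (map (map ((*) k)) L) = (\<lambda>r s. k * periodic L r s)"
    by blast
  then show ?thesis
    unfolding diamond_gf_def by (simp only: region_gf_scale)
qed

section \<open>The orbit of the weight matrix\<close>

text \<open>With exponent vectors, all products and quotients in the orbit become integer arithmetic
  on lists, which the simplifier can carry out.\<close>

definition monomial :: "'a::field list \<Rightarrow> int list \<Rightarrow> 'a" where
  "monomial xs es = prod_list (map2 (powi) xs es)"

lemma monomial_simps:
  "monomial [] es = 1" "monomial xs [] = 1"
  "monomial (x # xs) (e # es) = x powi e * monomial xs es"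
  by (simp_all add: monomial_def)

lemma monomial_add:
  "0 \<notin> set xs \<Longrightarrow> length es = length xs \<Longrightarrow> length es' = length xs \<Longrightarrow>
    monomial xs es * monomial xs es' = monomial xs (map2 (+) es es')"
proof (induction xs arbitrary: es es')
  case (Cons x xs)
  then obtain e es1 e' es1' where "es = e # es1" "es' = e' # es1'"
    by (metis length_Suc_conv)
  with Cons show ?case by (simp add: monomial_simps power_int_add ac_simps flip: Cons.IH)
qed (simp add: monomial_simps)

lemma monomial_diff:
  "0 \<notin> set xs \<Longrightarrow> length es = length xs \<Longrightarrow> length es' = length xs \<Longrightarrow>
    monomial xs es / monomial xs es' = monomial xs (map2 (-) es es')"
proof (induction xs arbitrary: es es')
  case (Cons x xs)
  then obtain e es1 e' es1' where "es = e # es1" "es' = e' # es1'"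
    by (metis length_Suc_conv)
  with Cons show ?case by (simp add: monomial_simps power_int_diff flip: Cons.IH)
qed (simp add: monomial_simps)

lemma monomial_power: "monomial xs es ^ k = monomial xs (map (\<lambda>e. e * int k) es)"
proof (induction xs arbitrary: es)
  case (Cons x xs)
  show ?case
  proof (cases es)
    case (Cons e es1)
    have "(x powi e) ^ k = x powi (e * int k)"
      by (metis power_int_mult power_int_of_nat)
    then show ?thesis by (simp add: Cons monomial_simps power_mult_distrib Cons.IH)
  qed (simp add: monomial_simps)
qed (simp add: monomial_simps)

lemma monomial_nonzero: "0 \<notin> set xs \<Longrightarrow> monomial xs es \<noteq> 0"
proof (induction xs arbitrary: es)
  case (Cons x xs)
  then show ?case by (cases es) (auto simp: monomial_simps)
qed (simp add: monomial_simps)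

text \<open>Isolates the additions of the orbit: the two products in a cell factor share a monomial
  \<open>k\<close>, and what remains is a known relation \<open>p + q = r\<close>.\<close>

lemma add_common_factor:
  fixes x y z k p q r :: "'a::comm_semiring_0"
  assumes "p + q = r" "x = k * p" "y = k * q" "z = k * r"
  shows "x + y = z"
  using assms by (simp flip: distrib_left)

text \<open>\<open>F t m\<close> stands for the diamond of order \<open>2 * m\<close> or
  \<open>2 * m + 1\<close> weighted by the matrix reached after \<open>t\<close> pairs of
  reductions. Starting from \<open>q + k\<close>, pair number \<open>t\<close> ends at
  \<open>q + (k - Suc t)\<close>, which is the \<open>m\<close> of that pair.\<close>

lemma iterate_steps:
  fixes F :: "nat \<Rightarrow> nat \<Rightarrow> 'a::comm_semiring_1"
  assumes "\<And>t m. t < N \<Longrightarrow> F t (Suc m) = U t ^ m\<^sup>2 * V t ^ m * C t * F (Suc t) m"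
  shows "k \<le> N \<Longrightarrow> F 0 (q + k)
    = (\<Prod>t<k. U t ^ (q + (k - Suc t))\<^sup>2 * V t ^ (q + (k - Suc t)) * C t) * F k q"
proof (induction k arbitrary: q)
  case (Suc k)
  have "F 0 (q + Suc k) = F 0 (Suc q + k)" by simp
  also have "\<dots> = (\<Prod>t<k. U t ^ (Suc q + (k - Suc t))\<^sup>2 * V t ^ (Suc q + (k - Suc t)) * C t) * F k (Suc q)"
    using Suc by (intro Suc.IH) simp
  also have "(\<Prod>t<k. U t ^ (Suc q + (k - Suc t))\<^sup>2 * V t ^ (Suc q + (k - Suc t)) * C t)
      = (\<Prod>t<k. U t ^ (q + (Suc k - Suc t))\<^sup>2 * V t ^ (q + (Suc k - Suc t)) * C t)"
    by (intro prod.cong) (simp_all add: Suc_diff_Suc)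
  also have "F k (Suc q) = U k ^ q\<^sup>2 * V k ^ q * C k * F (Suc k) q"
    using Suc.prems by (intro assms) simp
  finally show ?case by (simp add: mult.assoc)
qed simp

text \<open>Expanding the square of \<open>q + j\<close> with \<open>j = N - Suc t\<close> separates
  the dependence on \<open>q\<close> into a quadratic, a linear and a constant part, so that the
  three products no longer involve \<open>q\<close>.\<close>

lemma iterate_steps_powers:
  fixes F :: "nat \<Rightarrow> nat \<Rightarrow> 'a::comm_semiring_1"
  assumes "\<And>t m. t < N \<Longrightarrow> F t (Suc m) = U t ^ m\<^sup>2 * V t ^ m * C t * F (Suc t) m"
  shows "F 0 (q + N) = (\<Prod>t<N. U t) ^ q\<^sup>2 * (\<Prod>t<N. U t ^ (2 * (N - Suc t)) * V t) ^ q
    * (\<Prod>t<N. U t ^ (N - Suc t)\<^sup>2 * V t ^ (N - Suc t) * C t) * F N q"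
proof -
  have sq: "x ^ (q + j)\<^sup>2 = x ^ q\<^sup>2 * (x ^ (2 * j)) ^ q * x ^ j\<^sup>2" for x :: 'a and j
    by (simp add: power2_sum power_add mult.commute mult.left_commute flip: power_mult)
  have split: "U t ^ (q + (N - Suc t))\<^sup>2 * V t ^ (q + (N - Suc t)) * C t
      = U t ^ q\<^sup>2 * (U t ^ (2 * (N - Suc t)) * V t) ^ q * (U t ^ (N - Suc t)\<^sup>2 * V t ^ (N - Suc t) * C t)" for t
    unfolding sq by (simp add: power_add power_mult_distrib ac_simps)
  show ?thesis
    using iterate_steps[of N F U V C N q, OF assms] unfolding split
    by (simp only: prod_power_distrib le_refl flip: prod.distrib)
qed

text \<open>On the way from order \<open>2 * m + 2\<close> to \<open>2 * m\<close> the rounded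
  halves are \<open>m + 1, m + 1\<close> and then \<open>m + 1, m\<close>. \<open>U\<close>,
  \<open>V\<close>, \<open>C\<close> collect the coefficients of the square of \<open>m\<close>, of
  \<open>m\<close> and of 1 in their products.\<close>

lemma two_steps_even:
  fixes L :: "'a::field list list"
  assumes "\<And>n. diamond_gf (Suc n) L = D1 ^ (n div 2 + 1)\<^sup>2 * (D2 * D3) ^ ((n div 2 + 1) * ((n + 1) div 2))
      * D4 ^ ((n + 1) div 2)\<^sup>2 * diamond_gf n L'"
    and "\<And>n. diamond_gf (Suc n) L' = E1 ^ (n div 2 + 1)\<^sup>2 * (E2 * E3) ^ ((n div 2 + 1) * ((n + 1) div 2))
      * E4 ^ ((n + 1) div 2)\<^sup>2 * diamond_gf n L''"
    and U: "U = D1 * (D2 * D3) * D4 * (E1 * (E2 * E3) * E4)"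
    and V: "V = (D1 * (D2 * D3) * D4)\<^sup>2 * (E1\<^sup>2 * (E2 * E3))" and C: "C = D1 * (D2 * D3) * D4 * E1"
  shows "diamond_gf (2 * Suc m) L = U ^ m\<^sup>2 * V ^ m * C * diamond_gf (2 * m) L''"
proof -
  have "diamond_gf (2 * Suc m) L = D1 ^ (m + 1)\<^sup>2 * (D2 * D3) ^ ((m + 1) * (m + 1)) * D4 ^ (m + 1)\<^sup>2
      * (E1 ^ (m + 1)\<^sup>2 * (E2 * E3) ^ ((m + 1) * m) * E4 ^ m\<^sup>2 * diamond_gf (2 * m) L'')"
    using assms(1)[of "Suc (2 * m)"] assms(2)[of "2 * m"] by simp
  moreover have sq: "x ^ (m + 1)\<^sup>2 = x ^ m\<^sup>2 * (x\<^sup>2) ^ m * x" "x ^ ((m + 1) * (m + 1)) = x ^ m\<^sup>2 * (x\<^sup>2) ^ m * x"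
    "x ^ ((m + 1) * m) = x ^ m\<^sup>2 * x ^ m" for x :: 'a
    by (simp_all add: power2_eq_square power_add algebra_simps flip: power_mult)
  ultimately show ?thesis
    unfolding U V C by (simp only: sq power_mult_distrib) (simp add: ac_simps)
qed

text \<open>For odd orders the rounded halves are \<open>m + 2, m + 1\<close> and then
  \<open>m + 1, m + 1\<close>.\<close>

lemma two_steps_odd:
  fixes L :: "'a::field list list"
  assumes "\<And>n. diamond_gf (Suc n) L = D1 ^ (n div 2 + 1)\<^sup>2 * (D2 * D3) ^ ((n div 2 + 1) * ((n + 1) div 2))
      * D4 ^ ((n + 1) div 2)\<^sup>2 * diamond_gf n L'"
    and "\<And>n. diamond_gf (Suc n) L' = E1 ^ (n div 2 + 1)\<^sup>2 * (E2 * E3) ^ ((n div 2 + 1) * ((n + 1) div 2))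
      * E4 ^ ((n + 1) div 2)\<^sup>2 * diamond_gf n L''"
    and U: "U = D1 * (D2 * D3) * D4 * (E1 * (E2 * E3) * E4)"
    and V: "V = D1 ^ 4 * (D2 * D3) ^ 3 * D4\<^sup>2 * (E1 * (E2 * E3) * E4)\<^sup>2"
    and C: "C = D1 ^ 4 * (D2 * D3)\<^sup>2 * D4 * (E1 * (E2 * E3) * E4)"
  shows "diamond_gf (2 * Suc m + 1) L = U ^ m\<^sup>2 * V ^ m * C * diamond_gf (2 * m + 1) L''"
proof -
  have "diamond_gf (2 * Suc m + 1) L = D1 ^ (m + 2)\<^sup>2 * (D2 * D3) ^ ((m + 2) * (m + 1)) * D4 ^ (m + 1)\<^sup>2
      * (E1 ^ (m + 1)\<^sup>2 * (E2 * E3) ^ ((m + 1) * (m + 1)) * E4 ^ (m + 1)\<^sup>2 * diamond_gf (2 * m + 1) L'')"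
    using assms(1)[of "Suc (Suc (2 * m))"] assms(2)[of "Suc (2 * m)"] by simp
  moreover have sq: "x ^ (m + 1)\<^sup>2 = x ^ m\<^sup>2 * (x\<^sup>2) ^ m * x" "x ^ ((m + 1) * (m + 1)) = x ^ m\<^sup>2 * (x\<^sup>2) ^ m * x"
    "x ^ (m + 2)\<^sup>2 = x ^ m\<^sup>2 * (x ^ 4) ^ m * x ^ 4" "x ^ ((m + 2) * (m + 1)) = x ^ m\<^sup>2 * (x ^ 3) ^ m * x\<^sup>2" for x :: 'a
  proof -
    have "(m + 1)\<^sup>2 = m\<^sup>2 + 2 * m + 1" "(m + 1) * (m + 1) = m\<^sup>2 + 2 * m + 1"
      "(m + 2)\<^sup>2 = m\<^sup>2 + 4 * m + 4" "(m + 2) * (m + 1) = m\<^sup>2 + 3 * m + 2"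
      by (simp_all add: power2_eq_square algebra_simps)
    then show "x ^ (m + 1)\<^sup>2 = x ^ m\<^sup>2 * (x\<^sup>2) ^ m * x" "x ^ ((m + 1) * (m + 1)) = x ^ m\<^sup>2 * (x\<^sup>2) ^ m * x"
      "x ^ (m + 2)\<^sup>2 = x ^ m\<^sup>2 * (x ^ 4) ^ m * x ^ 4" "x ^ ((m + 2) * (m + 1)) = x ^ m\<^sup>2 * (x ^ 3) ^ m * x\<^sup>2"
      by (simp_all only: power_add power_mult power_one_right)
  qed
  ultimately show ?thesis
    unfolding U V C by (simp only: sq power_mult_distrib) (simp add: ac_simps)
qed

text \<open>
  Exponent vectors, in the order \<open>2, a, b, c, d, e, f, g, h, R, S, T, P, Q\<close>, of the monomials \<open>U, V, C\<close> such
  that the two reductions starting from the \<open>2 t\<close>-th matrix contribute \<open>U\<^bsup>m\<^sup>2\<^esup> V\<^bsup>m\<^esup> C\<close>, where the smaller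
  diamond has order \<open>2 m\<close> or \<open>2 m + 1\<close>. The exponents \<open>U\<close> do not depend on the parity of the order.
\<close>

definition two_step_exponents :: "int list list" where
  "two_step_exponents =
    [[0,1,1,-1,-1,-1,-1,1,1,3,-3,-3,0,0],
     [3,-1,-1,0,0,0,0,-1,-1,5,-1,-1,-3,-3],
     [5,0,0,1,1,1,1,0,0,0,0,0,-1,-1],
     [0,1,1,-1,-1,-1,-1,1,1,3,-3,-3,0,0],
     [3,-1,-1,0,0,0,0,-1,-1,5,-1,-1,-3,-3],
     [5,0,0,1,1,1,1,0,0,0,0,0,-1,-1]]"

definition even_linear_exponents :: "int list list" where
  "even_linear_exponents =
    [[0,2,2,-1,-1,-1,-1,0,0,4,-2,-2,0,0],
     [4,-4,-4,5,5,5,5,-2,-2,-4,6,6,-2,-2],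
     [-4,4,4,1,1,1,1,2,2,-16,8,8,6,6],
     [-16,-2,-2,1,1,1,1,0,0,-12,6,6,8,8],
     [-12,0,0,3,3,3,3,-2,-2,-20,14,14,6,6],
     [-20,0,0,3,3,3,3,2,2,-32,16,16,14,14]]"

definition even_constant_exponents :: "int list list" where
  "even_constant_exponents =
    [[0,1,1,0,0,0,0,0,0,1,0,0,0,0],
     [1,-2,-2,3,3,3,3,-1,-1,-5,5,5,0,0],
     [-5,2,2,1,1,1,1,1,1,-12,6,6,5,5],
     [-12,-1,-1,1,1,1,1,0,0,-11,6,6,6,6],
     [-11,0,0,2,2,2,2,-1,-1,-17,11,11,6,6],
     [-17,0,0,2,2,2,2,1,1,-24,12,12,11,11]]"

definition odd_linear_exponents :: "int list list" where
  "odd_linear_exponents =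
    [[0,2,2,-2,0,0,-2,2,2,6,-5,-5,0,0],
     [6,-3,-3,4,2,2,4,-3,-3,2,5,5,-5,-5],
     [2,1,1,3,5,5,3,1,1,-16,8,8,5,5],
     [-16,2,2,0,-2,-2,0,2,2,-10,3,3,8,8],
     [-10,-3,-3,2,4,4,2,-3,-3,-14,13,13,3,3],
     [-14,1,1,5,3,3,5,1,1,-32,16,16,13,13]]"

definition odd_constant_exponents :: "int list list" where
  "odd_constant_exponents =
    [[0,1,1,-1,2,2,-1,1,1,3,-2,-2,0,0],
     [3,-2,-2,5,2,2,5,-2,-2,-5,8,8,-2,-2],
     [-5,1,1,2,5,5,2,1,1,-20,10,10,8,8],
     [-20,1,1,2,-1,-1,2,1,1,-17,8,8,10,10],
     [-17,-2,-2,2,5,5,2,-2,-2,-25,18,18,8,8],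
     [-25,1,1,5,2,2,5,1,1,-40,20,20,18,18]]"

text \<open>Even orders descend to order 0 with value 1, odd orders only to order 1, where the value
  still depends on the matrix reached.\<close>

definition odd_initial_exponents :: "int list list" where
  "odd_initial_exponents =
    [[0,0,0,0,1,1,0,0,0,0,0,0,0,0],
     [0,0,0,1,0,0,1,0,0,-2,2,2,0,0],
     [-2,0,0,0,1,1,0,0,0,-4,2,2,2,2],
     [-4,0,0,1,0,0,1,0,0,-4,2,2,2,2],
     [-4,0,0,0,1,1,0,0,0,-6,4,4,2,2],
     [-6,0,0,1,0,0,1,0,0,-8,4,4,4,4]]"

text \<open>\<open>R\<close> and the four binomials are atoms beside the variables, as is
  \<open>2\<close>, which enters through relations such as
  \<open>P * Q + a * b * g * h = 2 * R\<close>. Keeping \<open>mono\<close> as a parameter hides the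
  product of powers from the simplifier, which then sees only exponents.\<close>

locale periodic_weights =
  fixes a b c d e f g h R S T P Q :: "'a::field" and mono :: "int list \<Rightarrow> 'a"
  assumes nonzero: "a \<noteq> 0" "b \<noteq> 0" "c \<noteq> 0" "d \<noteq> 0" "e \<noteq> 0" "f \<noteq> 0" "g \<noteq> 0" "h \<noteq> 0"
    "R \<noteq> 0" "S \<noteq> 0" "T \<noteq> 0" "P \<noteq> 0" "Q \<noteq> 0" "(2::'a) \<noteq> 0"
    and S: "S = a * g + d * e" and T: "T = b * h + c * f"
    and P: "P = a * g + 2 * d * e" and Q: "Q = b * h + 2 * c * f"
    and R: "R = a * b * g * h + a * c * f * g + b * d * e * h + 2 * c * d * e * f"
    and mono: "mono = monomial [2, a, b, c, d, e, f, g, h, R, S, T, P, Q]"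
begin

text \<open>Apart from \<open>1 + 1 = 2\<close>, these are all the nontrivial additions of the
  orbit, with the summands in the orders in which the cells produce them.\<close>

lemma relations:
  "d * e + a * g = S" "c * f + b * h = T" "S * T + c * d * e * f = R" "c * d * e * f + S * T = R"
  "b * d * e * h + R = T * P" "a * c * f * g + R = S * Q" "P * Q + a * b * g * h = 2 * R"
  "a * b * g * h + P * Q = 2 * R" "b * h + 2 * c * f = Q" "a * g + 2 * d * e = P"
  by (simp_all add: S T P Q R algebra_simps)

lemma atoms_nonzero: "0 \<notin> set [2, a, b, c, d, e, f, g, h, R, S, T, P, Q]"
  by (simp add: nonzero nonzero[symmetric])

lemma mono_nonzero: "mono es \<noteq> 0"
  unfolding mono by (rule monomial_nonzero[OF atoms_nonzero])

lemma laurent_arith: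
  "mono [x0, x1, x2, x3, x4, x5, x6, x7, x8, x9, x10, x11, x12, x13] * mono [y0, y1, y2, y3, y4, y5, y6, y7, y8, y9, y10, y11, y12, y13] = mono 
      [x0 + y0, x1 + y1, x2 + y2, x3 + y3, x4 + y4, x5 + y5, x6 + y6, x7 + y7, x8 + y8, x9 + y9, x10 + y10, x11 + y11, x12 + y12, x13 + y13]"
  "mono [x0, x1, x2, x3, x4, x5, x6, x7, x8, x9, x10, x11, x12, x13] / mono [y0, y1, y2, y3, y4, y5, y6, y7, y8, y9, y10, y11, y12, y13] = mono 
      [x0 - y0, x1 - y1, x2 - y2, x3 - y3, x4 - y4, x5 - y5, x6 - y6, x7 - y7, x8 - y8, x9 - y9, x10 - y10, x11 - y11, x12 - y12, x13 - y13]"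
  "mono [x0, x1, x2, x3, x4, x5, x6, x7, x8, x9, x10, x11, x12, x13] ^ k = mono
      [x0 * int k, x1 * int k, x2 * int k, x3 * int k, x4 * int k, x5 * int k, x6 * int k, x7 * int k, x8 * int k, x9 * int k, x10 * int k, x11 * int k, x12 * int k, x13 * int k]"
  using monomial_add[OF atoms_nonzero, of "[x0, x1, x2, x3, x4, x5, x6, x7, x8, x9, x10, x11, x12, x13]" "[y0, y1, y2, y3, y4, y5, y6, y7, y8, y9, y10, y11, y12, y13]"]
    monomial_diff[OF atoms_nonzero, of "[x0, x1, x2, x3, x4, x5, x6, x7, x8, x9, x10, x11, x12, x13]" "[y0, y1, y2, y3, y4, y5, y6, y7, y8, y9, y10, y11, y12, y13]"]
  by (simp_all add: mono monomial_power)

lemma laurent_atoms: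
  "2 = mono [1, 0, 0, 0, 0, 0, 0, 0, 0, 0, 0, 0, 0, 0]"
  "a = mono [0, 1, 0, 0, 0, 0, 0, 0, 0, 0, 0, 0, 0, 0]"
  "b = mono [0, 0, 1, 0, 0, 0, 0, 0, 0, 0, 0, 0, 0, 0]"
  "c = mono [0, 0, 0, 1, 0, 0, 0, 0, 0, 0, 0, 0, 0, 0]"
  "d = mono [0, 0, 0, 0, 1, 0, 0, 0, 0, 0, 0, 0, 0, 0]"
  "e = mono [0, 0, 0, 0, 0, 1, 0, 0, 0, 0, 0, 0, 0, 0]"
  "f = mono [0, 0, 0, 0, 0, 0, 1, 0, 0, 0, 0, 0, 0, 0]"
  "g = mono [0, 0, 0, 0, 0, 0, 0, 1, 0, 0, 0, 0, 0, 0]"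
  "h = mono [0, 0, 0, 0, 0, 0, 0, 0, 1, 0, 0, 0, 0, 0]"
  "R = mono [0, 0, 0, 0, 0, 0, 0, 0, 0, 1, 0, 0, 0, 0]"
  "S = mono [0, 0, 0, 0, 0, 0, 0, 0, 0, 0, 1, 0, 0, 0]"
  "T = mono [0, 0, 0, 0, 0, 0, 0, 0, 0, 0, 0, 1, 0, 0]"
  "P = mono [0, 0, 0, 0, 0, 0, 0, 0, 0, 0, 0, 0, 1, 0]"
  "Q = mono [0, 0, 0, 0, 0, 0, 0, 0, 0, 0, 0, 0, 0, 1]"
  "1 = mono [0, 0, 0, 0, 0, 0, 0, 0, 0, 0, 0, 0, 0, 0]"
  by (simp_all add: mono monomial_simps)

lemmas laurent = laurent_atoms laurent_arith

text \<open>\<open>Wk\<close> arises from \<open>W0\<close> by \<open>k\<close> reductions; the entries were computed by machine.\<close>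

definition W0 :: "'a list list" where
  "W0 = [[a, d, d, a],
    [e, 0, g, e],
    [f, h, 0, f],
    [b, c, c, b]]"

definition W1 :: "'a list list" where
  "W1 = [[a / (d * e), a / S, d / S, 1 / e],
    [b / T, b / (c * f), 1 / f, c / T],
    [f / T, 1 / c, 0, h / T],
    [1 / d, e / S, g / S, 0]]"

definition W2 :: "'a list list" where
  "W2 = [[c * f * S * T / (b * R), f * S * T / R, d * e * f * T / R, c * d * e * f * T / (b * R)],
    [c * S * T / R, 0, T / h, c * d * e * T / R],
    [c * d * f * S / R, S / g, 0, d * S * T / R],
    [c * d * e * f * S / (a * R), c * e * f * S / R, e * S * T / R, d * e * S * T / (a * R)]]"

definition W3 :: "'a list list" where
  "W3 = [[R / (b * S * T), h * R / (T^2 * P), b * h * R / (c * T^2 * P), R / (c * S * T)],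
    [g * R / (S^2 * Q), R / (a * S * T), R / (d * S * T), a * g * R / (d * S^2 * Q)],
    [a * g * R / (e * S^2 * Q), R / (e * S * T), 0, a * R^2 / (c * d * e * f * S^2 * Q)],
    [R / (f * S * T), b * h * R / (f * T^2 * P), b * R^2 / (c * d * e * f * T^2 * P), 0]]"

definition W4 :: "'a list list" where
  "W4 = [[a * S * T * P * Q / (2 * R^2), d * S * T * P * Q / (2 * R^2), b * d * h * S^2 * Q / (2 * R^2), a * b * h * S^2 * Q / (2 * R^2)],
    [e * S * T * P * Q / (2 * R^2), 0, c * d * e * f * S^2 * Q / (a * R^2), b * e * h * S^2 * Q / (2 * R^2)],
    [a * f * g * T^2 * P / (2 * R^2), c * d * e * f * T^2 * P / (b * R^2), 0, f * S * T * P * Q / (2 * R^2)],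
    [a * b * g * T^2 * P / (2 * R^2), a * c * g * T^2 * P / (2 * R^2), c * S * T * P * Q / (2 * R^2), b * S * T * P * Q / (2 * R^2)]]"

definition W5 :: "'a list list" where
  "W5 = [[2 * a * R^2 / (d * e * S * T * P * Q), 2 * a * R^2 / (d * e * S^2 * Q^2), 2 * R^2 / (e * S^2 * Q^2), 2 * R^2 / (e * S * T * P * Q)],
    [2 * b * R^2 / (c * f * T^2 * P^2), 2 * b * R^2 / (c * f * S * T * P * Q), 2 * R^2 / (f * S * T * P * Q), 2 * R^2 / (f * T^2 * P^2)],
    [2 * R^2 / (c * T^2 * P^2), 2 * R^2 / (c * S * T * P * Q), 0, 2^2 * d * e * R^2 / (a * b * g * T^2 * P^2)],
    [2 * R^2 / (d * S * T * P * Q), 2 * R^2 / (d * S^2 * Q^2), 2^2 * c * f * R^2 / (a * b * h * S^2 * Q^2), 0]]"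

definition W6 :: "'a list list" where
  "W6 = [[c * f * S * T * P * Q / (2^2 * b * R^2), f * S * T * P * Q / (2^2 * R^2), f * T^2 * P^2 / (2^2 * R^2), c * f * T^2 * P^2 / (2^2 * b * R^2)],
    [c * S * T * P * Q / (2^2 * R^2), 0, a * b * g * T^2 * P^2 / (2^2 * d * e * R^2), c * T^2 * P^2 / (2^2 * R^2)],
    [d * S^2 * Q^2 / (2^2 * R^2), a * b * h * S^2 * Q^2 / (2^2 * c * f * R^2), 0, d * S * T * P * Q / (2^2 * R^2)],
    [d * e * S^2 * Q^2 / (2^2 * a * R^2), e * S^2 * Q^2 / (2^2 * R^2), e * S * T * P * Q / (2^2 * R^2), d * e * S * T * P * Q / (2^2 * a * R^2)]]"

definition W7 :: "'a list list" where
  "W7 = [[2^2 * R^2 / (b * S * T * P * Q), 2^2 * d * e * R^2 / (b * S * T^2 * P^2), 2^2 * d * e * R^2 / (c * S * T^2 * P^2), 2^2 * R^2 / (c * S * T * P * Q)],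
    [2^2 * c * f * R^2 / (a * S^2 * T * Q^2), 2^2 * R^2 / (a * S * T * P * Q), 2^2 * R^2 / (d * S * T * P * Q), 2^2 * c * f * R^2 / (d * S^2 * T * Q^2)],
    [2^2 * c * f * R^2 / (e * S^2 * T * Q^2), 2^2 * R^2 / (e * S * T * P * Q), 0, 2^2 * a * b * h * R^2 / (d * e * S^2 * T * Q^2)],
    [2^2 * R^2 / (f * S * T * P * Q), 2^2 * d * e * R^2 / (f * S * T^2 * P^2), 2^2 * a * b * g * R^2 / (c * f * S * T^2 * P^2), 0]]"

definition W8 :: "'a list list" where
  "W8 = [[a * S^2 * T^2 * P * Q / (2^2 * R^3), d * S^2 * T^2 * P * Q / (2^2 * R^3), d^2 * e * S^2 * T * Q^2 / (2^2 * R^3), a * d * e * S^2 * T * Q^2 / (2^2 * R^3)],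
    [e * S^2 * T^2 * P * Q / (2^2 * R^3), 0, d * e * S^2 * T * Q^2 / (2^2 * a * b * h * R^2), d * e^2 * S^2 * T * Q^2 / (2^2 * R^3)],
    [c * f^2 * S * T^2 * P^2 / (2^2 * R^3), c * f * S * T^2 * P^2 / (2^2 * a * b * g * R^2), 0, f * S^2 * T^2 * P * Q / (2^2 * R^3)],
    [b * c * f * S * T^2 * P^2 / (2^2 * R^3), c^2 * f * S * T^2 * P^2 / (2^2 * R^3), c * S^2 * T^2 * P * Q / (2^2 * R^3), b * S^2 * T^2 * P * Q / (2^2 * R^3)]]"

definition W9 :: "'a list list" where
  "W9 = [[2^2 * a * R^3 / (d * e * S^2 * T^2 * P * Q), 2^2 * a * b * h * R^3 / (d * e * S^2 * T^2 * P * Q^2), 2^2 * b * h * R^3 / (e * S^2 * T^2 * P * Q^2), 2^2 * R^3 / (e * S^2 * T^2 * P * Q)],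
    [2^2 * a * b * g * R^3 / (c * f * S^2 * T^2 * P^2 * Q), 2^2 * b * R^3 / (c * f * S^2 * T^2 * P * Q), 2^2 * R^3 / (f * S^2 * T^2 * P * Q), 2^2 * a * g * R^3 / (f * S^2 * T^2 * P^2 * Q)],
    [2^2 * a * g * R^3 / (c * S^2 * T^2 * P^2 * Q), 2^2 * R^3 / (c * S^2 * T^2 * P * Q), 0, 2^2 * R^4 / (b * c * f * S^2 * T^2 * P^2 * Q)],
    [2^2 * R^3 / (d * S^2 * T^2 * P * Q), 2^2 * b * h * R^3 / (d * S^2 * T^2 * P * Q^2), 2^2 * R^4 / (a * d * e * S^2 * T^2 * P * Q^2), 0]]"

definition W10 :: "'a list list" where
  "W10 = [[c * f * S^2 * T^2 * P^2 * Q^2 / (2^3 * b * R^4), f * S^2 * T^2 * P^2 * Q^2 / (2^3 * R^4), b * f * h * S^2 * T^2 * P^2 * Q / (2^3 * R^4), c * f * h * S^2 * T^2 * P^2 * Q / (2^3 * R^4)],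
    [c * S^2 * T^2 * P^2 * Q^2 / (2^3 * R^4), 0, b * c * f * S^2 * T^2 * P^2 * Q / (2^2 * R^4), b * c * h * S^2 * T^2 * P^2 * Q / (2^3 * R^4)],
    [a * d * g * S^2 * T^2 * P * Q^2 / (2^3 * R^4), a * d * e * S^2 * T^2 * P * Q^2 / (2^2 * R^4), 0, d * S^2 * T^2 * P^2 * Q^2 / (2^3 * R^4)],
    [d * e * g * S^2 * T^2 * P * Q^2 / (2^3 * R^4), a * e * g * S^2 * T^2 * P * Q^2 / (2^3 * R^4), e * S^2 * T^2 * P^2 * Q^2 / (2^3 * R^4), d * e * S^2 * T^2 * P^2 * Q^2 / (2^3 * a * R^4)]]"

definition W11 :: "'a list list" where
  "W11 = [[2^3 * R^4 / (b * S^2 * T^2 * P^2 * Q^2), 2^3 * R^4 / (b * S^2 * T^2 * P^2 * Q^2), 2^3 * R^4 / (c * S^2 * T^2 * P^2 * Q^2), 2^3 * R^4 / (c * S^2 * T^2 * P^2 * Q^2)],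
    [2^3 * R^4 / (a * S^2 * T^2 * P^2 * Q^2), 2^3 * R^4 / (a * S^2 * T^2 * P^2 * Q^2), 2^3 * R^4 / (d * S^2 * T^2 * P^2 * Q^2), 2^3 * R^4 / (d * S^2 * T^2 * P^2 * Q^2)],
    [2^3 * R^4 / (e * S^2 * T^2 * P^2 * Q^2), 2^3 * R^4 / (e * S^2 * T^2 * P^2 * Q^2), 0, 2^4 * R^4 / (g * S^2 * T^2 * P^2 * Q^2)],
    [2^3 * R^4 / (f * S^2 * T^2 * P^2 * Q^2), 2^3 * R^4 / (f * S^2 * T^2 * P^2 * Q^2), 2^4 * R^4 / (h * S^2 * T^2 * P^2 * Q^2), 0]]"

definition W12 :: "'a list list" where
  "W12 = [[a * S^2 * T^2 * P^2 * Q^2 / (2^4 * R^4), d * S^2 * T^2 * P^2 * Q^2 / (2^4 * R^4), d * S^2 * T^2 * P^2 * Q^2 / (2^4 * R^4), a * S^2 * T^2 * P^2 * Q^2 / (2^4 * R^4)],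
    [e * S^2 * T^2 * P^2 * Q^2 / (2^4 * R^4), 0, g * S^2 * T^2 * P^2 * Q^2 / (2^4 * R^4), e * S^2 * T^2 * P^2 * Q^2 / (2^4 * R^4)],
    [f * S^2 * T^2 * P^2 * Q^2 / (2^4 * R^4), h * S^2 * T^2 * P^2 * Q^2 / (2^4 * R^4), 0, f * S^2 * T^2 * P^2 * Q^2 / (2^4 * R^4)],
    [b * S^2 * T^2 * P^2 * Q^2 / (2^4 * R^4), c * S^2 * T^2 * P^2 * Q^2 / (2^4 * R^4), c * S^2 * T^2 * P^2 * Q^2 / (2^4 * R^4), b * S^2 * T^2 * P^2 * Q^2 / (2^4 * R^4)]]"

section \<open>The twelve reductions\<close>

lemma step0:
  "diamond_gf (Suc n) W0 = mono [0,0,0,0,1,1,0,0,0,0,0,0,0,0] ^ (n div 2 + 1)\<^sup>2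
     * (mono [0,0,0,0,0,0,0,0,0,0,1,0,0,0] * mono [0,0,0,0,0,0,0,0,0,0,0,1,0,0]) ^ ((n div 2 + 1) * ((n + 1) div 2))
     * mono [0,0,0,1,0,0,1,0,0,0,0,0,0,0] ^ ((n + 1) div 2)\<^sup>2 * diamond_gf n W1"
proof (rule reduction_step[OF W0_def])
  \<comment> \<open>In every even-numbered matrix the upper left and the lower right block contain
    one zero each, so their factors are single products, and only the two mixed blocks need a
    relation.\<close>
  show "a * 0 + d * e = mono [0,0,0,0,1,1,0,0,0,0,0,0,0,0]"
    by (simp add: laurent)
  show "d * e + a * g = mono [0,0,0,0,0,0,0,0,0,0,1,0,0,0]"
    by (rule add_common_factor[where k = "1" and p = "d * e" and q = "a * g" and r = "S"])
      (rule relations, simp_all add: laurent)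
  show "f * c + h * b = mono [0,0,0,0,0,0,0,0,0,0,0,1,0,0]"
    by (rule add_common_factor[where k = "1" and p = "c * f" and q = "b * h" and r = "T"])
      (rule relations, simp_all add: laurent)
  show "0 * b + f * c = mono [0,0,0,1,0,0,1,0,0,0,0,0,0,0]"
    by (simp add: laurent)
qed (unfold W1_def, (rule mono_nonzero | simp add: laurent)+)

text \<open>In every odd-numbered matrix both zeros lie on the diagonal of the lower right block;
  the other three blocks share one relation, up to the order of the summands.\<close>

lemma step1:
  "diamond_gf (Suc n) W1 = mono [0,1,1,-1,-1,-1,-1,0,0,1,-1,-1,0,0] ^ (n div 2 + 1)\<^sup>2
     * (mono [0,0,0,0,0,-1,-1,0,0,1,-1,-1,0,0] * mono [0,0,0,-1,-1,0,0,0,0,1,-1,-1,0,0]) ^ ((n div 2 + 1) * ((n + 1) div 2))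
     * mono [0,0,0,0,0,0,0,1,1,0,-1,-1,0,0] ^ ((n + 1) div 2)\<^sup>2 * diamond_gf n W2"
proof (rule reduction_step[OF W1_def])
  show "(a / (d * e)) * (b / (c * f)) + (a / S) * (b / T) = mono [0,1,1,-1,-1,-1,-1,0,0,1,-1,-1,0,0]"
    by (rule add_common_factor[where k = "a * b / (c * d * e * f * S * T)" and p = "S * T" and q = "c * d * e * f" and r = "R"])
      (rule relations, simp_all add: laurent)
  show "(d / S) * (c / T) + (1 / e) * (1 / f) = mono [0,0,0,0,0,-1,-1,0,0,1,-1,-1,0,0]"
    by (rule add_common_factor[where k = "1 / (e * f * S * T)" and p = "c * d * e * f" and q = "S * T" and r = "R"])
      (rule relations, simp_all add: laurent)
  show "(f / T) * (e / S) + (1 / c) * (1 / d) = mono [0,0,0,-1,-1,0,0,0,0,1,-1,-1,0,0]"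
    by (rule add_common_factor[where k = "1 / (c * d * S * T)" and p = "c * d * e * f" and q = "S * T" and r = "R"])
      (rule relations, simp_all add: laurent)
  show "0 * 0 + (h / T) * (g / S) = mono [0,0,0,0,0,0,0,1,1,0,-1,-1,0,0]"
    by (simp add: laurent)
qed (unfold W2_def, (rule mono_nonzero | simp add: laurent)+)

text \<open>\<open>P\<close> and \<open>Q\<close> originate here: adding
  \<open>b * d * e * h\<close> to \<open>R\<close> doubles that term, and the result splits as
  \<open>(b * h + c * f) * (a * g + 2 * d * e)\<close>; likewise for
  \<open>a * c * f * g\<close>.\<close>

lemma step2:
  "diamond_gf (Suc n) W2 = mono [0,0,0,1,0,0,1,0,0,-2,2,2,0,0] ^ (n div 2 + 1)\<^sup>2
     * (mono [0,0,-1,1,1,1,1,0,-1,-2,0,3,1,0] * mono [0,-1,0,1,1,1,1,-1,0,-2,3,0,0,1]) ^ ((n div 2 + 1) * ((n + 1) div 2))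
     * mono [0,0,0,0,1,1,0,0,0,-2,2,2,0,0] ^ ((n + 1) div 2)\<^sup>2 * diamond_gf n W3"
proof (rule reduction_step[OF W2_def])
  show "(c * f * S * T / (b * R)) * 0 + (f * S * T / R) * (c * S * T / R) = mono [0,0,0,1,0,0,1,0,0,-2,2,2,0,0]"
    by (simp add: laurent)
  show "(d * e * f * T / R) * (c * d * e * T / R) + (c * d * e * f * T / (b * R)) * (T / h) = mono [0,0,-1,1,1,1,1,0,-1,-2,0,3,1,0]"
    by (rule add_common_factor[where k = "c * d * e * f * T^2 / (b * h * R^2)" and p = "b * d * e * h" and q = "R" and r = "T * P"])
      (rule relations, simp_all add: laurent)
  show "(c * d * f * S / R) * (c * e * f * S / R) + (S / g) * (c * d * e * f * S / (a * R)) = mono [0,-1,0,1,1,1,1,-1,0,-2,3,0,0,1]"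
    by (rule add_common_factor[where k = "c * d * e * f * S^2 / (a * g * R^2)" and p = "a * c * f * g" and q = "R" and r = "S * Q"])
      (rule relations, simp_all add: laurent)
  show "0 * (d * e * S * T / (a * R)) + (d * S * T / R) * (e * S * T / R) = mono [0,0,0,0,1,1,0,0,0,-2,2,2,0,0]"
    by (simp add: laurent)
qed (unfold W3_def, (rule mono_nonzero | simp add: laurent)+)

lemma step3:
  "diamond_gf (Suc n) W3 = mono [1,-1,-1,0,0,0,0,0,0,3,-2,-2,-1,-1] ^ (n div 2 + 1)\<^sup>2
     * (mono [1,0,0,-1,-1,0,0,0,0,3,-2,-2,-1,-1] * mono [1,0,0,0,0,-1,-1,0,0,3,-2,-2,-1,-1]) ^ ((n div 2 + 1) * ((n + 1) div 2))
     * mono [0,1,1,-2,-2,-2,-2,0,0,4,-2,-2,-1,-1] ^ ((n + 1) div 2)\<^sup>2 * diamond_gf n W4"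
proof (rule reduction_step[OF W3_def])
  show "(R / (b * S * T)) * (R / (a * S * T)) + (h * R / (T^2 * P)) * (g * R / (S^2 * Q)) = mono [1,-1,-1,0,0,0,0,0,0,3,-2,-2,-1,-1]"
    by (rule add_common_factor[where k = "R^2 / (a * b * S^2 * T^2 * P * Q)" and p = "P * Q" and q = "a * b * g * h" and r = "2 * R"])
      (rule relations, simp_all add: laurent)
  show "(b * h * R / (c * T^2 * P)) * (a * g * R / (d * S^2 * Q)) + (R / (c * S * T)) * (R / (d * S * T)) = mono [1,0,0,-1,-1,0,0,0,0,3,-2,-2,-1,-1]"
    by (rule add_common_factor[where k = "R^2 / (c * d * S^2 * T^2 * P * Q)" and p = "a * b * g * h" and q = "P * Q" and r = "2 * R"])
      (rule relations, simp_all add: laurent)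
  show "(a * g * R / (e * S^2 * Q)) * (b * h * R / (f * T^2 * P)) + (R / (e * S * T)) * (R / (f * S * T)) = mono [1,0,0,0,0,-1,-1,0,0,3,-2,-2,-1,-1]"
    by (rule add_common_factor[where k = "R^2 / (e * f * S^2 * T^2 * P * Q)" and p = "a * b * g * h" and q = "P * Q" and r = "2 * R"])
      (rule relations, simp_all add: laurent)
  show "0 * 0 + (a * R^2 / (c * d * e * f * S^2 * Q)) * (b * R^2 / (c * d * e * f * T^2 * P)) = mono [0,1,1,-2,-2,-2,-2,0,0,4,-2,-2,-1,-1]"
    by (simp add: laurent)
qed (unfold W4_def, (rule mono_nonzero | simp add: laurent)+)

lemma step4:
  "diamond_gf (Suc n) W4 = mono [-2,0,0,0,1,1,0,0,0,-4,2,2,2,2] ^ (n div 2 + 1)\<^sup>2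
     * (mono [-2,0,1,0,1,1,0,0,1,-4,4,0,0,3] * mono [-2,1,0,1,0,0,1,1,0,-4,0,4,3,0]) ^ ((n div 2 + 1) * ((n + 1) div 2))
     * mono [-2,0,0,1,0,0,1,0,0,-4,2,2,2,2] ^ ((n + 1) div 2)\<^sup>2 * diamond_gf n W5"
proof (rule reduction_step[OF W4_def])
  show "(a * S * T * P * Q / (2 * R^2)) * 0 + (d * S * T * P * Q / (2 * R^2)) * (e * S * T * P * Q / (2 * R^2)) = mono [-2,0,0,0,1,1,0,0,0,-4,2,2,2,2]"
    by (simp add: laurent)
  show "(b * d * h * S^2 * Q / (2 * R^2)) * (b * e * h * S^2 * Q / (2 * R^2)) + (a * b * h * S^2 * Q / (2 * R^2)) * (c * d * e * f * S^2 * Q / (a * R^2)) = mono [-2,0,1,0,1,1,0,0,1,-4,4,0,0,3]"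
    by (rule add_common_factor[where k = "b * d * e * h * S^4 * Q^2 / (2^2 * R^4)" and p = "b * h" and q = "2 * c * f" and r = "Q"])
      (rule relations, simp_all add: laurent)
  show "(a * f * g * T^2 * P / (2 * R^2)) * (a * c * g * T^2 * P / (2 * R^2)) + (c * d * e * f * T^2 * P / (b * R^2)) * (a * b * g * T^2 * P / (2 * R^2)) = mono [-2,1,0,1,0,0,1,1,0,-4,0,4,3,0]"
    by (rule add_common_factor[where k = "a * c * f * g * T^4 * P^2 / (2^2 * R^4)" and p = "a * g" and q = "2 * d * e" and r = "P"])
      (rule relations, simp_all add: laurent)
  show "0 * (b * S * T * P * Q / (2 * R^2)) + (f * S * T * P * Q / (2 * R^2)) * (c * S * T * P * Q / (2 * R^2)) = mono [-2,0,0,1,0,0,1,0,0,-4,2,2,2,2]"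
    by (simp add: laurent)
qed (unfold W5_def, (rule mono_nonzero | simp add: laurent)+)

lemma step5:
  "diamond_gf (Suc n) W5 = mono [3,1,1,-1,-1,-1,-1,0,0,4,-2,-2,-2,-2] ^ (n div 2 + 1)\<^sup>2
     * (mono [3,0,0,0,0,-1,-1,0,0,4,-2,-2,-2,-2] * mono [3,0,0,-1,-1,0,0,0,0,4,-2,-2,-2,-2]) ^ ((n div 2 + 1) * ((n + 1) div 2))
     * mono [4,-2,-2,1,1,1,1,-1,-1,4,-2,-2,-2,-2] ^ ((n + 1) div 2)\<^sup>2 * diamond_gf n W6"
proof (rule reduction_step[OF W5_def])
  show "(2 * a * R^2 / (d * e * S * T * P * Q)) * (2 * b * R^2 / (c * f * S * T * P * Q)) + (2 * a * R^2 / (d * e * S^2 * Q^2)) * (2 * b * R^2 / (c * f * T^2 * P^2)) = mono [3,1,1,-1,-1,-1,-1,0,0,4,-2,-2,-2,-2]"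
    by (rule add_common_factor[where k = "2^2 * a * b * R^4 / (c * d * e * f * S^2 * T^2 * P^2 * Q^2)" and p = "1" and q = "1" and r = "2"])
      (rule one_add_one, simp_all add: laurent)
  show "(2 * R^2 / (e * S^2 * Q^2)) * (2 * R^2 / (f * T^2 * P^2)) + (2 * R^2 / (e * S * T * P * Q)) * (2 * R^2 / (f * S * T * P * Q)) = mono [3,0,0,0,0,-1,-1,0,0,4,-2,-2,-2,-2]"
    by (rule add_common_factor[where k = "2^2 * R^4 / (e * f * S^2 * T^2 * P^2 * Q^2)" and p = "1" and q = "1" and r = "2"])
      (rule one_add_one, simp_all add: laurent)
  show "(2 * R^2 / (c * T^2 * P^2)) * (2 * R^2 / (d * S^2 * Q^2)) + (2 * R^2 / (c * S * T * P * Q)) * (2 * R^2 / (d * S * T * P * Q)) = mono [3,0,0,-1,-1,0,0,0,0,4,-2,-2,-2,-2]"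
    by (rule add_common_factor[where k = "2^2 * R^4 / (c * d * S^2 * T^2 * P^2 * Q^2)" and p = "1" and q = "1" and r = "2"])
      (rule one_add_one, simp_all add: laurent)
  show "0 * 0 + (2^2 * d * e * R^2 / (a * b * g * T^2 * P^2)) * (2^2 * c * f * R^2 / (a * b * h * S^2 * Q^2)) = mono [4,-2,-2,1,1,1,1,-1,-1,4,-2,-2,-2,-2]"
    by (simp add: laurent)
qed (unfold W6_def, (rule mono_nonzero | simp add: laurent)+)

text \<open>From here on the relations of the first six reductions recur in the same order, although
  the entries of \<open>W6\<close> differ from those of \<open>W0\<close> by varying monomials.
  Accordingly the rows of \<open>two_step_exponents\<close> repeat after three.\<close>

lemma step6:
  "diamond_gf (Suc n) W6 = mono [-4,0,0,1,0,0,1,0,0,-4,2,2,2,2] ^ (n div 2 + 1)\<^sup>2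
     * (mono [-4,0,0,1,-1,-1,1,0,0,-4,1,4,4,0] * mono [-4,0,0,-1,1,1,-1,0,0,-4,4,1,0,4]) ^ ((n div 2 + 1) * ((n + 1) div 2))
     * mono [-4,0,0,0,1,1,0,0,0,-4,2,2,2,2] ^ ((n + 1) div 2)\<^sup>2 * diamond_gf n W7"
proof (rule reduction_step[OF W6_def])
  show "(c * f * S * T * P * Q / (2^2 * b * R^2)) * 0 + (f * S * T * P * Q / (2^2 * R^2)) * (c * S * T * P * Q / (2^2 * R^2)) = mono [-4,0,0,1,0,0,1,0,0,-4,2,2,2,2]"
    by (simp add: laurent)
  show "(f * T^2 * P^2 / (2^2 * R^2)) * (c * T^2 * P^2 / (2^2 * R^2)) + (c * f * T^2 * P^2 / (2^2 * b * R^2)) * (a * b * g * T^2 * P^2 / (2^2 * d * e * R^2)) = mono [-4,0,0,1,-1,-1,1,0,0,-4,1,4,4,0]"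
    by (rule add_common_factor[where k = "c * f * T^4 * P^4 / (2^4 * d * e * R^4)" and p = "d * e" and q = "a * g" and r = "S"])
      (rule relations, simp_all add: laurent)
  show "(d * S^2 * Q^2 / (2^2 * R^2)) * (e * S^2 * Q^2 / (2^2 * R^2)) + (a * b * h * S^2 * Q^2 / (2^2 * c * f * R^2)) * (d * e * S^2 * Q^2 / (2^2 * a * R^2)) = mono [-4,0,0,-1,1,1,-1,0,0,-4,4,1,0,4]"
    by (rule add_common_factor[where k = "d * e * S^4 * Q^4 / (2^4 * c * f * R^4)" and p = "c * f" and q = "b * h" and r = "T"])
      (rule relations, simp_all add: laurent)
  show "0 * (d * e * S * T * P * Q / (2^2 * a * R^2)) + (d * S * T * P * Q / (2^2 * R^2)) * (e * S * T * P * Q / (2^2 * R^2)) = mono [-4,0,0,0,1,1,0,0,0,-4,2,2,2,2]"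
    by (simp add: laurent)
qed (unfold W7_def, (rule mono_nonzero | simp add: laurent)+)

lemma step7:
  "diamond_gf (Suc n) W7 = mono [4,-1,-1,0,0,0,0,0,0,5,-3,-3,-2,-2] ^ (n div 2 + 1)\<^sup>2
     * (mono [4,0,0,-1,-1,0,0,0,0,5,-3,-3,-2,-2] * mono [4,0,0,0,0,-1,-1,0,0,5,-3,-3,-2,-2]) ^ ((n div 2 + 1) * ((n + 1) div 2))
     * mono [4,2,2,-1,-1,-1,-1,1,1,4,-3,-3,-2,-2] ^ ((n + 1) div 2)\<^sup>2 * diamond_gf n W8"
proof (rule reduction_step[OF W7_def])
  show "(2^2 * R^2 / (b * S * T * P * Q)) * (2^2 * R^2 / (a * S * T * P * Q)) + (2^2 * d * e * R^2 / (b * S * T^2 * P^2)) * (2^2 * c * f * R^2 / (a * S^2 * T * Q^2)) = mono [4,-1,-1,0,0,0,0,0,0,5,-3,-3,-2,-2]"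
    by (rule add_common_factor[where k = "2^4 * R^4 / (a * b * S^3 * T^3 * P^2 * Q^2)" and p = "S * T" and q = "c * d * e * f" and r = "R"])
      (rule relations, simp_all add: laurent)
  show "(2^2 * d * e * R^2 / (c * S * T^2 * P^2)) * (2^2 * c * f * R^2 / (d * S^2 * T * Q^2)) + (2^2 * R^2 / (c * S * T * P * Q)) * (2^2 * R^2 / (d * S * T * P * Q)) = mono [4,0,0,-1,-1,0,0,0,0,5,-3,-3,-2,-2]"
    by (rule add_common_factor[where k = "2^4 * R^4 / (c * d * S^3 * T^3 * P^2 * Q^2)" and p = "c * d * e * f" and q = "S * T" and r = "R"])
      (rule relations, simp_all add: laurent)
  show "(2^2 * c * f * R^2 / (e * S^2 * T * Q^2)) * (2^2 * d * e * R^2 / (f * S * T^2 * P^2)) + (2^2 * R^2 / (e * S * T * P * Q)) * (2^2 * R^2 / (f * S * T * P * Q)) = mono [4,0,0,0,0,-1,-1,0,0,5,-3,-3,-2,-2]"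
    by (rule add_common_factor[where k = "2^4 * R^4 / (e * f * S^3 * T^3 * P^2 * Q^2)" and p = "c * d * e * f" and q = "S * T" and r = "R"])
      (rule relations, simp_all add: laurent)
  show "0 * 0 + (2^2 * a * b * h * R^2 / (d * e * S^2 * T * Q^2)) * (2^2 * a * b * g * R^2 / (c * f * S * T^2 * P^2)) = mono [4,2,2,-1,-1,-1,-1,1,1,4,-3,-3,-2,-2]"
    by (simp add: laurent)
qed (unfold W8_def, (rule mono_nonzero | simp add: laurent)+)

lemma step8:
  "diamond_gf (Suc n) W8 = mono [-4,0,0,0,1,1,0,0,0,-6,4,4,2,2] ^ (n div 2 + 1)\<^sup>2
     * (mono [-4,0,-1,0,2,2,0,0,-1,-6,4,3,1,4] * mono [-4,-1,0,2,0,0,2,-1,0,-6,3,4,4,1]) ^ ((n div 2 + 1) * ((n + 1) div 2))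
     * mono [-4,0,0,1,0,0,1,0,0,-6,4,4,2,2] ^ ((n + 1) div 2)\<^sup>2 * diamond_gf n W9"
proof (rule reduction_step[OF W8_def])
  show "(a * S^2 * T^2 * P * Q / (2^2 * R^3)) * 0 + (d * S^2 * T^2 * P * Q / (2^2 * R^3)) * (e * S^2 * T^2 * P * Q / (2^2 * R^3)) = mono [-4,0,0,0,1,1,0,0,0,-6,4,4,2,2]"
    by (simp add: laurent)
  show "(d^2 * e * S^2 * T * Q^2 / (2^2 * R^3)) * (d * e^2 * S^2 * T * Q^2 / (2^2 * R^3)) + (a * d * e * S^2 * T * Q^2 / (2^2 * R^3)) * (d * e * S^2 * T * Q^2 / (2^2 * a * b * h * R^2)) = mono [-4,0,-1,0,2,2,0,0,-1,-6,4,3,1,4]"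
    by (rule add_common_factor[where k = "d^2 * e^2 * S^4 * T^2 * Q^4 / (2^4 * b * h * R^6)" and p = "b * d * e * h" and q = "R" and r = "T * P"])
      (rule relations, simp_all add: laurent)
  show "(c * f^2 * S * T^2 * P^2 / (2^2 * R^3)) * (c^2 * f * S * T^2 * P^2 / (2^2 * R^3)) + (c * f * S * T^2 * P^2 / (2^2 * a * b * g * R^2)) * (b * c * f * S * T^2 * P^2 / (2^2 * R^3)) = mono [-4,-1,0,2,0,0,2,-1,0,-6,3,4,4,1]"
    by (rule add_common_factor[where k = "c^2 * f^2 * S^2 * T^4 * P^4 / (2^4 * a * g * R^6)" and p = "a * c * f * g" and q = "R" and r = "S * Q"])
      (rule relations, simp_all add: laurent)
  show "0 * (b * S^2 * T^2 * P * Q / (2^2 * R^3)) + (f * S^2 * T^2 * P * Q / (2^2 * R^3)) * (c * S^2 * T^2 * P * Q / (2^2 * R^3)) = mono [-4,0,0,1,0,0,1,0,0,-6,4,4,2,2]"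
    by (simp add: laurent)
qed (unfold W9_def, (rule mono_nonzero | simp add: laurent)+)

lemma step9:
  "diamond_gf (Suc n) W9 = mono [5,1,1,-1,-1,-1,-1,0,0,7,-4,-4,-3,-3] ^ (n div 2 + 1)\<^sup>2
     * (mono [5,0,0,0,0,-1,-1,0,0,7,-4,-4,-3,-3] * mono [5,0,0,-1,-1,0,0,0,0,7,-4,-4,-3,-3]) ^ ((n div 2 + 1) * ((n + 1) div 2))
     * mono [4,-1,-1,-1,-1,-1,-1,0,0,8,-4,-4,-3,-3] ^ ((n + 1) div 2)\<^sup>2 * diamond_gf n W10"
proof (rule reduction_step[OF W9_def])
  show "(2^2 * a * R^3 / (d * e * S^2 * T^2 * P * Q)) * (2^2 * b * R^3 / (c * f * S^2 * T^2 * P * Q)) + (2^2 * a * b * h * R^3 / (d * e * S^2 * T^2 * P * Q^2)) * (2^2 * a * b * g * R^3 / (c * f * S^2 * T^2 * P^2 * Q)) = mono [5,1,1,-1,-1,-1,-1,0,0,7,-4,-4,-3,-3]"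
    by (rule add_common_factor[where k = "2^4 * a * b * R^6 / (c * d * e * f * S^4 * T^4 * P^3 * Q^3)" and p = "P * Q" and q = "a * b * g * h" and r = "2 * R"])
      (rule relations, simp_all add: laurent)
  show "(2^2 * b * h * R^3 / (e * S^2 * T^2 * P * Q^2)) * (2^2 * a * g * R^3 / (f * S^2 * T^2 * P^2 * Q)) + (2^2 * R^3 / (e * S^2 * T^2 * P * Q)) * (2^2 * R^3 / (f * S^2 * T^2 * P * Q)) = mono [5,0,0,0,0,-1,-1,0,0,7,-4,-4,-3,-3]"
    by (rule add_common_factor[where k = "2^4 * R^6 / (e * f * S^4 * T^4 * P^3 * Q^3)" and p = "a * b * g * h" and q = "P * Q" and r = "2 * R"])
      (rule relations, simp_all add: laurent)
  show "(2^2 * a * g * R^3 / (c * S^2 * T^2 * P^2 * Q)) * (2^2 * b * h * R^3 / (d * S^2 * T^2 * P * Q^2)) + (2^2 * R^3 / (c * S^2 * T^2 * P * Q)) * (2^2 * R^3 / (d * S^2 * T^2 * P * Q)) = mono [5,0,0,-1,-1,0,0,0,0,7,-4,-4,-3,-3]"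
    by (rule add_common_factor[where k = "2^4 * R^6 / (c * d * S^4 * T^4 * P^3 * Q^3)" and p = "a * b * g * h" and q = "P * Q" and r = "2 * R"])
      (rule relations, simp_all add: laurent)
  show "0 * 0 + (2^2 * R^4 / (b * c * f * S^2 * T^2 * P^2 * Q)) * (2^2 * R^4 / (a * d * e * S^2 * T^2 * P * Q^2)) = mono [4,-1,-1,-1,-1,-1,-1,0,0,8,-4,-4,-3,-3]"
    by (simp add: laurent)
qed (unfold W10_def, (rule mono_nonzero | simp add: laurent)+)

lemma step10:
  "diamond_gf (Suc n) W10 = mono [-6,0,0,1,0,0,1,0,0,-8,4,4,4,4] ^ (n div 2 + 1)\<^sup>2
     * (mono [-6,0,1,1,0,0,1,0,1,-8,4,4,4,3] * mono [-6,1,0,0,1,1,0,1,0,-8,4,4,3,4]) ^ ((n div 2 + 1) * ((n + 1) div 2))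
     * mono [-6,0,0,0,1,1,0,0,0,-8,4,4,4,4] ^ ((n + 1) div 2)\<^sup>2 * diamond_gf n W11"
proof (rule reduction_step[OF W10_def])
  show "(c * f * S^2 * T^2 * P^2 * Q^2 / (2^3 * b * R^4)) * 0 + (f * S^2 * T^2 * P^2 * Q^2 / (2^3 * R^4)) * (c * S^2 * T^2 * P^2 * Q^2 / (2^3 * R^4)) = mono [-6,0,0,1,0,0,1,0,0,-8,4,4,4,4]"
    by (simp add: laurent)
  show "(b * f * h * S^2 * T^2 * P^2 * Q / (2^3 * R^4)) * (b * c * h * S^2 * T^2 * P^2 * Q / (2^3 * R^4)) + (c * f * h * S^2 * T^2 * P^2 * Q / (2^3 * R^4)) * (b * c * f * S^2 * T^2 * P^2 * Q / (2^2 * R^4)) = mono [-6,0,1,1,0,0,1,0,1,-8,4,4,4,3]"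
    by (rule add_common_factor[where k = "b * c * f * h * S^4 * T^4 * P^4 * Q^2 / (2^6 * R^8)" and p = "b * h" and q = "2 * c * f" and r = "Q"])
      (rule relations, simp_all add: laurent)
  show "(a * d * g * S^2 * T^2 * P * Q^2 / (2^3 * R^4)) * (a * e * g * S^2 * T^2 * P * Q^2 / (2^3 * R^4)) + (a * d * e * S^2 * T^2 * P * Q^2 / (2^2 * R^4)) * (d * e * g * S^2 * T^2 * P * Q^2 / (2^3 * R^4)) = mono [-6,1,0,0,1,1,0,1,0,-8,4,4,3,4]"
    by (rule add_common_factor[where k = "a * d * e * g * S^4 * T^4 * P^2 * Q^4 / (2^6 * R^8)" and p = "a * g" and q = "2 * d * e" and r = "P"])
      (rule relations, simp_all add: laurent)
  show "0 * (d * e * S^2 * T^2 * P^2 * Q^2 / (2^3 * a * R^4)) + (d * S^2 * T^2 * P^2 * Q^2 / (2^3 * R^4)) * (e * S^2 * T^2 * P^2 * Q^2 / (2^3 * R^4)) = mono [-6,0,0,0,1,1,0,0,0,-8,4,4,4,4]"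
    by (simp add: laurent)
qed (unfold W11_def, (rule mono_nonzero | simp add: laurent)+)

lemma step11:
  "diamond_gf (Suc n) W11 = mono [7,-1,-1,0,0,0,0,0,0,8,-4,-4,-4,-4] ^ (n div 2 + 1)\<^sup>2
     * (mono [7,0,0,-1,-1,0,0,0,0,8,-4,-4,-4,-4] * mono [7,0,0,0,0,-1,-1,0,0,8,-4,-4,-4,-4]) ^ ((n div 2 + 1) * ((n + 1) div 2))
     * mono [8,0,0,0,0,0,0,-1,-1,8,-4,-4,-4,-4] ^ ((n + 1) div 2)\<^sup>2 * diamond_gf n W12"
proof (rule reduction_step[OF W11_def])
  show "(2^3 * R^4 / (b * S^2 * T^2 * P^2 * Q^2)) * (2^3 * R^4 / (a * S^2 * T^2 * P^2 * Q^2)) + (2^3 * R^4 / (b * S^2 * T^2 * P^2 * Q^2)) * (2^3 * R^4 / (a * S^2 * T^2 * P^2 * Q^2)) = mono [7,-1,-1,0,0,0,0,0,0,8,-4,-4,-4,-4]"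
    by (rule add_common_factor[where k = "2^6 * R^8 / (a * b * S^4 * T^4 * P^4 * Q^4)" and p = "1" and q = "1" and r = "2"])
      (rule one_add_one, simp_all add: laurent)
  show "(2^3 * R^4 / (c * S^2 * T^2 * P^2 * Q^2)) * (2^3 * R^4 / (d * S^2 * T^2 * P^2 * Q^2)) + (2^3 * R^4 / (c * S^2 * T^2 * P^2 * Q^2)) * (2^3 * R^4 / (d * S^2 * T^2 * P^2 * Q^2)) = mono [7,0,0,-1,-1,0,0,0,0,8,-4,-4,-4,-4]"
    by (rule add_common_factor[where k = "2^6 * R^8 / (c * d * S^4 * T^4 * P^4 * Q^4)" and p = "1" and q = "1" and r = "2"])
      (rule one_add_one, simp_all add: laurent)
  show "(2^3 * R^4 / (e * S^2 * T^2 * P^2 * Q^2)) * (2^3 * R^4 / (f * S^2 * T^2 * P^2 * Q^2)) + (2^3 * R^4 / (e * S^2 * T^2 * P^2 * Q^2)) * (2^3 * R^4 / (f * S^2 * T^2 * P^2 * Q^2)) = mono [7,0,0,0,0,-1,-1,0,0,8,-4,-4,-4,-4]"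
    by (rule add_common_factor[where k = "2^6 * R^8 / (e * f * S^4 * T^4 * P^4 * Q^4)" and p = "1" and q = "1" and r = "2"])
      (rule one_add_one, simp_all add: laurent)
  show "0 * 0 + (2^4 * R^4 / (g * S^2 * T^2 * P^2 * Q^2)) * (2^4 * R^4 / (h * S^2 * T^2 * P^2 * Q^2)) = mono [8,0,0,0,0,0,0,-1,-1,8,-4,-4,-4,-4]"
    by (simp add: laurent)
qed (unfold W12_def, (rule mono_nonzero | simp add: laurent)+)

section \<open>Pairs of reductions\<close>

definition even_weights :: "'a list list list" where
  "even_weights = [W0, W2, W4, W6, W8, W10, W12]"

lemma even_step0:
  "diamond_gf (2 * Suc m) W0 = mono [0,1,1,-1,-1,-1,-1,1,1,3,-3,-3,0,0] ^ m\<^sup>2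
     * mono [0,2,2,-1,-1,-1,-1,0,0,4,-2,-2,0,0] ^ m * mono [0,1,1,0,0,0,0,0,0,1,0,0,0,0]
     * diamond_gf (2 * m) W2"
  by (rule two_steps_even[OF step0 step1]) (simp_all add: laurent)

lemma even_step1:
  "diamond_gf (2 * Suc m) W2 = mono [3,-1,-1,0,0,0,0,-1,-1,5,-1,-1,-3,-3] ^ m\<^sup>2
     * mono [4,-4,-4,5,5,5,5,-2,-2,-4,6,6,-2,-2] ^ m * mono [1,-2,-2,3,3,3,3,-1,-1,-5,5,5,0,0]
     * diamond_gf (2 * m) W4"
  by (rule two_steps_even[OF step2 step3]) (simp_all add: laurent)

lemma even_step2:
  "diamond_gf (2 * Suc m) W4 = mono [5,0,0,1,1,1,1,0,0,0,0,0,-1,-1] ^ m\<^sup>2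
     * mono [-4,4,4,1,1,1,1,2,2,-16,8,8,6,6] ^ m * mono [-5,2,2,1,1,1,1,1,1,-12,6,6,5,5]
     * diamond_gf (2 * m) W6"
  by (rule two_steps_even[OF step4 step5]) (simp_all add: laurent)

lemma even_step3:
  "diamond_gf (2 * Suc m) W6 = mono [0,1,1,-1,-1,-1,-1,1,1,3,-3,-3,0,0] ^ m\<^sup>2
     * mono [-16,-2,-2,1,1,1,1,0,0,-12,6,6,8,8] ^ m * mono [-12,-1,-1,1,1,1,1,0,0,-11,6,6,6,6]
     * diamond_gf (2 * m) W8"
  by (rule two_steps_even[OF step6 step7]) (simp_all add: laurent)

lemma even_step4:
  "diamond_gf (2 * Suc m) W8 = mono [3,-1,-1,0,0,0,0,-1,-1,5,-1,-1,-3,-3] ^ m\<^sup>2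
     * mono [-12,0,0,3,3,3,3,-2,-2,-20,14,14,6,6] ^ m * mono [-11,0,0,2,2,2,2,-1,-1,-17,11,11,6,6]
     * diamond_gf (2 * m) W10"
  by (rule two_steps_even[OF step8 step9]) (simp_all add: laurent)

lemma even_step5:
  "diamond_gf (2 * Suc m) W10 = mono [5,0,0,1,1,1,1,0,0,0,0,0,-1,-1] ^ m\<^sup>2
     * mono [-20,0,0,3,3,3,3,2,2,-32,16,16,14,14] ^ m * mono [-17,0,0,2,2,2,2,1,1,-24,12,12,11,11]
     * diamond_gf (2 * m) W12"
  by (rule two_steps_even[OF step10 step11]) (simp_all add: laurent)

lemma even_steps:
  assumes "t < 6"
  shows "diamond_gf (2 * Suc m) (even_weights ! t) = mono (two_step_exponents ! t) ^ m\<^sup>2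
    * mono (even_linear_exponents ! t) ^ m * mono (even_constant_exponents ! t)
    * diamond_gf (2 * m) (even_weights ! Suc t)"
proof -
  consider "t = 0" | "t = 1" | "t = 2" | "t = 3" | "t = 4" | "t = 5"
    using assms by linarith
  then show ?thesis
    using even_step0[of m] even_step1[of m] even_step2[of m] even_step3[of m] even_step4[of m] even_step5[of m]
    by cases (simp_all add: even_weights_def two_step_exponents_def even_linear_exponents_def
      even_constant_exponents_def)
qed

lemma odd_step0:
  "diamond_gf (2 * Suc m + 1) W0 = mono [0,1,1,-1,-1,-1,-1,1,1,3,-3,-3,0,0] ^ m\<^sup>2
     * mono [0,2,2,-2,0,0,-2,2,2,6,-5,-5,0,0] ^ m * mono [0,1,1,-1,2,2,-1,1,1,3,-2,-2,0,0]
     * diamond_gf (2 * m + 1) W2"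
  by (rule two_steps_odd[OF step0 step1]) (simp_all add: laurent)

lemma odd_step1:
  "diamond_gf (2 * Suc m + 1) W2 = mono [3,-1,-1,0,0,0,0,-1,-1,5,-1,-1,-3,-3] ^ m\<^sup>2
     * mono [6,-3,-3,4,2,2,4,-3,-3,2,5,5,-5,-5] ^ m * mono [3,-2,-2,5,2,2,5,-2,-2,-5,8,8,-2,-2]
     * diamond_gf (2 * m + 1) W4"
  by (rule two_steps_odd[OF step2 step3]) (simp_all add: laurent)

lemma odd_step2:
  "diamond_gf (2 * Suc m + 1) W4 = mono [5,0,0,1,1,1,1,0,0,0,0,0,-1,-1] ^ m\<^sup>2
     * mono [2,1,1,3,5,5,3,1,1,-16,8,8,5,5] ^ m * mono [-5,1,1,2,5,5,2,1,1,-20,10,10,8,8]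
     * diamond_gf (2 * m + 1) W6"
  by (rule two_steps_odd[OF step4 step5]) (simp_all add: laurent)

lemma odd_step3:
  "diamond_gf (2 * Suc m + 1) W6 = mono [0,1,1,-1,-1,-1,-1,1,1,3,-3,-3,0,0] ^ m\<^sup>2
     * mono [-16,2,2,0,-2,-2,0,2,2,-10,3,3,8,8] ^ m * mono [-20,1,1,2,-1,-1,2,1,1,-17,8,8,10,10]
     * diamond_gf (2 * m + 1) W8"
  by (rule two_steps_odd[OF step6 step7]) (simp_all add: laurent)

lemma odd_step4:
  "diamond_gf (2 * Suc m + 1) W8 = mono [3,-1,-1,0,0,0,0,-1,-1,5,-1,-1,-3,-3] ^ m\<^sup>2
     * mono [-10,-3,-3,2,4,4,2,-3,-3,-14,13,13,3,3] ^ m * mono [-17,-2,-2,2,5,5,2,-2,-2,-25,18,18,8,8]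
     * diamond_gf (2 * m + 1) W10"
  by (rule two_steps_odd[OF step8 step9]) (simp_all add: laurent)

lemma odd_step5:
  "diamond_gf (2 * Suc m + 1) W10 = mono [5,0,0,1,1,1,1,0,0,0,0,0,-1,-1] ^ m\<^sup>2
     * mono [-14,1,1,5,3,3,5,1,1,-32,16,16,13,13] ^ m * mono [-25,1,1,5,2,2,5,1,1,-40,20,20,18,18]
     * diamond_gf (2 * m + 1) W12"
  by (rule two_steps_odd[OF step10 step11]) (simp_all add: laurent)

lemma odd_steps:
  assumes "t < 6"
  shows "diamond_gf (2 * Suc m + 1) (even_weights ! t) = mono (two_step_exponents ! t) ^ m\<^sup>2
    * mono (odd_linear_exponents ! t) ^ m * mono (odd_constant_exponents ! t)
    * diamond_gf (2 * m + 1) (even_weights ! Suc t)"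
proof -
  consider "t = 0" | "t = 1" | "t = 2" | "t = 3" | "t = 4" | "t = 5"
    using assms by linarith
  then show ?thesis
    using odd_step0[of m] odd_step1[of m] odd_step2[of m] odd_step3[of m] odd_step4[of m] odd_step5[of m]
    by cases (simp_all add: even_weights_def two_step_exponents_def odd_linear_exponents_def
      odd_constant_exponents_def)
qed

text \<open>A diamond of order 1 is one cell: the reduction with \<open>n = 0\<close> leaves the
  factor of the upper left block to the power 1.\<close>

lemma odd_initial:
  "t < 6 \<Longrightarrow> diamond_gf 1 (even_weights ! t) = mono (odd_initial_exponents ! t)"
proof -
  assume "t < 6"
  then consider "t = 0" | "t = 1" | "t = 2" | "t = 3" | "t = 4" | "t = 5"
    by linarith
  then show ?thesis
    using step0[of 0] step2[of 0] step4[of 0] step6[of 0] step8[of 0] step10[of 0]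
    by cases (simp_all add: even_weights_def odd_initial_exponents_def diamond_gf_0)
qed

section \<open>Closing the orbit\<close>

lemma W12_scaled: "W12 = map (map ((*) (mono [-4,0,0,0,0,0,0,0,0,-4,2,2,2,2]))) W0"
  unfolding W12_def W0_def by (simp add: laurent)

lemma diamond_gf_W12: "diamond_gf n W12 = mono [-4,0,0,0,0,0,0,0,0,-4,2,2,2,2] ^ (n * (n + 1)) * diamond_gf n W0"
  unfolding W12_scaled by (rule diamond_gf_scale) (auto simp: W0_def)

lemma lessThan_6: "{..<6::nat} = {0, 1, 2, 3, 4, 5}"
  by auto

text \<open>The scalar of \<open>W12_scaled\<close> enters with the power
  \<open>n * (n + 1)\<close>, whose quadratic part is four times the square of \<open>q\<close> for
  \<open>n = 2 * q\<close> and for \<open>n = 2 * q + 1\<close>; hence its fourth power here. This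
  cancellation is what leaves exponents linear in the order.\<close>

lemma prod_two_step: "(\<Prod>t<6. mono (two_step_exponents ! t)) * mono [-4,0,0,0,0,0,0,0,0,-4,2,2,2,2] ^ 4 = 1"
  by (simp add: lessThan_6 two_step_exponents_def laurent)

text \<open>In the linear and the constant part all powers of \<open>S\<close>, \<open>T\<close>,
  \<open>P\<close>, \<open>Q\<close> cancel. At \<open>q = 0\<close> the first bracket is the value
  at order 12, since order 0 has value 1.\<close>

lemma even_recurrence:
  "diamond_gf (2 * (q + 6)) W0
     = (2^12 * (a*b)^14 * (c*d*e*f)^12 * (g*h)^8 * R^16) * (2^4 * (a*b)^4 * (c*d*e*f)^4 * (g*h)^4 * R^4) ^ q
       * diamond_gf (2 * q) W0"
proof -
  define l where "l = mono [-4,0,0,0,0,0,0,0,0,-4,2,2,2,2]"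
  let ?U = "\<lambda>t. mono (two_step_exponents ! t)"
  let ?V = "\<lambda>t. mono (even_linear_exponents ! t)"
  let ?C = "\<lambda>t. mono (even_constant_exponents ! t)"
  have "diamond_gf (2 * (q + 6)) (even_weights ! 0)
    = (\<Prod>t<6. ?U t) ^ q\<^sup>2 * (\<Prod>t<6. ?U t ^ (2 * (6 - Suc t)) * ?V t) ^ q
      * (\<Prod>t<6. ?U t ^ (6 - Suc t)\<^sup>2 * ?V t ^ (6 - Suc t) * ?C t) * diamond_gf (2 * q) (even_weights ! 6)"
    by (rule iterate_steps_powers[where F = "\<lambda>t m. diamond_gf (2 * m) (even_weights ! t)", OF even_steps])
  moreover have "even_weights ! 0 = W0" "even_weights ! 6 = W12"
    by (simp_all add: even_weights_def)
  moreover have "diamond_gf (2 * q) W12 = (l ^ 4) ^ q\<^sup>2 * (l ^ 2) ^ q * l ^ 0 * diamond_gf (2 * q) W0"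
  proof -
    have "(2 * q) * (2 * q + 1) = 4 * q\<^sup>2 + 2 * q + 0"
      by (simp add: power2_eq_square algebra_simps)
    then show ?thesis unfolding diamond_gf_W12 l_def[symmetric] by (simp only: power_add power_mult)
  qed
  ultimately have combined: "diamond_gf (2 * (q + 6)) W0
    = ((\<Prod>t<6. ?U t) * l ^ 4) ^ q\<^sup>2 * ((\<Prod>t<6. ?U t ^ (2 * (6 - Suc t)) * ?V t) * l ^ 2) ^ q
      * ((\<Prod>t<6. ?U t ^ (6 - Suc t)\<^sup>2 * ?V t ^ (6 - Suc t) * ?C t) * l ^ 0) * diamond_gf (2 * q) W0"
    by (simp only: power_mult_distrib mult_ac)
  have quadratic_part: "(\<Prod>t<6. ?U t) * l ^ 4 = 1"
    unfolding l_def by (rule prod_two_step)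
  have linear_part: "(\<Prod>t<6. ?U t ^ (2 * (6 - Suc t)) * ?V t) * l ^ 2 = 2^4 * (a*b)^4 * (c*d*e*f)^4 * (g*h)^4 * R^4"
    by (simp add: l_def lessThan_6 two_step_exponents_def even_linear_exponents_def laurent)
  have constant_part: "(\<Prod>t<6. ?U t ^ (6 - Suc t)\<^sup>2 * ?V t ^ (6 - Suc t) * ?C t) * l ^ 0
      = 2^12 * (a*b)^14 * (c*d*e*f)^12 * (g*h)^8 * R^16"
    by (simp add: l_def lessThan_6 two_step_exponents_def even_linear_exponents_def even_constant_exponents_def laurent)
  show ?thesis
    unfolding combined quadratic_part linear_part constant_part
    by (simp only: power_one mult_1_left mult_ac)
qed

text \<open>The descent with \<open>q = 0\<close> reaches order 0 before the orbit closes, so the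
  scalar does not enter.\<close>

lemma even_product:
  assumes "k < 6"
  shows "diamond_gf (2 * k) W0
    = (\<Prod>t<k. mono (two_step_exponents ! t) ^ (k - Suc t)\<^sup>2 * mono (even_linear_exponents ! t) ^ (k - Suc t)
        * mono (even_constant_exponents ! t))"
proof -
  have "diamond_gf (2 * (0 + k)) (even_weights ! 0)
    = (\<Prod>t<k. mono (two_step_exponents ! t) ^ (0 + (k - Suc t))\<^sup>2 * mono (even_linear_exponents ! t) ^ (0 + (k - Suc t))
        * mono (even_constant_exponents ! t)) * diamond_gf (2 * 0) (even_weights ! k)"
    by (rule iterate_steps[where F = "\<lambda>t m. diamond_gf (2 * m) (even_weights ! t)" and N = 6, OF even_steps])
      (use assms in simp_all)
  moreover have "even_weights ! 0 = W0"
    by (simp add: even_weights_def)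
  ultimately show ?thesis
    using assms by (simp add: diamond_gf_0)
qed

lemma even_values:
  "diamond_gf 0 W0 = 1"
  "diamond_gf 2 W0 = a*b*R"
  "diamond_gf 4 W0 = 2 * (a*b)^2 * (c*d*e*f) * R^3"
  "diamond_gf 6 W0 = 2^3 * (a*b)^4 * (c*d*e*f)^3 * (g*h) * R^5"
  "diamond_gf 8 W0 = 2^5 * (a*b)^7 * (c*d*e*f)^5 * (g*h)^3 * R^8"
  "diamond_gf 10 W0 = 2^8 * (a*b)^10 * (c*d*e*f)^8 * (g*h)^5 * R^12"
proof -
  have lessThan: "{..<1::nat} = {0}" "{..<2::nat} = {0, 1}" "{..<3::nat} = {0, 1, 2}" "{..<4::nat} = {0, 1, 2, 3}"
    "{..<5::nat} = {0, 1, 2, 3, 4}"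
    by auto
  show "diamond_gf 0 W0 = 1"
    "diamond_gf 2 W0 = a*b*R"
    "diamond_gf 4 W0 = 2 * (a*b)^2 * (c*d*e*f) * R^3"
    "diamond_gf 6 W0 = 2^3 * (a*b)^4 * (c*d*e*f)^3 * (g*h) * R^5"
    "diamond_gf 8 W0 = 2^5 * (a*b)^7 * (c*d*e*f)^5 * (g*h)^3 * R^8"
    "diamond_gf 10 W0 = 2^8 * (a*b)^10 * (c*d*e*f)^8 * (g*h)^5 * R^12"
    using even_product[of 0] even_product[of 1] even_product[of 2] even_product[of 3] even_product[of 4] even_product[of 5]
    by (simp_all add: lessThan two_step_exponents_def even_linear_exponents_def even_constant_exponents_def laurent)
qed

text \<open>Here \<open>n * (n + 1)\<close> with \<open>n = 2 * q + 1\<close> has the linear part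
  \<open>6 * q\<close> and the constant part \<open>2\<close>, so the scalar contributes to all
  three parts.\<close>

lemma odd_recurrence:
  "diamond_gf (2 * (q + 6) + 1) W0
     = (2^12 * (d*e)^18 * (a*b*g*h)^14 * (c*f)^12 * R^16) * (2^4 * (d*e)^4 * (a*b*g*h)^4 * (c*f)^4 * R^4) ^ q
       * diamond_gf (2 * q + 1) W0"
proof -
  define l where "l = mono [-4,0,0,0,0,0,0,0,0,-4,2,2,2,2]"
  let ?U = "\<lambda>t. mono (two_step_exponents ! t)"
  let ?V = "\<lambda>t. mono (odd_linear_exponents ! t)"
  let ?C = "\<lambda>t. mono (odd_constant_exponents ! t)"
  have "diamond_gf (2 * (q + 6) + 1) (even_weights ! 0)
    = (\<Prod>t<6. ?U t) ^ q\<^sup>2 * (\<Prod>t<6. ?U t ^ (2 * (6 - Suc t)) * ?V t) ^ q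
      * (\<Prod>t<6. ?U t ^ (6 - Suc t)\<^sup>2 * ?V t ^ (6 - Suc t) * ?C t) * diamond_gf (2 * q + 1) (even_weights ! 6)"
    by (rule iterate_steps_powers[where F = "\<lambda>t m. diamond_gf (2 * m + 1) (even_weights ! t)", OF odd_steps])
  moreover have "even_weights ! 0 = W0" "even_weights ! 6 = W12"
    by (simp_all add: even_weights_def)
  moreover have "diamond_gf (2 * q + 1) W12 = (l ^ 4) ^ q\<^sup>2 * (l ^ 6) ^ q * l ^ 2 * diamond_gf (2 * q + 1) W0"
  proof -
    have "(2 * q + 1) * (2 * q + 1 + 1) = 4 * q\<^sup>2 + 6 * q + 2"
      by (simp add: power2_eq_square algebra_simps)
    then show ?thesis unfolding diamond_gf_W12 l_def[symmetric] by (simp only: power_add power_mult)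
  qed
  ultimately have combined: "diamond_gf (2 * (q + 6) + 1) W0
    = ((\<Prod>t<6. ?U t) * l ^ 4) ^ q\<^sup>2 * ((\<Prod>t<6. ?U t ^ (2 * (6 - Suc t)) * ?V t) * l ^ 6) ^ q
      * ((\<Prod>t<6. ?U t ^ (6 - Suc t)\<^sup>2 * ?V t ^ (6 - Suc t) * ?C t) * l ^ 2) * diamond_gf (2 * q + 1) W0"
    by (simp only: power_mult_distrib mult_ac)
  have quadratic_part: "(\<Prod>t<6. ?U t) * l ^ 4 = 1"
    unfolding l_def by (rule prod_two_step)
  have linear_part: "(\<Prod>t<6. ?U t ^ (2 * (6 - Suc t)) * ?V t) * l ^ 6 = 2^4 * (d*e)^4 * (a*b*g*h)^4 * (c*f)^4 * R^4"
    by (simp add: l_def lessThan_6 two_step_exponents_def odd_linear_exponents_def laurent)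
  have constant_part: "(\<Prod>t<6. ?U t ^ (6 - Suc t)\<^sup>2 * ?V t ^ (6 - Suc t) * ?C t) * l ^ 2
      = 2^12 * (d*e)^18 * (a*b*g*h)^14 * (c*f)^12 * R^16"
    by (simp add: l_def lessThan_6 two_step_exponents_def odd_linear_exponents_def odd_constant_exponents_def laurent)
  show ?thesis
    unfolding combined quadratic_part linear_part constant_part
    by (simp only: power_one mult_1_left mult_ac)
qed

lemma odd_product:
  assumes "k < 6"
  shows "diamond_gf (2 * k + 1) W0
    = (\<Prod>t<k. mono (two_step_exponents ! t) ^ (k - Suc t)\<^sup>2 * mono (odd_linear_exponents ! t) ^ (k - Suc t)
        * mono (odd_constant_exponents ! t)) * mono (odd_initial_exponents ! k)"
proof -
  have "diamond_gf (2 * (0 + k) + 1) (even_weights ! 0)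
    = (\<Prod>t<k. mono (two_step_exponents ! t) ^ (0 + (k - Suc t))\<^sup>2 * mono (odd_linear_exponents ! t) ^ (0 + (k - Suc t))
        * mono (odd_constant_exponents ! t)) * diamond_gf (2 * 0 + 1) (even_weights ! k)"
    by (rule iterate_steps[where F = "\<lambda>t m. diamond_gf (2 * m + 1) (even_weights ! t)" and N = 6, OF odd_steps])
      (use assms in simp_all)
  moreover have "even_weights ! 0 = W0"
    by (simp add: even_weights_def)
  ultimately show ?thesis
    using assms by (simp add: odd_initial[simplified])
qed

lemma odd_values:
  "diamond_gf 1 W0 = d*e"
  "diamond_gf 3 W0 = (d*e)^2 * (a*b*g*h) * R"
  "diamond_gf 5 W0 = 2 * (d*e)^4 * (a*b*g*h)^2 * (c*f) * R^3"
  "diamond_gf 7 W0 = 2^3 * (d*e)^7 * (a*b*g*h)^4 * (c*f)^3 * R^5"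
  "diamond_gf 9 W0 = 2^5 * (d*e)^10 * (a*b*g*h)^7 * (c*f)^5 * R^8"
  "diamond_gf 11 W0 = 2^8 * (d*e)^14 * (a*b*g*h)^10 * (c*f)^8 * R^12"
proof -
  have lessThan: "{..<1::nat} = {0}" "{..<2::nat} = {0, 1}" "{..<3::nat} = {0, 1, 2}" "{..<4::nat} = {0, 1, 2, 3}"
    "{..<5::nat} = {0, 1, 2, 3, 4}"
    by auto
  show "diamond_gf 1 W0 = d*e"
    "diamond_gf 3 W0 = (d*e)^2 * (a*b*g*h) * R"
    "diamond_gf 5 W0 = 2 * (d*e)^4 * (a*b*g*h)^2 * (c*f) * R^3"
    "diamond_gf 7 W0 = 2^3 * (d*e)^7 * (a*b*g*h)^4 * (c*f)^3 * R^5"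
    "diamond_gf 9 W0 = 2^5 * (d*e)^10 * (a*b*g*h)^7 * (c*f)^5 * R^8"
    "diamond_gf 11 W0 = 2^8 * (d*e)^14 * (a*b*g*h)^10 * (c*f)^8 * R^12"
    using odd_product[of 0] odd_product[of 1] odd_product[of 2] odd_product[of 3] odd_product[of 4] odd_product[of 5]
    by (simp_all add: lessThan two_step_exponents_def odd_linear_exponents_def odd_constant_exponents_def odd_initial_exponents_def laurent)
qed

end

section \<open>Irreducibility\<close>

lemma keys_times_obtain:
  assumes "k \<in> Poly_Mapping.keys (p * q)"
  obtains m n where "m \<in> Poly_Mapping.keys p" "n \<in> Poly_Mapping.keys q" "k = m + n"
  using assms keys_mult[of p q] by blast

text \<open>The components of \<open>p\<close> and \<open>q\<close> of maximal degree in \<open>i\<close> have a nonzero product.\<close>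

lemma degree_in_mult:
  fixes p q :: "('n::linorder \<Rightarrow>\<^sub>0 nat) \<Rightarrow>\<^sub>0 'k::idom"
  assumes "m \<in> Poly_Mapping.keys p" "n \<in> Poly_Mapping.keys q"
  obtains k where "k \<in> Poly_Mapping.keys (p * q)" "Poly_Mapping.lookup m i + Poly_Mapping.lookup n i \<le> Poly_Mapping.lookup k i"
proof -
  have split: "\<exists>t l N. p = t + l \<and> t \<noteq> 0 \<and> Poly_Mapping.lookup m i \<le> N \<and> (\<forall>k\<in>Poly_Mapping.keys t. Poly_Mapping.lookup k i = N)
      \<and> (\<forall>k\<in>Poly_Mapping.keys l. Poly_Mapping.lookup k i < N)"
    if m: "m \<in> Poly_Mapping.keys p" for p :: "('n \<Rightarrow>\<^sub>0 nat) \<Rightarrow>\<^sub>0 'k" and m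
  proof -
    define N where "N = Max ((\<lambda>k. Poly_Mapping.lookup k i) ` Poly_Mapping.keys p)"
    have le: "Poly_Mapping.lookup k i \<le> N" if "k \<in> Poly_Mapping.keys p" for k
      unfolding N_def using that by (intro Max_ge) auto
    have "N \<in> (\<lambda>k. Poly_Mapping.lookup k i) ` Poly_Mapping.keys p"
      unfolding N_def using m by (intro Max_in) auto
    then obtain k0 where k0: "k0 \<in> Poly_Mapping.keys p" "Poly_Mapping.lookup k0 i = N" by blast
    define t where "t = (\<Sum>k\<in>{k\<in>Poly_Mapping.keys p. Poly_Mapping.lookup k i = N}. Poly_Mapping.single k (Poly_Mapping.lookup p k))"
    have t: "Poly_Mapping.lookup t k = (if Poly_Mapping.lookup k i = N then Poly_Mapping.lookup p k else 0)" for k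
      by (auto simp: t_def lookup_sum lookup_single when_def in_keys_iff)
    have "Poly_Mapping.lookup t k0 \<noteq> 0" using k0 by (simp add: t in_keys_iff)
    then have "t \<noteq> 0" by auto
    moreover have "\<forall>k\<in>Poly_Mapping.keys t. Poly_Mapping.lookup k i = N"
      by (auto simp: in_keys_iff t split: if_splits)
    moreover have "Poly_Mapping.lookup k i < N" if "k \<in> Poly_Mapping.keys (p - t)" for k
    proof -
      have "Poly_Mapping.lookup k i \<noteq> N" "k \<in> Poly_Mapping.keys p"
        using that by (auto simp: in_keys_iff lookup_minus t split: if_splits)
      then show ?thesis using le[of k] by simp
    qed
    ultimately show ?thesis using le[OF m] by (intro exI[of _ t] exI[of _ "p - t"] exI[of _ N]) simp
  qed
  obtain t l N where p: "p = t + l" "t \<noteq> 0" "Poly_Mapping.lookup m i \<le> N" "\<forall>k\<in>Poly_Mapping.keys t. Poly_Mapping.lookup k i = N"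
      "\<forall>k\<in>Poly_Mapping.keys l. Poly_Mapping.lookup k i < N"
    using split[OF assms(1)] by blast
  obtain t' l' N' where q: "q = t' + l'" "t' \<noteq> 0" "Poly_Mapping.lookup n i \<le> N'" "\<forall>k\<in>Poly_Mapping.keys t'. Poly_Mapping.lookup k i = N'"
      "\<forall>k\<in>Poly_Mapping.keys l'. Poly_Mapping.lookup k i < N'"
    using split[OF assms(2)] by blast
  have "t * t' \<noteq> 0" using p q by simp
  then obtain k where k: "k \<in> Poly_Mapping.keys (t * t')"
    by (metis keys_eq_empty equals0I)
  then have deg: "Poly_Mapping.lookup k i = N + N'"
    using p q by (elim keys_times_obtain) (simp add: lookup_add)
  \<comment> \<open>These three products have degree below \<open>N + N'\<close> in
    \<open>i\<close>, so they cannot cancel the term \<open>k\<close> of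
    \<open>t * t'\<close>.\<close>
  have "k \<notin> Poly_Mapping.keys (t * l')" "k \<notin> Poly_Mapping.keys (l * t')" "k \<notin> Poly_Mapping.keys (l * l')"
    using p q deg by (auto elim!: keys_times_obtain simp: lookup_add dest!: bspec)
  moreover have "p * q = t * t' + (t * l' + l * t' + l * l')"
    by (simp add: p q algebra_simps)
  ultimately have "k \<in> Poly_Mapping.keys (p * q)"
    using k by (simp add: in_keys_iff lookup_add)
  then show ?thesis using deg p q that by simp
qed

definition restrict_exponent :: "'n set \<Rightarrow> ('n \<Rightarrow>\<^sub>0 nat) \<Rightarrow> ('n \<Rightarrow>\<^sub>0 nat)" where
  "restrict_exponent V m = Abs_poly_mapping (\<lambda>i. Poly_Mapping.lookup m i when i \<in> V)"

lemma lookup_restrict_exponent: "Poly_Mapping.lookup (restrict_exponent V m) i = (if i \<in> V then Poly_Mapping.lookup m i else 0)"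
proof -
  have "finite {i. (Poly_Mapping.lookup m i when i \<in> V) \<noteq> 0}"
    by (rule finite_subset[OF _ finite_lookup[of m]]) (auto simp: when_def split: if_splits)
  then show ?thesis by (simp add: restrict_exponent_def when_def)
qed

text \<open>A monomial splits in only one way into a part in the variables of \<open>V\<close> and a
  part in the others, so a single pair of terms contributes to each coefficient of the
  product.\<close>

lemma lookup_mult_disjoint_variables:
  fixes p q :: "('n::linorder \<Rightarrow>\<^sub>0 nat) \<Rightarrow>\<^sub>0 'k::idom"
  assumes p: "\<And>m i. m \<in> Poly_Mapping.keys p \<Longrightarrow> i \<notin> V \<Longrightarrow> Poly_Mapping.lookup m i = 0"
    and q: "\<And>m i. m \<in> Poly_Mapping.keys q \<Longrightarrow> i \<in> V \<Longrightarrow> Poly_Mapping.lookup m i = 0"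
  shows "Poly_Mapping.lookup (p * q) k = Poly_Mapping.lookup p (restrict_exponent V k) * Poly_Mapping.lookup q (restrict_exponent (- V) k)"
proof -
  define m n where "m = restrict_exponent V k" and "n = restrict_exponent (- V) k"
  have k: "k = m + n"
    by (rule poly_mapping_eqI) (simp add: m_def n_def lookup_add lookup_restrict_exponent)
  have unique: "m' = m \<and> n' = n" if "m' \<in> Poly_Mapping.keys p" "n' \<in> Poly_Mapping.keys q" "k = m' + n'" for m' n'
  proof -
    have "Poly_Mapping.lookup m' i = Poly_Mapping.lookup m i \<and> Poly_Mapping.lookup n' i = Poly_Mapping.lookup n i" for i
      using p[OF that(1), of i] q[OF that(2), of i] that(3)
      by (cases "i \<in> V") (auto simp: m_def n_def lookup_add lookup_restrict_exponent)
    then show ?thesis by (simp add: poly_mapping_eqI)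
  qed
  \<comment> \<open>Without these two terms the remaining products can no longer produce
    \<open>k\<close>.\<close>
  define p' q' where "p' = p - Poly_Mapping.single m (Poly_Mapping.lookup p m)" and "q' = q - Poly_Mapping.single n (Poly_Mapping.lookup q n)"
  have keys: "Poly_Mapping.keys p' \<subseteq> Poly_Mapping.keys p - {m}" "Poly_Mapping.keys q' \<subseteq> Poly_Mapping.keys q - {n}"
    by (auto simp: p'_def q'_def in_keys_iff lookup_minus lookup_single when_def split: if_splits)
  have "k \<notin> Poly_Mapping.keys (p' * q)"
    using keys unique by (blast elim: keys_times_obtain)
  moreover have "k \<notin> Poly_Mapping.keys (Poly_Mapping.single m (Poly_Mapping.lookup p m) * q')"
  proof
    assume "k \<in> Poly_Mapping.keys (Poly_Mapping.single m (Poly_Mapping.lookup p m) * q')"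
    then obtain m' n' where *: "m' \<in> Poly_Mapping.keys (Poly_Mapping.single m (Poly_Mapping.lookup p m))"
        "n' \<in> Poly_Mapping.keys q'" "k = m' + n'"
      by (rule keys_times_obtain)
    then have "m' \<in> Poly_Mapping.keys p"
      by (auto simp: in_keys_iff split: if_splits)
    then show False using * keys unique by blast
  qed
  moreover have "p * q = Poly_Mapping.single m (Poly_Mapping.lookup p m) * Poly_Mapping.single n (Poly_Mapping.lookup q n)
      + (Poly_Mapping.single m (Poly_Mapping.lookup p m) * q' + p' * q)"
    by (simp add: p'_def q'_def algebra_simps)
  ultimately have "Poly_Mapping.lookup (p * q) k = Poly_Mapping.lookup p m * Poly_Mapping.lookup q n"
    by (simp add: in_keys_iff lookup_add mult_single k)
  then show ?thesis
    unfolding m_def n_def .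
qed

text \<open>
  In a factorization \<open>p * q\<close> of a multilinear polynomial no variable occurs in both factors. Exchanging the
  parts of two monomials that come from \<open>p\<close> and from \<open>q\<close> therefore preserves the product of their
  coefficients, but here \<open>1 * 2 \<noteq> 1 * 1\<close>.
\<close>

lemma irreducible_four_terms:
  fixes A B C D :: "'n::linorder \<Rightarrow>\<^sub>0 nat" and R :: "('n \<Rightarrow>\<^sub>0 nat) \<Rightarrow>\<^sub>0 'k::{idom,ring_char_0}"
  assumes R: "R = Poly_Mapping.single A 1 + Poly_Mapping.single B 1 + Poly_Mapping.single C 1 + Poly_Mapping.single D 2"
    and AD: "\<And>i. Poly_Mapping.lookup A i + Poly_Mapping.lookup D i = 1" and BC: "A + D = B + C"
    and distinct: "A \<noteq> B" "A \<noteq> C" "A \<noteq> D" "B \<noteq> C" "B \<noteq> D" "C \<noteq> D"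
  shows "irreducible R"
proof -
  have coeffs: "Poly_Mapping.lookup R A = 1" "Poly_Mapping.lookup R B = 1" "Poly_Mapping.lookup R C = 1"
    "Poly_Mapping.lookup R D = 2"
    using distinct by (simp_all add: R lookup_add lookup_single when_def)
  have keys: "k = A \<or> k = B \<or> k = C \<or> k = D" if "Poly_Mapping.lookup R k \<noteq> 0" for k
    using that by (auto simp: R lookup_add lookup_single when_def split: if_splits)
  have BC': "Poly_Mapping.lookup B i + Poly_Mapping.lookup C i = 1" for i
    using AD[of i] BC by (metis lookup_add)
  have multilinear: "Poly_Mapping.lookup k i \<le> 1" if "k \<in> Poly_Mapping.keys R" for k i
    using keys[of k] that AD[of i] BC'[of i] by (auto simp: in_keys_iff)
  show ?thesis
  proof (rule irreducibleI)
    show "R \<noteq> 0"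
      using coeffs(1) by auto
    show "\<not> R dvd 1"
    proof
      assume "R dvd 1"
      then obtain s where s: "1 = R * s" by (elim dvdE)
      then have "s \<noteq> 0" by auto
      then obtain n where n: "n \<in> Poly_Mapping.keys s" by (metis keys_eq_empty equals0I)
      \<comment> \<open>Any variable will do: \<open>A\<close> and \<open>D\<close> together contain
        each variable once, so \<open>R\<close> has positive degree in \<open>i\<close>, and so
        would its product with \<open>s\<close>.\<close>
      fix i :: 'n
      have "Poly_Mapping.lookup A i = 1 \<or> Poly_Mapping.lookup D i = 1"
        using AD[of i] by linarith
      moreover have "A \<in> Poly_Mapping.keys R" "D \<in> Poly_Mapping.keys R"
        using coeffs by (simp_all add: in_keys_iff)
      ultimately obtain m where m: "m \<in> Poly_Mapping.keys R" "Poly_Mapping.lookup m i = 1"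
        by blast
      obtain k where "k \<in> Poly_Mapping.keys (1 :: ('n \<Rightarrow>\<^sub>0 nat) \<Rightarrow>\<^sub>0 'k)" "1 \<le> Poly_Mapping.lookup k i"
        using degree_in_mult[OF m(1) n, of i] m(2) s by (metis le_add1 order_trans)
      then show False by simp
    qed
  next
    fix p q assume pq: "R = p * q"
    define V where "V = {i. \<exists>m\<in>Poly_Mapping.keys p. Poly_Mapping.lookup m i \<noteq> 0}"
    have V: "Poly_Mapping.lookup m i = 0" if "m \<in> Poly_Mapping.keys p" "i \<notin> V" for m i
      using that by (auto simp: V_def)
    have nV: "Poly_Mapping.lookup n i = 0" if n: "n \<in> Poly_Mapping.keys q" and "i \<in> V" for n i
    proof -
      obtain m where m: "m \<in> Poly_Mapping.keys p" "Poly_Mapping.lookup m i \<noteq> 0"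
        using \<open>i \<in> V\<close> by (auto simp: V_def)
      obtain k where "k \<in> Poly_Mapping.keys R" "Poly_Mapping.lookup m i + Poly_Mapping.lookup n i \<le> Poly_Mapping.lookup k i"
        using degree_in_mult[OF m(1) n] pq by metis
      then show ?thesis using multilinear[of k i] m(2) by simp
    qed
    define mix where "mix k l = restrict_exponent V k + restrict_exponent (- V) l" for k l :: "'n \<Rightarrow>\<^sub>0 nat"
    have lookup_mix: "Poly_Mapping.lookup (mix k l) i
        = (if i \<in> V then Poly_Mapping.lookup k i else Poly_Mapping.lookup l i)" for k l i
      by (simp add: mix_def lookup_add lookup_restrict_exponent)
    have factor: "Poly_Mapping.lookup R k
        = Poly_Mapping.lookup p (restrict_exponent V k) * Poly_Mapping.lookup q (restrict_exponent (- V) k)" for k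
      unfolding pq by (rule lookup_mult_disjoint_variables) (use V nV in auto)
    have "restrict_exponent V (mix k l) = restrict_exponent V k"
      "restrict_exponent (- V) (mix k l) = restrict_exponent (- V) l" for k l
      by (rule poly_mapping_eqI; simp add: lookup_restrict_exponent lookup_mix)+
    then have "Poly_Mapping.lookup R (mix A D) * Poly_Mapping.lookup R (mix D A)
        = Poly_Mapping.lookup R A * Poly_Mapping.lookup R D"
      unfolding factor by (simp add: ac_simps)
    then have exchange: "Poly_Mapping.lookup R (mix A D) * Poly_Mapping.lookup R (mix D A) = 2"
      using coeffs by simp
    have AD_neq: "Poly_Mapping.lookup A i \<noteq> Poly_Mapping.lookup D i" for i
      using AD[of i] by presburger
    have sum_mix: "mix A D + mix D A = A + D"
      by (rule poly_mapping_eqI) (simp add: lookup_add lookup_mix)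
    have "Poly_Mapping.lookup R (mix A D) \<noteq> 0"
      using exchange by auto
    then consider "mix A D = A" | "mix A D = B" | "mix A D = C" | "mix A D = D"
      using keys by blast
    then show "p dvd 1 \<or> q dvd 1"
    proof cases
      \<comment> \<open>\<open>A\<close> and \<open>D\<close> differ at every variable, so
        \<open>V\<close> is everything and \<open>q\<close> is constant. The coefficient 1 of
        \<open>A\<close> makes this constant a unit even if the coefficients do not form a
        field.\<close>
      case 1
      have "i \<in> V" for i
        using AD_neq[of i] arg_cong[OF 1, of "\<lambda>k. Poly_Mapping.lookup k i"] by (simp add: lookup_mix split: if_splits)
      then have "V = UNIV" by auto
      then have "n = 0" if "n \<in> Poly_Mapping.keys q" for n
        using nV[OF that] by (auto intro: poly_mapping_eqI)
      then have q: "q = Poly_Mapping.single 0 (Poly_Mapping.lookup q 0)"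
        by (intro poly_mapping_eqI) (auto simp: lookup_single when_def in_keys_iff)
      have "restrict_exponent (- V) A = 0"
        using \<open>V = UNIV\<close> by (intro poly_mapping_eqI) (simp add: lookup_restrict_exponent)
      then have "Poly_Mapping.lookup p (restrict_exponent V A) * Poly_Mapping.lookup q 0 = 1"
        using factor[of A] coeffs(1) by simp
      then have "1 = q * Poly_Mapping.single 0 (Poly_Mapping.lookup p (restrict_exponent V A))"
        by (subst q) (simp add: mult_single mult.commute)
      then show ?thesis by (metis dvd_triv_left)
    next
      case 4
      have "i \<notin> V" for i
        using AD_neq[of i] arg_cong[OF 4, of "\<lambda>k. Poly_Mapping.lookup k i"] by (auto simp: lookup_mix split: if_splits)
      then have "V = {}" by auto
      then have "m = 0" if "m \<in> Poly_Mapping.keys p" for m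
        using V[OF that] by (auto intro: poly_mapping_eqI)
      then have p: "p = Poly_Mapping.single 0 (Poly_Mapping.lookup p 0)"
        by (intro poly_mapping_eqI) (auto simp: lookup_single when_def in_keys_iff)
      have "restrict_exponent V A = 0"
        using \<open>V = {}\<close> by (intro poly_mapping_eqI) (simp add: lookup_restrict_exponent)
      then have "Poly_Mapping.lookup p 0 * Poly_Mapping.lookup q (restrict_exponent (- V) A) = 1"
        using factor[of A] coeffs(1) by simp
      then have "1 = p * Poly_Mapping.single 0 (Poly_Mapping.lookup q (restrict_exponent (- V) A))"
        by (subst p) (simp add: mult_single)
      then show ?thesis by (metis dvd_triv_left)
    next
      \<comment> \<open>By \<open>BC\<close> the opposite exchange yields \<open>C\<close>, and the
        coefficients of \<open>B\<close> and \<open>C\<close> have product 1 instead of 2.\<close>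
      case 2
      then have "mix D A = C" using sum_mix BC by simp
      then show ?thesis using exchange 2 coeffs by simp
    next
      case 3
      then have "mix D A = B" using sum_mix BC by (simp add: add.commute[of B C])
      then show ?thesis using exchange 3 coeffs by simp
    qed
  qed
qed

lemma exhaust_8: "i = 0 \<or> i = 1 \<or> i = 2 \<or> i = 3 \<or> i = 4 \<or> i = 5 \<or> i = 6 \<or> i = 7" for i :: 8
proof (induct i)
  case (of_int z)
  then have "0 \<le> z" "z < 8" by simp_all
  then have "z = 0 \<or> z = 1 \<or> z = 2 \<or> z = 3 \<or> z = 4 \<or> z = 5 \<or> z = 6 \<or> z = 7" by arith
  then show ?case by auto
qed

section \<open>Passing to the fraction field\<close>

lemma to_fract_power: "to_fract (x ^ n) = to_fract x ^ n"
  by (induction n) simp_all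

lemma to_fract_2: "to_fract 2 = 2"
  using to_fract_add[of 1 1] by simp

lemma aztec_gf_diamond_gf:
  assumes "length L = 4" "\<forall>l\<in>set L. length l = 4"
  shows "aztec_gf (mat_of_rows_list 4 L) n = diamond_gf n L"
proof -
  have "mat_of_rows_list 4 L $$ ((r - 1) mod dim_row (mat_of_rows_list 4 L), (s - 1) mod dim_col (mat_of_rows_list 4 L))
      = periodic L r s" for r s
    using assms by (simp add: mat_of_rows_list_def periodic_def)
  then show ?thesis
    unfolding aztec_gf_def matching_gf_region_gf diamond_gf_def aztec_weight_edge by simp
qed

lemma diamond_gf_to_fract:
  assumes "length L = 4" "\<forall>l\<in>set L. length l = 4"
  shows "to_fract (diamond_gf n L) = diamond_gf n (map (map to_fract) L)"
proof -
  have "periodic (map (map to_fract) L) r s = to_fract (periodic L r s)" for r s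
    using assms by (simp add: periodic_def)
  then have "periodic (map (map to_fract) L) = (\<lambda>r s. to_fract (periodic L r s))"
    by blast
  then show ?thesis
    unfolding diamond_gf_def by (simp only:) (rule region_gf_hom; simp)
qed

lemma indet_mult:
  "indet i * indet j = Poly_Mapping.single (Poly_Mapping.single i 1 + Poly_Mapping.single j 1) 1"
  "Poly_Mapping.single m c * indet j = Poly_Mapping.single (m + Poly_Mapping.single j 1) c"
  "2 * indet i = Poly_Mapping.single (Poly_Mapping.single i 1) 2"
  by (simp_all add: indet_def mult_single flip: single_numeral)

lemma lookup_unit_exponent: "Poly_Mapping.lookup (Poly_Mapping.single i (1::nat)) j = (if i = j then 1 else 0)"
  by (simp add: lookup_single when_def)

theorem theorem3p8:
  fixes a b c d e f g h R :: "'k::{idom,ring_char_0} poly8"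
    and M :: "'k poly8 mat"
  assumes indets: "a = indet 0" "b = indet 1" "c = indet 2" "d = indet 3"
      "e = indet 4" "f = indet 5" "g = indet 6" "h = indet 7"
    and M: "M = mat_of_rows_list 4
      [[a, d, d, a],
       [e, 0, g, e],
       [f, h, 0, f],
       [b, c, c, b]]"
    and R: "R = a*b*g*h + a*c*f*g + b*d*e*h + 2*c*d*e*f"
  shows "irreducible R
    \<and> aztec_gf M 0 = 1
    \<and> aztec_gf M 1 = d*e
    \<and> aztec_gf M 2 = a*b*R
    \<and> aztec_gf M 3 = (d*e)^2 * (a*b*g*h) * R
    \<and> aztec_gf M 4 = 2 * (a*b)^2 * (c*d*e*f) * R^3
    \<and> aztec_gf M 5 = 2 * (d*e)^4 * (a*b*g*h)^2 * (c*f) * R^3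
    \<and> aztec_gf M 6 = 2^3 * (a*b)^4 * (c*d*e*f)^3 * (g*h) * R^5
    \<and> aztec_gf M 7 = 2^3 * (d*e)^7 * (a*b*g*h)^4 * (c*f)^3 * R^5
    \<and> aztec_gf M 8 = 2^5 * (a*b)^7 * (c*d*e*f)^5 * (g*h)^3 * R^8
    \<and> aztec_gf M 9 = 2^5 * (d*e)^10 * (a*b*g*h)^7 * (c*f)^5 * R^8
    \<and> aztec_gf M 10 = 2^8 * (a*b)^10 * (c*d*e*f)^8 * (g*h)^5 * R^12
    \<and> aztec_gf M 11 = 2^8 * (d*e)^14 * (a*b*g*h)^10 * (c*f)^8 * R^12
    \<and> (\<forall>n. 2*n \<ge> 12 \<longrightarrow>
         aztec_gf M (2*n) =
           2^(4*n - 12) * (a*b)^(4*n - 10) * (c*d*e*f)^(4*n - 12) * (g*h)^(4*n - 16)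
             * R^(4*n - 8) * aztec_gf M (2*n - 12))
    \<and> (\<forall>n. 2*n - 1 \<ge> 13 \<longrightarrow>
         aztec_gf M (2*n - 1) =
           2^(4*n - 16) * (d*e)^(4*n - 10) * (a*b*g*h)^(4*n - 14) * (c*f)^(4*n - 16)
             * R^(4*n - 12) * aztec_gf M (2*n - 13))"
proof -
  define x :: "8 \<Rightarrow> (8 \<Rightarrow>\<^sub>0 nat)" where "x i = Poly_Mapping.single i 1" for i
  have lookup_x: "Poly_Mapping.lookup (x i) j = (if i = j then 1 else 0)" for i j
    unfolding x_def by (rule lookup_unit_exponent)
  have monomials: "R = Poly_Mapping.single (x 0 + x 1 + x 6 + x 7) 1 + Poly_Mapping.single (x 0 + x 2 + x 5 + x 6) 1
      + Poly_Mapping.single (x 1 + x 3 + x 4 + x 7) 1 + Poly_Mapping.single (x 2 + x 3 + x 4 + x 5) 2"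
    unfolding R indets indet_mult x_def ..
  have irred: "irreducible R"
    using monomials
  proof (rule irreducible_four_terms)
    show "Poly_Mapping.lookup (x 0 + x 1 + x 6 + x 7) i + Poly_Mapping.lookup (x 2 + x 3 + x 4 + x 5) i = 1" for i
      using exhaust_8[of i] by (elim disjE) (simp_all add: lookup_add lookup_x)
    show "x 0 + x 1 + x 6 + x 7 + (x 2 + x 3 + x 4 + x 5) = x 0 + x 2 + x 5 + x 6 + (x 1 + x 3 + x 4 + x 7)"
      by (simp add: ac_simps)
    have neq: "m \<noteq> m'" if "Poly_Mapping.lookup m i \<noteq> Poly_Mapping.lookup m' i" for m m' :: "8 \<Rightarrow>\<^sub>0 nat" and i
      using that by blast
    show "x 0 + x 1 + x 6 + x 7 \<noteq> x 0 + x 2 + x 5 + x 6" "x 0 + x 1 + x 6 + x 7 \<noteq> x 1 + x 3 + x 4 + x 7"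
      "x 0 + x 1 + x 6 + x 7 \<noteq> x 2 + x 3 + x 4 + x 5" "x 0 + x 2 + x 5 + x 6 \<noteq> x 1 + x 3 + x 4 + x 7"
      "x 0 + x 2 + x 5 + x 6 \<noteq> x 2 + x 3 + x 4 + x 5" "x 1 + x 3 + x 4 + x 7 \<noteq> x 2 + x 3 + x 4 + x 5"
      by (rule neq[of _ 1], simp add: lookup_add lookup_x; fail | rule neq[of _ 0], simp add: lookup_add lookup_x; fail)+
  qed
  have indet_nonzero: "indet i \<noteq> (0 :: 'k poly8)" for i
    by (metis indet_def lookup_single_eq lookup_zero zero_neq_one)
  \<comment> \<open>The variable \<open>i\<close> occurs in the first monomial only, so the two
    terms cannot merge. It is applied with \<open>t = 1\<close> for \<open>S\<close>,
    \<open>T\<close> and with \<open>t = 2\<close> for \<open>P\<close>, \<open>Q\<close>.\<close>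
  have binomial_nonzero: "Poly_Mapping.single (x i + x j) 1 + Poly_Mapping.single (x k + x l) t \<noteq> (0 :: 'k poly8)"
    if "i \<noteq> k" "i \<noteq> l" for i j k l t
  proof -
    have "Poly_Mapping.lookup (x i + x j) i \<noteq> Poly_Mapping.lookup (x k + x l) i"
      using that by (simp add: lookup_add lookup_x)
    then have "x i + x j \<noteq> x k + x l" by metis
    then have "Poly_Mapping.lookup (Poly_Mapping.single (x i + x j) 1 + Poly_Mapping.single (x k + x l) t) (x i + x j) = (1 :: 'k)"
      by (simp add: lookup_add lookup_single when_def)
    then show ?thesis by (metis lookup_zero zero_neq_one)
  qed
  define rows where "rows = [[a, d, d, a], [e, 0, g, e], [f, h, 0, f], [b, c, c, b]]"
  let ?F = "to_fract :: 'k poly8 \<Rightarrow> 'k poly8 fract"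
  interpret periodic_weights "?F a" "?F b" "?F c" "?F d" "?F e" "?F f" "?F g" "?F h" "?F R"
    "?F (a*g + d*e)" "?F (b*h + c*f)" "?F (a*g + 2*d*e)" "?F (b*h + 2*c*f)"
    "monomial [2, ?F a, ?F b, ?F c, ?F d, ?F e, ?F f, ?F g, ?F h, ?F R,
      ?F (a*g + d*e), ?F (b*h + c*f), ?F (a*g + 2*d*e), ?F (b*h + 2*c*f)]"
  proof
    show "?F a \<noteq> 0" "?F b \<noteq> 0" "?F c \<noteq> 0" "?F d \<noteq> 0" "?F e \<noteq> 0" "?F f \<noteq> 0" "?F g \<noteq> 0" "?F h \<noteq> 0"
      by (simp_all add: indets indet_nonzero)
    show "?F R \<noteq> 0"
      using irred by auto
    have "a*g + d*e \<noteq> 0" "b*h + c*f \<noteq> 0" "a*g + 2*d*e \<noteq> 0" "b*h + 2*c*f \<noteq> 0"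
      unfolding indets indet_mult x_def[symmetric] by (rule binomial_nonzero; simp)+
    then show "?F (a*g + d*e) \<noteq> 0" "?F (b*h + c*f) \<noteq> 0" "?F (a*g + 2*d*e) \<noteq> 0" "?F (b*h + 2*c*f) \<noteq> 0"
      by (simp_all only: to_fract_eq_0_iff not_False_eq_True)
    show "(2 :: 'k poly8 fract) \<noteq> 0"
      unfolding to_fract_2[symmetric] by simp
  qed (simp_all add: R to_fract_2)
  have W0: "W0 = map (map ?F) rows"
    by (simp add: W0_def rows_def)
  have rows: "length rows = 4" "\<forall>l\<in>set rows. length l = 4"
    by (auto simp: rows_def)
  have gf: "?F (aztec_gf M n) = diamond_gf n W0" for n
    unfolding M rows_def[symmetric] W0 aztec_gf_diamond_gf[OF rows] by (rule diamond_gf_to_fract[OF rows])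
  \<comment> \<open>Injectivity of the embedding brings identities of fractions back to
    polynomials.\<close>
  have gf_eqI: "aztec_gf M n = y" if "diamond_gf n W0 = ?F y" for n y
    using that gf[of n] by simp
  note to_fract = to_fract_mult to_fract_power to_fract_2 to_fract_1
  have even_rec: "aztec_gf M (2*n) =
           2^(4*n - 12) * (a*b)^(4*n - 10) * (c*d*e*f)^(4*n - 12) * (g*h)^(4*n - 16)
             * R^(4*n - 8) * aztec_gf M (2*n - 12)" if "2 * n \<ge> 12" for n
  proof -
    \<comment> \<open>With this bound none of the subtractions in the exponents is
      truncated.\<close>
    have "6 \<le> n" using that by simp
    then obtain q where n: "n = q + 6" by (metis le_add_diff_inverse2)
    have exponents: "4*n - 12 = 4*q + 12" "4*n - 10 = 4*q + 14" "4*n - 16 = 4*q + 8" "4*n - 8 = 4*q + 16"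
      "2*n - 12 = 2*q" "2*n = 2*(q + 6)"
      by (simp_all add: n)
    \<comment> \<open>The differences are rewritten before \<open>2*n\<close> itself, since
      \<open>2*n\<close> also occurs inside \<open>2*n - 12\<close>.\<close>
    show ?thesis
      unfolding exponents(1-5) unfolding exponents(6) by (rule gf_eqI, unfold even_recurrence to_fract gf)
        (simp only: power_add power_mult power_mult_distrib, simp only: mult_ac)
  qed
  have odd_rec: "aztec_gf M (2*n - 1) =
           2^(4*n - 16) * (d*e)^(4*n - 10) * (a*b*g*h)^(4*n - 14) * (c*f)^(4*n - 16)
             * R^(4*n - 12) * aztec_gf M (2*n - 13)" if "2 * n - 1 \<ge> 13" for n
  proof -
    \<comment> \<open>The order drops by twelve, from \<open>2*(q + 6) + 1\<close> to
      \<open>2*q + 1\<close>, which corresponds to \<open>n = q + 7\<close>.\<close>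
    have "7 \<le> n" using that by simp
    then obtain q where n: "n = q + 7" by (metis le_add_diff_inverse2)
    have exponents: "4*n - 16 = 4*q + 12" "4*n - 10 = 4*q + 18" "4*n - 14 = 4*q + 14" "4*n - 12 = 4*q + 16"
      "2*n - 13 = 2*q + 1" "2*n - 1 = 2*(q + 6) + 1"
      by (simp_all add: n)
    show ?thesis
      unfolding exponents(1-5) unfolding exponents(6) by (rule gf_eqI, unfold odd_recurrence to_fract gf)
        (simp only: power_add power_mult power_mult_distrib, simp only: mult_ac)
  qed
  show ?thesis
    by (intro conjI irred allI impI even_rec odd_rec; (assumption | rule gf_eqI, simp only: even_values odd_values to_fract))
qed

end
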